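(* There is an absolute constant $K>0$ such that the following holds. Let $N\ge1$ be an integer, $F=\left(e^{2\pi i(j-1)(k-1)/N}\right)_{j,k=1}^N\in\mathbb{C}^{N\times N}$, let $S\subset[N]$ be an arbitrary nonempty subset and $T\subset[N]$ a nonempty cyclically contiguous subset. Then $$\log\kappa(F_{S,T})\le\frac{2GN}{\pi}+K,$$ where $G=\sum_{k=0}^\infty\frac{(-1)^k}{(2k+1)^2}$ is Catalan's constant. If both $S,T\subset[N]$ are (nonempty) cyclically contiguous subsets, then $$\log\kappa(F_{S,T})\le\frac{2GN}{\pi}-\frac12\log N+K,$$ and equality is achieved up to the error term when $|S|=|T|=\lceil N/2\rceil$ and both $S,T$ are cyclically contiguous, i.e. in that case $$\left|\log\kappa(F_{S,T})-\left(\frac{2GN}{\pi}-\frac12\log N\right)\right|\le K.$$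
   Context: $[N]=\{1,\ldots,N\}$. A subset $S\subset[N]$ is cyclically contiguous if it equals a set of consecutive integers modulo $N$. For $A\in\mathbb{C}^{N\times N}$ and $S,T\subset[N]$, $A_{S,T}$ is the $|S|\times|T|$ submatrix of $A$ with rows indexed by $S$ and columns indexed by $T$, and $\kappa(A_{S,T})=\sigma_1(A_{S,T})/\sigma_{\min(|S|,|T|)}(A_{S,T})$ is its condition number, with $\sigma_1\ge\sigma_2\ge\cdots$ the singular values. (The terms with $K$ spell out the notation $\pm O(1)$.) *)

theory Defs
  imports
    Complex_Main
    "HOL-Library.Extended_Real"
    "HOL-Number_Theory.Cong"
    "Jordan_Normal_Form.Schur_Decomposition"
    "Jordan_Normal_Form.DL_Submatrix"
begin

definition catalan_const :: real where
  "catalan_const = (\<Sum>k. (- 1) ^ k / (2 * real k + 1) ^ 2)"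

(* Matrices are indexed from 0, so the (j-1)(k-1) of the 1-based convention becomes j * k. *)
definition fourier_mat :: "nat \<Rightarrow> complex mat" where
  "fourier_mat N = mat N N (\<lambda>(j, k). exp (2 * of_real pi * \<i> * of_nat j * of_nat k / of_nat N))"

(* The index sets S and T consist of 1-based indices; submatrix expects 0-based ones. *)
definition submat :: "'a mat \<Rightarrow> nat set \<Rightarrow> nat set \<Rightarrow> 'a mat" where
  "submat A S T = submatrix A ((\<lambda>s. s - 1) ` S) ((\<lambda>t. t - 1) ` T)"

definition cyclically_contiguous :: "nat \<Rightarrow> nat set \<Rightarrow> bool" where
  "cyclically_contiguous N S \<longleftrightarrow> (\<exists>a l. S = {s \<in> {1..N}. \<exists>i<l. [s = a + i] (mod N)})"

(* The square roots of the eigenvalues of A* A with algebraic multiplicity, in decreasing order.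
   These eigenvalues are real and nonnegative, so Re loses nothing.  The list has dim_col A
   entries; those beyond position min (dim_row A) (dim_col A) vanish. *)
definition singular_values :: "complex mat \<Rightarrow> real list" where
  "singular_values A = rev (sorted_list_of_multiset
     (image_mset (\<lambda>z. sqrt (Re z)) (proots (char_poly (mat_adjoint A * A)))))"

(* 1-based: sigma A 1 is the largest singular value *)
definition sigma :: "complex mat \<Rightarrow> nat \<Rightarrow> real" where
  "sigma A i = singular_values A ! (i - 1)"

(* Extended-real valued, so that a rank-deficient matrix has condition number \<infinity>
   rather than the value 0 that real division by zero would give. *)
definition cond_number :: "complex mat \<Rightarrow> ereal" where
  "cond_number A =
     (let \<sigma> = sigma A (min (dim_row A) (dim_col A))
      in if \<sigma> = 0 then \<infinity> else ereal (sigma A 1 / \<sigma>))"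

definition log_ereal :: "ereal \<Rightarrow> ereal" where
  "log_ereal x = (case x of ereal r \<Rightarrow> if r > 0 then ereal (ln r) else - \<infinity>
                   | PInfty \<Rightarrow> \<infinity> | MInfty \<Rightarrow> - \<infinity>)"

end

theory Submission
  imports
    Defs
    "HOL-Analysis.Complex_Transcendental"
    "Jordan_Normal_Form.Spectral_Radius"
begin

text \<open>Row factors of modulus one and permutations do not change singular values, so the submatrix with
a cyclic interval of \<open>q\<close> columns is the Vandermonde matrix that evaluates polynomials \<open>f\<close> of degree
below \<open>q\<close> at a set \<open>I\<close> of \<open>N\<close>-th roots of unity (\<open>fourier_submatrix_phased_vandermonde\<close>). The largest
singular value is at most \<open>sqrt N\<close> by Parseval. For the smallest one, discarding rows or columns reduces
the problem to \<open>card I = q\<close>. There the values of \<open>f\<close> at the remaining roots of unity are interpolated from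
those on \<open>I\<close>, and Parseval over all \<open>N\<close> roots of unity bounds the coefficients of \<open>f\<close> by its values on \<open>I\<close>.
The loss is \<open>1 + lagr_energy\<close>, where the energy is the sum of the squared absolute values
of all Lagrange basis polynomials at the roots of unity outside \<open>I\<close>. Hence the condition number is at most the
square root of \<open>1 + lagr_energy\<close>.

The product of the distances from one \<open>N\<close>-th root of unity to all others is \<open>N\<close>. This turns each value of a
Lagrange basis polynomial into \<open>1/N\<close> times a product of \<open>N - 1\<close> chords (\<open>cmod_lagr\<close>): one joins the two nodes
\<open>s\<close> and \<open>j\<close>, the others start at \<open>j\<close> and end in \<open>I\<close>, or start at \<open>s\<close> and end outside \<open>I\<close>. With
\<open>h(k) = ln (2 sin (\<pi> k / N))\<close>, the logarithm of the product of the latter is a sum of \<open>h\<close> over two sets of indices with \<open>N - 2\<close> elements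
in total. Subtracting the level \<open>h(N/4) = ln 2 / 2\<close> from every term costs a fixed amount, and afterwards each
of the two sums is at most the sum of the positive parts, that is, the sum over \<open>N/4 \<le> k \<le> 3N/4\<close>.
Up to scaling, the antiderivative of \<open>h\<close> is Clausen's function, whose value at \<open>\<pi>/2\<close> is Catalan's constant, so each value
of a Lagrange basis polynomial is at most \<open>O(1/N)\<close> times \<open>exp (2 G N / \<pi>)\<close>. There are at most \<open>N\<^sup>2\<close> pairs
\<open>(s, j)\<close>, which gives the first bound.

If \<open>I\<close> is also a cyclic interval, the two sets of indices are intervals. The sums drop quadratically,
with coefficient of order \<open>1/N\<close>, when the left ends of the intervals move away from \<open>N/4\<close>
(\<open>deficit_interval\<close>). So only about \<open>sqrt N\<close> indices \<open>s\<close> and as many \<open>j\<close> contribute, the energy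
gains a factor \<open>1/N\<close>, and the logarithm of the condition number gains \<open>- ln N / 2\<close>.

For the reverse inequality with both intervals of length \<open>\<lceil>N/2\<rceil>\<close>, the phase of the
value of the basis polynomial of \<open>s\<close> at a node \<open>j\<close> outside \<open>I\<close> splits into a factor that depends on \<open>s\<close> and one that
depends on \<open>j\<close>. About \<open>sqrt N\<close> central basis
polynomials can therefore be added without cancellation at about \<open>sqrt N\<close> opposite nodes
(\<open>central_test_vector\<close>). A bound for the smallest singular value by a test vector follows from the
Rayleigh quotient of a Hermitian matrix (\<open>hermitian_rayleigh_le\<close>).\<close>

unbundle no vec_syntax
hide_type (open) Finite_Cartesian_Product.vec
hide_const (open) Finite_Cartesian_Product.vec module.smult

section \<open>Clausen's function and Catalan's constant\<close>

text \<open>The Clausen function of order two. The term at \<open>k = 0\<close> vanishes because division by zero yields zero.\<close>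

definition clausen :: "real \<Rightarrow> real" where
  "clausen \<theta> = (\<Sum>k. sin (real k * \<theta>) / real k ^ 2)"

text \<open>Abel means of the Clausen series, which can be differentiated term by term.\<close>

definition clausen_abel :: "real \<Rightarrow> real \<Rightarrow> real" where
  "clausen_abel r \<theta> = (\<Sum>k. r ^ k * sin (real k * \<theta>) / real k ^ 2)"

text \<open>This is the real part of the power series of \<open>- ln (1 - z)\<close> at \<open>z = r exp (\<i> \<theta>)\<close>, where
\<open>|1 - z|\<^sup>2 = (1 - r)\<^sup>2 + 4 r sin\<^sup>2 (\<theta> / 2)\<close>.\<close>

lemma clausen_abel_deriv_sum:
  assumes "0 \<le> r" "r < 1"
  shows "(\<lambda>k. r ^ k * cos (real k * \<theta>) / real k) sums (- ln ((1 - r)^2 + 4 * r * (sin (\<theta> / 2))^2) / 2)"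
proof -
  define z where "z = - (of_real r * cis \<theta>)"
  have nz: "cmod z < 1" using assms by (simp add: z_def norm_mult)
  have ne: "1 + z \<noteq> 0"
    using nz by (metis add.inverse_unique norm_minus_cancel norm_one order_less_irrefl)
  have "(\<lambda>k. Re (- ((- z) ^ k) / of_nat k)) sums Re (ln (1 + z))"
    by (intro sums_Re Ln_series' nz)
  moreover have "Re (- ((- z) ^ k) / of_nat k) = - (r ^ k * cos (real k * \<theta>) / real k)" for k
    by (simp add: z_def power_mult_distrib Complex.DeMoivre Re_divide_of_nat)
  moreover have "Re (ln (1 + z)) = ln (cmod (1 + z))" using ne by simp
  moreover have "cmod (1 + z) = sqrt ((1 - r)^2 + 4 * r * (sin (\<theta> / 2))^2)"
  proof -
    have c: "cos \<theta> = 1 - 2 * (sin (\<theta> / 2))^2"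
      using cos_double_sin[of "\<theta>/2"] by simp
    have s: "(r * cos \<theta>)^2 + (r * sin \<theta>)^2 = r\<^sup>2"
      by (simp add: power_mult_distrib flip: distrib_left)
    have "(cmod (1 + z))^2 = (1 - r * cos \<theta>)^2 + (r * sin \<theta>)^2"
      unfolding cmod_power2 z_def by simp
    also have "\<dots> = 1 - 2 * r * cos \<theta> + r\<^sup>2"
      using s by (simp add: power2_diff)
    also have "\<dots> = (1 - r)^2 + 4 * r * (sin (\<theta> / 2))^2"
      unfolding c by (simp add: power2_eq_square algebra_simps)
    finally show ?thesis by (metis norm_ge_zero real_sqrt_unique)
  qed
  moreover have "ln (sqrt ((1 - r)^2 + 4 * r * (sin (\<theta> / 2))^2)) = ln ((1 - r)^2 + 4 * r * (sin (\<theta> / 2))^2) / 2"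
    by (rule ln_sqrt) (use assms in \<open>auto intro!: add_pos_nonneg\<close>)
  ultimately have "(\<lambda>k. - (r ^ k * cos (real k * \<theta>) / real k)) sums (ln ((1 - r)^2 + 4 * r * (sin (\<theta> / 2))^2) / 2)"
    by (simp only:)
  from sums_minus[OF this] show ?thesis by simp
qed

lemma clausen_abel_has_derivative:
  assumes "0 \<le> r" "r < 1"
  shows "(clausen_abel r has_field_derivative (- ln ((1 - r)^2 + 4 * r * (sin (\<theta> / 2))^2) / 2)) (at \<theta>)"
proof -
  have "uniform_limit UNIV (\<lambda>n x. \<Sum>k<n. r ^ k * cos (real k * x) / real k) (\<lambda>x. \<Sum>k. r ^ k * cos (real k * x) / real k) sequentially"
  proof (rule Weierstrass_m_test)
    show "norm (r ^ k * cos (real k * x) / real k) \<le> r ^ k" for k x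
    proof (cases "k = 0")
      case False
      have "\<bar>cos (real k * x)\<bar> / real k \<le> 1 / 1"
        by (rule frac_le) (use False in auto)
      hence "r ^ k * (\<bar>cos (real k * x)\<bar> / real k) \<le> r ^ k * 1"
        by (intro mult_left_mono) (use assms in auto)
      thus ?thesis using assms by (simp add: abs_mult)
    qed auto
    show "summable ((^) r)" using assms by (intro summable_geometric) auto
  qed
  hence u: "uniform_limit UNIV (\<lambda>n x. \<Sum>k<n. r ^ k * cos (real k * x) / real k) (\<lambda>\<theta>. - ln ((1 - r)^2 + 4 * r * (sin (\<theta> / 2))^2) / 2) sequentially"
    using clausen_abel_deriv_sum[OF assms, THEN sums_unique] by simp
  have "\<exists>g. \<forall>x\<in>UNIV. (\<lambda>n. r ^ n * sin (real n * x) / real n ^ 2) sums g x \<and> (g has_field_derivative (- ln ((1 - r)^2 + 4 * r * (sin (x / 2))^2) / 2)) (at x within UNIV)"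
  proof (rule has_field_derivative_series[OF _ _ u])
    show "((\<lambda>x. r ^ n * sin (real n * x) / real n ^ 2) has_field_derivative r ^ n * cos (real n * x) / real n) (at x within UNIV)" for n x
      by (cases "n = 0") (auto intro!: derivative_eq_intros simp: power2_eq_square field_simps)
    show "summable (\<lambda>n. r ^ n * sin (real n * 0) / real n ^ 2)" by simp
  qed auto
  then obtain g where g: "\<And>x. (\<lambda>n. r ^ n * sin (real n * x) / real n ^ 2) sums g x"
     "\<And>x. (g has_field_derivative (- ln ((1 - r)^2 + 4 * r * (sin (x / 2))^2) / 2)) (at x)" by auto
  have "g = clausen_abel r"
    unfolding clausen_abel_def using g(1)[THEN sums_unique] by auto
  with g(2) show ?thesis by simp
qed

lemma clausen_bound: "norm (sin (real k * \<theta>) / real k ^ 2) \<le> inverse (real k ^ 2)"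
proof -
  have "\<bar>sin (real k * \<theta>)\<bar> * inverse (real k ^ 2) \<le> 1 * inverse (real k ^ 2)"
    by (intro mult_right_mono) auto
  thus ?thesis by (simp add: divide_inverse abs_mult)
qed

lemma clausen_abel_tendsto:
  "(\<lambda>n. clausen_abel (1 - inverse (real (n + 2))) \<theta>) \<longlonglongrightarrow> clausen \<theta>"
  unfolding clausen_abel_def clausen_def
proof (rule tannerys_theorem[THEN conjunct2, THEN conjunct2])
  show "summable (\<lambda>k. inverse (real k ^ 2))" by (rule inverse_power_summable) simp
  show "\<forall>\<^sub>F (k, n) in at_top \<times>\<^sub>F sequentially.
       norm ((1 - inverse (real (n + 2))) ^ k * sin (real k * \<theta>) / (real k)^2) \<le> inverse (real k ^ 2)"
  proof (intro always_eventually, clarify)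
    fix k n :: nat
    let ?r = "1 - inverse (real (n + 2))"
    have r: "0 \<le> ?r" "?r \<le> 1" by (auto simp: field_simps)
    have "norm (?r ^ k * sin (real k * \<theta>) / (real k)^2) = ?r ^ k * norm (sin (real k * \<theta>) / (real k)^2)"
      using r by (simp add: abs_mult)
    also have "\<dots> \<le> 1 * norm (sin (real k * \<theta>) / (real k)^2)"
      by (intro mult_right_mono power_le_one r) simp
    finally show "norm (?r ^ k * sin (real k * \<theta>) / (real k)^2) \<le> inverse (real k ^ 2)"
      using clausen_bound[of k \<theta>] by simp
  qed
  fix k :: nat
  have "(\<lambda>n. inverse (real (n + 2))) \<longlonglongrightarrow> 0"
    using LIMSEQ_ignore_initial_segment[OF lim_inverse_n, of 2] by simp
  hence "(\<lambda>n. (1 - inverse (real (n + 2))) ^ k * sin (real k * \<theta>) / (real k)^2) \<longlonglongrightarrow> (1 - 0) ^ k * sin (real k * \<theta>) / (real k)^2"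
    unfolding divide_inverse by (intro tendsto_intros)
  thus "(\<lambda>n. (1 - inverse (real (n + 2))) ^ k * sin (real k * \<theta>) / (real k)^2) \<longlonglongrightarrow> sin (real k * \<theta>) / (real k)^2" by simp
qed auto

lemma abs_ln_diff_le:
  fixes a b :: real
  assumes "m > 0" "m \<le> a" "m \<le> b"
  shows "\<bar>ln a - ln b\<bar> \<le> \<bar>a - b\<bar> / m"
proof -
  have *: "ln x - ln y \<le> \<bar>x - y\<bar> / m" if "m \<le> x" "m \<le> y" for x y
  proof -
    have "ln x - ln y = ln (x / y)" using that assms by (simp add: ln_div)
    also have "\<dots> \<le> x / y - 1" using that assms by (intro ln_le_minus_one) auto
    also have "\<dots> = (x - y) / y" using that assms by (simp add: field_simps)
    also have "\<dots> \<le> \<bar>x - y\<bar> / y" using that assms by (intro divide_right_mono) auto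
    also have "\<dots> \<le> \<bar>x - y\<bar> / m" using that assms by (intro divide_left_mono) auto
    finally show ?thesis .
  qed
  from *[of a b] *[of b a] assms show ?thesis by (simp add: abs_le_iff abs_minus_commute)
qed

text \<open>The differentiated Clausen series converges only conditionally. The derivatives of the Abel means,
however, have a closed form and converge uniformly for \<open>r \<rightarrow> 1\<close> as long as \<open>\<theta>\<close> stays away from
the multiples of \<open>2\<pi>\<close>.\<close>

lemma clausen_has_derivative:
  assumes "0 < \<theta>" "\<theta> < 2 * pi"
  shows "(clausen has_field_derivative (- ln (2 * sin (\<theta> / 2)))) (at \<theta>)"
proof -
  define e where "e = min \<theta> (2 * pi - \<theta>) / 2"
  have e: "0 < e" "e < \<theta>" "\<theta> < 2 * pi - e" "e \<le> pi" using assms by (auto simp: e_def min_def field_simps)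
  define S where "S = {e<..<2 * pi - e}"
  define m where "m = (sin (e / 2))^2"
  have sin_ge: "sin (x / 2) \<ge> sin (e / 2)" if "x \<in> S" for x
  proof (cases "x \<le> pi")
    case True
    thus ?thesis using that e by (intro sin_monotone_2pi_le) (auto simp: S_def)
  next
    case False
    have "sin (e / 2) \<le> sin (pi - x / 2)" using that e False by (intro sin_monotone_2pi_le) (auto simp: S_def)
    thus ?thesis by simp
  qed
  have se: "sin (e / 2) > 0" using e by (intro sin_gt_zero) auto
  have m: "m > 0" using se by (simp add: m_def)
  have sq: "m \<le> (sin (x / 2))^2" if "x \<in> S" for x
    unfolding m_def using sin_ge[OF that] se by (intro power_mono) auto
  let ?r = "\<lambda>n. 1 - inverse (real (n + 2))"
  let ?d = "\<lambda>n x. - ln ((1 - ?r n)^2 + 4 * ?r n * (sin (x / 2))^2) / 2"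
  have r: "1 / 2 \<le> ?r n" "?r n < 1" for n by (auto simp: field_simps)
  have diff: "\<bar>?d n x + ln (2 * sin (x / 2))\<bar> \<le> 5 / (4 * m) * inverse (real (n + 2))" if x: "x \<in> S" for n x
  proof -
    define t where "t = inverse (real (n + 2))"
    have t: "0 \<le> t" "t \<le> 1/2" by (auto simp: t_def field_simps)
    let ?q = "(sin (x / 2))^2"
    have q: "m \<le> ?q" "?q \<le> 1" using sq[OF x] by (auto simp: abs_square_le_1)
    have "ln (2 * sin (x / 2)) = ln ((2 * sin (x / 2))^2) / 2"
      using sin_ge[OF x] se by (subst ln_realpow) auto
    hence ln4: "ln (2 * sin (x / 2)) = ln (4 * ?q) / 2" by (simp add: power_mult_distrib)
    have dn: "?d n x = - ln (t\<^sup>2 + 4 * (1 - t) * ?q) / 2" unfolding t_def by simp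
    have half: "\<bar>- a / 2 + b / 2\<bar> = \<bar>a - b\<bar> / 2" for a b :: real by (simp add: abs_if)
    have "\<bar>?d n x + ln (2 * sin (x / 2))\<bar> = \<bar>ln (t\<^sup>2 + 4 * (1 - t) * ?q) - ln (4 * ?q)\<bar> / 2"
      unfolding ln4 dn by (rule half)
    also have "\<dots> \<le> (\<bar>(t\<^sup>2 + 4 * (1 - t) * ?q) - (4 * ?q)\<bar> / (2 * m)) / 2"
    proof (intro divide_right_mono abs_ln_diff_le)
      have "2 * m \<le> 4 * (1 - t) * ?q" using t q m by (intro mult_mono) auto
      thus "2 * m \<le> t\<^sup>2 + 4 * (1 - t) * ?q" by (simp add: add_increasing)
    qed (use m q in auto)
    also have "\<dots> = t * \<bar>t - 4 * ?q\<bar> / (4 * m)"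
    proof -
      have "(t\<^sup>2 + 4 * (1 - t) * ?q) - (4 * ?q) = t * (t - 4 * ?q)"
        by (simp add: algebra_simps power2_eq_square)
      thus ?thesis using t by (simp add: abs_mult)
    qed
    also have "\<dots> \<le> t * 5 / (4 * m)"
      using t q m by (intro divide_right_mono mult_left_mono) linarith+
    finally show ?thesis unfolding t_def[symmetric] by (simp add: mult.commute)
  qed
  have lim0: "(\<lambda>n. inverse (real (n + 2))) \<longlonglongrightarrow> 0"
    using LIMSEQ_ignore_initial_segment[OF lim_inverse_n, of 2] by simp
  have "\<exists>g. \<forall>x\<in>S. (\<lambda>n. clausen_abel (?r n) x) \<longlonglongrightarrow> g x \<and> (g has_derivative (\<lambda>h. - ln (2 * sin (x / 2)) * h)) (at x within S)"
  proof (rule has_derivative_sequence)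
    show "convex S" by (simp add: S_def)
    show "(clausen_abel (?r n) has_derivative (\<lambda>h. ?d n x * h)) (at x within S)" for n x
    proof -
      have "(clausen_abel (?r n) has_field_derivative ?d n x) (at x)"
        using r[of n] by (intro clausen_abel_has_derivative[of "?r n"]) linarith+
      thus ?thesis unfolding has_field_derivative_def by (rule has_derivative_at_withinI)
    qed
    show "\<theta> \<in> S" using e by (simp add: S_def)
    show "(\<lambda>n. clausen_abel (?r n) \<theta>) \<longlonglongrightarrow> clausen \<theta>" by (rule clausen_abel_tendsto)
    fix \<epsilon> :: real assume "\<epsilon> > 0"
    have "(\<lambda>n. 5 / (4 * m) * inverse (real (n + 2))) \<longlonglongrightarrow> 5 / (4 * m) * 0"
      by (intro tendsto_intros lim0)
    hence "\<forall>\<^sub>F n in sequentially. 5 / (4 * m) * inverse (real (n + 2)) < \<epsilon>"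
      using \<open>\<epsilon> > 0\<close> by (auto dest: order_tendstoD(2))
    thus "\<forall>\<^sub>F n in sequentially. \<forall>x\<in>S. \<forall>h. norm (?d n x * h - - ln (2 * sin (x / 2)) * h) \<le> \<epsilon> * norm h"
    proof (eventually_elim, clarify)
      fix n x and h :: real
      assume n: "5 / (4 * m) * inverse (real (n + 2)) < \<epsilon>" and x: "x \<in> S"
      have "norm (?d n x * h - - ln (2 * sin (x / 2)) * h) = \<bar>?d n x + ln (2 * sin (x / 2))\<bar> * norm h"
        unfolding real_norm_def abs_mult[symmetric] by (simp only: distrib_right minus_mult_left diff_minus_eq_add)
      also have "\<dots> \<le> \<epsilon> * norm h" using diff[OF x, of n] n by (intro mult_right_mono) auto
      finally show "norm (?d n x * h - - ln (2 * sin (x / 2)) * h) \<le> \<epsilon> * norm h" .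
    qed
  qed
  then obtain g where g: "\<And>x. x \<in> S \<Longrightarrow> (\<lambda>n. clausen_abel (?r n) x) \<longlonglongrightarrow> g x"
      "\<And>x. x \<in> S \<Longrightarrow> (g has_derivative (\<lambda>h. - ln (2 * sin (x / 2)) * h)) (at x within S)" by blast
  have gc: "g x = clausen x" if "x \<in> S" for x
    using g(1)[OF that] clausen_abel_tendsto LIMSEQ_unique by blast
  have S: "open S" "\<theta> \<in> S" using e by (auto simp: S_def)
  have "(g has_field_derivative - ln (2 * sin (\<theta> / 2))) (at \<theta>)"
    using g(2)[OF S(2)] unfolding at_within_open[OF S(2,1)] has_field_derivative_def .
  moreover have "\<forall>\<^sub>F x in nhds \<theta>. g x = clausen x"
    using eventually_nhds_in_open[OF S] by (rule eventually_mono) (rule gc)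
  ultimately show ?thesis using DERIV_cong_ev[OF refl _ refl, of g clausen \<theta>] by blast
qed

lemma clausen_reflect: "clausen (2 * pi - \<theta>) = - clausen \<theta>"
proof -
  have "sin (real k * (2 * pi - \<theta>)) = - sin (real k * \<theta>)" for k
  proof -
    have "real k * (2 * pi - \<theta>) = 2 * real k * pi - real k * \<theta>" by (simp add: algebra_simps)
    thus ?thesis by (simp add: sin_diff)
  qed
  moreover have "summable (\<lambda>k. sin (real k * \<theta>) / (real k)^2)"
    by (rule summable_comparison_test'[OF inverse_power_summable[of 2]]) (use clausen_bound in auto)
  ultimately show ?thesis
    unfolding clausen_def by (simp add: suminf_minus)
qed

lemma clausen_half_pi: "clausen (pi / 2) = catalan_const"
proof -
  let ?f = "\<lambda>k. sin (real k * (pi / 2)) / (real k)^2"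
  have odd: "?f (2 * k + 1) = (- 1) ^ k / (2 * real k + 1) ^ 2" for k
  proof -
    have "real (2 * k + 1) * (pi / 2) = real k * pi + pi / 2" by (simp add: algebra_simps add_divide_distrib)
    hence "sin (real (2 * k + 1) * (pi / 2)) = (- 1) ^ k" by (simp only: sin_add) simp
    thus ?thesis by (simp add: add_ac)
  qed
  have even: "?f n = 0" if "n \<notin> range (\<lambda>k. 2 * k + 1)" for n
  proof -
    have "even n" using that by (metis oddE rangeI)
    then obtain k where "n = 2 * k" by (elim evenE)
    thus ?thesis by simp
  qed
  have "suminf (\<lambda>n. ?f ((\<lambda>k. 2 * k + 1) n)) = suminf ?f"
    by (rule suminf_mono_reindex) (use even in \<open>auto simp: strict_mono_def\<close>)
  thus ?thesis unfolding clausen_def catalan_const_def odd by simp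
qed

section \<open>Logarithms of chords of the N-th roots of unity\<close>

text \<open>Logarithm of the distance of two \<open>N\<close>-th roots of unity whose indices differ by \<open>x\<close>.\<close>

definition lg_chord :: "nat \<Rightarrow> real \<Rightarrow> real" where
  "lg_chord N x = ln (2 * sin (pi * x / real N))"

text \<open>The level \<open>ln 2 / 2\<close> is the logarithmic chord length at \<open>x = N/4\<close>. It is the right threshold because
two sets of chords with about \<open>N\<close> elements in total compete, and each is best taken as the half of the
chords that are longer than this.\<close>

definition excess :: "nat \<Rightarrow> real \<Rightarrow> real" where
  "excess N x = lg_chord N x - ln 2 / 2"

text \<open>An antiderivative of \<open>excess\<close>.\<close>

definition excess_int :: "nat \<Rightarrow> real \<Rightarrow> real" where
  "excess_int N x = - real N / (2 * pi) * clausen (2 * pi * x / real N) - ln 2 / 2 * x"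

lemma sin_chord_pos: "0 < x \<Longrightarrow> x < real N \<Longrightarrow> 0 < sin (pi * x / real N)"
  by (intro sin_gt_zero) (auto simp: field_simps)

lemma excess_reflect: "N > 0 \<Longrightarrow> excess N (real N - x) = excess N x"
  by (simp add: excess_def lg_chord_def right_diff_distrib diff_divide_distrib)

lemma excess_quarter: "N > 0 \<Longrightarrow> excess N (real N / 4) = 0"
proof -
  assume "N > 0"
  hence "lg_chord N (real N / 4) = ln (sqrt 2)"
    by (simp add: lg_chord_def sin_45)
  thus ?thesis by (simp add: excess_def ln_sqrt)
qed

lemma excess_mono:
  assumes "0 < y" "y \<le> x" "x \<le> real N / 2" "N > 0"
  shows "excess N y \<le> excess N x"
proof -
  have "sin (pi * y / real N) \<le> sin (pi * x / real N)"
  proof (rule sin_monotone_2pi_le)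
    have "0 \<le> pi * y / real N" using assms by simp
    thus "- (pi / 2) \<le> pi * y / real N" using pi_gt_zero by linarith
  qed (use assms in \<open>auto simp: field_simps\<close>)
  moreover have "sin (pi * y / real N) > 0" using assms by (intro sin_chord_pos) (auto simp: field_simps)
  ultimately show ?thesis unfolding excess_def lg_chord_def by (simp)
qed

lemma excess_le: "0 < x \<Longrightarrow> x < real N \<Longrightarrow> excess N x \<le> 1 / 2"
proof -
  assume "0 < x" "x < real N"
  hence "lg_chord N x \<le> ln 2"
    unfolding lg_chord_def using sin_chord_pos[of x N] by (subst ln_le_cancel_iff) auto
  thus ?thesis using ln_le_minus_one[of "2::real"] by (simp add: excess_def)
qed

lemma excess_nonneg:
  assumes "real N / 4 \<le> x" "x \<le> 3 * real N / 4" "N > 0"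
  shows "0 \<le> excess N x"
proof (cases "x \<le> real N / 2")
  case True
  thus ?thesis using excess_mono[of "real N / 4" x N] excess_quarter assms by auto
next
  case False
  have "0 \<le> excess N (real N - x)"
    using excess_mono[of "real N / 4" "real N - x" N] excess_quarter[of N] assms False by auto
  thus ?thesis using assms by (simp add: excess_reflect)
qed

lemma excess_nonpos:
  assumes "0 < x" "x \<le> real N / 4 \<or> 3 * real N / 4 \<le> x" "x < real N"
  shows "excess N x \<le> 0"
proof (cases "x \<le> real N / 4")
  case True
  thus ?thesis using excess_mono[of x "real N / 4" N] excess_quarter[of N] assms by auto
next
  case False
  have "excess N (real N - x) \<le> 0"
    using excess_mono[of "real N - x" "real N / 4" N] excess_quarter[of N] assms False by auto
  thus ?thesis using assms by (simp add: excess_reflect)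
qed

lemma excess_has_derivative:
  assumes "0 < x" "x < real N"
  shows "(excess N has_field_derivative pi / real N * (cos (pi * x / real N) / sin (pi * x / real N))) (at x)"
  unfolding excess_def[abs_def] lg_chord_def
  using sin_chord_pos[OF assms] assms by (auto intro!: derivative_eq_intros simp: field_simps)

text \<open>The excess crosses zero at \<open>N/4\<close> with slope of order \<open>1/N\<close>; this is what makes a misplaced end of an
interval costly.\<close>

lemma excess_slope_lower:
  assumes "0 < y" "y \<le> x" "x \<le> real N / 3"
  shows "(x - y) / real N \<le> excess N x - excess N y"
proof (cases "y = x")
  case False
  with assms have yx: "y < x" by simp
  obtain z where z: "y < z" "z < x"
    "excess N x - excess N y = (x - y) * (pi / real N * (cos (pi * z / real N) / sin (pi * z / real N)))"
    using MVT2[OF yx, of "excess N" "\<lambda>z. pi / real N * (cos (pi * z / real N) / sin (pi * z / real N))"]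
      excess_has_derivative[of _ N] assms by auto
  have N: "real N > 0" using assms yx by auto
  have "cos (pi / 3) \<le> cos (pi * z / real N)"
    using z assms N by (intro cos_monotone_0_pi_le) (auto simp: field_simps)
  hence c: "1 / 2 \<le> cos (pi * z / real N)" by (simp add: cos_60)
  have s: "0 < sin (pi * z / real N)" using z assms N by (intro sin_chord_pos) auto
  have "1 = 2 * (1 / 2 / 1 :: real)" by simp
  also have "\<dots> \<le> pi * (cos (pi * z / real N) / sin (pi * z / real N))"
    using c s pi_ge_two by (intro mult_mono frac_le) auto
  finally have "1 / real N \<le> pi / real N * (cos (pi * z / real N) / sin (pi * z / real N))"
    using N by (simp add: field_simps)
  hence "(x - y) * (1 / real N) \<le> excess N x - excess N y"
    unfolding z(3) using yx by (intro mult_left_mono) auto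
  thus ?thesis by simp
qed auto

lemma excess_slope_upper:
  assumes "real N / 6 \<le> y" "y \<le> x" "x \<le> real N / 2" "N > 0"
  shows "\<bar>excess N x - excess N y\<bar> \<le> 8 * \<bar>x - y\<bar> / real N"
proof (cases "y = x")
  case False
  with assms have yx: "y < x" by simp
  obtain z where z: "y < z" "z < x"
    "excess N x - excess N y = (x - y) * (pi / real N * (cos (pi * z / real N) / sin (pi * z / real N)))"
    using MVT2[OF yx, of "excess N" "\<lambda>z. pi / real N * (cos (pi * z / real N) / sin (pi * z / real N))"]
      excess_has_derivative[of _ N] assms by auto
  have N: "real N > 0" using assms yx by auto
  have "sin (pi / 6) \<le> sin (pi * z / real N)"
  proof (rule sin_monotone_2pi_le)
    have "- (pi / 2) \<le> 0" by simp
    thus "- (pi / 2) \<le> pi / 6" using pi_gt_zero by linarith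
  qed (use z assms N in \<open>auto simp: field_simps\<close>)
  hence s: "1 / 2 \<le> sin (pi * z / real N)" by (simp add: sin_30)
  have z0: "0 < z" using z(1) assms(1) N by linarith
  have "pi * z / real N \<le> pi / 2" using z(2) assms(3) N by (simp add: field_simps)
  moreover have "0 < pi * z / real N" using z0 N by simp
  ultimately have c: "0 \<le> cos (pi * z / real N)" by (intro cos_ge_zero) auto
  have "pi * (cos (pi * z / real N) / sin (pi * z / real N)) \<le> 4 * (1 / (1 / 2))"
    using s c pi_less_4 by (intro mult_mono frac_le divide_nonneg_nonneg) auto
  hence "pi / real N * (cos (pi * z / real N) / sin (pi * z / real N)) \<le> 8 / real N"
    using N by (simp add: field_simps)
  hence "excess N x - excess N y \<le> (x - y) * (8 / real N)"
    unfolding z(3) using yx by (intro mult_left_mono) auto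
  thus ?thesis using excess_mono[of y x N] assms by (simp add: mult.commute)
qed auto

lemma excess_int_has_derivative:
  assumes "0 < x" "x < real N"
  shows "(excess_int N has_field_derivative excess N x) (at x)"
proof -
  have "0 < 2 * pi * x / real N" "2 * pi * x / real N < 2 * pi" using assms by (auto simp: field_simps)
  note cl = clausen_has_derivative[OF this]
  have "((\<lambda>x. clausen (2 * pi * x / real N)) has_field_derivative - ln (2 * sin (2 * pi * x / real N / 2)) * (2 * pi / real N)) (at x)"
    by (rule DERIV_chain2[where f = clausen and g = "\<lambda>x. 2 * pi * x / real N" and x = x, OF cl])
      (use assms in \<open>auto intro!: derivative_eq_intros\<close>)
  from DERIV_diff[OF DERIV_cmult[OF this, of "- real N / (2 * pi)"] DERIV_cmult_Id[of "ln 2 / 2" x UNIV]]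
  have "(excess_int N has_field_derivative - real N / (2 * pi) * (- ln (2 * sin (2 * pi * x / real N / 2)) * (2 * pi / real N)) - ln 2 / 2) (at x)"
    unfolding excess_int_def[abs_def] .
  moreover have "- real N / (2 * pi) * (- ln (2 * sin (2 * pi * x / real N / 2)) * (2 * pi / real N)) - ln 2 / 2 = excess N x"
    using assms by (simp add: excess_def lg_chord_def field_simps)
  ultimately show ?thesis by simp
qed

lemma excess_int_reflect: "N > 0 \<Longrightarrow> excess_int N (real N - x) = - excess_int N x - ln 2 / 2 * real N"
proof -
  assume "N > 0"
  hence eq: "2 * pi * (real N - x) / real N = 2 * pi - 2 * pi * x / real N" by (simp add: field_simps)
  show ?thesis unfolding excess_int_def eq clausen_reflect by (simp add: field_simps)
qed

abbreviation (input) main_term :: "nat \<Rightarrow> real" where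
  "main_term N \<equiv> 2 * catalan_const * real N / pi"

text \<open>Twice the integral of the logarithmic chord length over the middle half. The subtracted level adds up to the
term \<open>ln 2 / 2 * N\<close>, and the right-hand side is the exponent in the final theorem.\<close>

lemma excess_int_total:
  "N > 0 \<Longrightarrow> 2 * (excess_int N (3 * real N / 4) - excess_int N (real N / 4)) + ln 2 / 2 * real N = main_term N"
proof -
  assume N: "N > 0"
  have "excess_int N (3 * real N / 4) = - excess_int N (real N / 4) - ln 2 / 2 * real N"
    using excess_int_reflect[OF N, of "real N / 4"] by simp
  moreover have "excess_int N (real N / 4) = - real N / (2 * pi) * catalan_const - ln 2 / 2 * (real N / 4)"
    using N by (simp add: excess_int_def clausen_half_pi)
  ultimately show ?thesis by (simp add: field_simps)
qed

lemma excess_int_mono: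
  assumes "real N / 4 \<le> x" "x \<le> y" "y \<le> 3 * real N / 4" "N > 0"
  shows "excess_int N x \<le> excess_int N y"
proof (rule DERIV_nonneg_imp_nondecreasing[OF assms(2)])
  fix z assume "x \<le> z" "z \<le> y"
  thus "\<exists>d. DERIV (excess_int N) z :> d \<and> 0 \<le> d"
    using assms excess_int_has_derivative[of z N] excess_nonneg[of N z] by (intro exI[of _ "excess N z"]) auto
qed

lemma excess_int_diff:
  assumes "0 < x" "x < y" "y < real N"
  obtains z where "x < z" "z < y" "excess_int N y - excess_int N x = (y - x) * excess N z"
  using MVT2[OF assms(2), of "excess_int N" "excess N"] excess_int_has_derivative[of _ N] assms by auto

text \<open>The point \<open>N/4\<close> is a zero of the derivative \<open>excess\<close>, whose own derivative is \<open>O(1/N)\<close> nearby.\<close>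

lemma excess_int_near_quarter:
  assumes "real N / 6 \<le> x" "x \<le> real N / 2" "N > 0"
  shows "\<bar>excess_int N x - excess_int N (real N / 4)\<bar> \<le> 8 * (x - real N / 4)^2 / real N"
proof -
  let ?a = "real N / 4"
  have "\<exists>z. \<bar>z - ?a\<bar> \<le> \<bar>x - ?a\<bar> \<and> \<bar>excess N z - excess N ?a\<bar> \<le> 8 * \<bar>z - ?a\<bar> / real N \<and>
    excess_int N x - excess_int N ?a = (x - ?a) * excess N z"
  proof (cases x ?a rule: linorder_cases)
    case less
    obtain z where z: "x < z" "z < ?a" "excess_int N ?a - excess_int N x = (?a - x) * excess N z"
      using excess_int_diff[of x ?a N] less assms by auto
    have "\<bar>excess N ?a - excess N z\<bar> \<le> 8 * \<bar>?a - z\<bar> / real N" using z assms by (intro excess_slope_upper) auto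
    thus ?thesis using z by (intro exI[of _ z]) (auto simp: abs_minus_commute algebra_simps)
  next
    case greater
    obtain z where z: "?a < z" "z < x" "excess_int N x - excess_int N ?a = (x - ?a) * excess N z"
      using excess_int_diff[of ?a x N] greater assms by auto
    have "\<bar>excess N z - excess N ?a\<bar> \<le> 8 * \<bar>z - ?a\<bar> / real N" using z assms by (intro excess_slope_upper) auto
    thus ?thesis using z by (intro exI[of _ z]) auto
  next
    case equal
    show ?thesis unfolding equal by (intro exI[of _ ?a]) simp
  qed
  then obtain z where z: "\<bar>z - ?a\<bar> \<le> \<bar>x - ?a\<bar>" "\<bar>excess N z\<bar> \<le> 8 * \<bar>z - ?a\<bar> / real N"
    "excess_int N x - excess_int N ?a = (x - ?a) * excess N z"
    using excess_quarter[OF assms(3)] by auto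
  have "\<bar>excess_int N x - excess_int N ?a\<bar> \<le> \<bar>x - ?a\<bar> * (8 * \<bar>x - ?a\<bar> / real N)"
    unfolding z(3) abs_mult
  proof (rule mult_left_mono)
    have "8 * \<bar>z - ?a\<bar> / real N \<le> 8 * \<bar>x - ?a\<bar> / real N" using z(1) by (intro divide_right_mono mult_left_mono) auto
    thus "\<bar>excess N z\<bar> \<le> 8 * \<bar>x - ?a\<bar> / real N" using z(2) by linarith
  qed simp
  also have "\<dots> = 8 * (x - ?a)^2 / real N" by (simp add: power2_eq_square flip: abs_mult)
  finally show ?thesis .
qed

text \<open>The midpoint rule overestimates the integral of a concave function. Here concavity takes the form
\<open>sin (a + b) sin (a - b) = sin\<^sup>2 a - sin\<^sup>2 b \<le> sin\<^sup>2 a\<close>.\<close>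

lemma midpoint_excess:
  assumes "1 / 2 < x" "x < real N - 1 / 2"
  shows "excess_int N (x + 1 / 2) - excess_int N (x - 1 / 2) \<le> excess N x"
proof -
  define \<phi> where "\<phi> t = excess_int N (x + t) - excess_int N (x - t)" for t
  have d: "(\<phi> has_field_derivative excess N (x + t) + excess N (x - t)) (at t)" if "0 \<le> t" "t \<le> 1/2" for t
  proof -
    have "((\<lambda>t. excess_int N (x + t)) has_field_derivative excess N (x + t) * 1) (at t)"
      by (rule DERIV_chain2[OF excess_int_has_derivative]) (use that assms in \<open>auto intro!: derivative_eq_intros\<close>)
    moreover have "((\<lambda>t. excess_int N (x - t)) has_field_derivative excess N (x - t) * (- 1)) (at t)"
      by (rule DERIV_chain2[OF excess_int_has_derivative]) (use that assms in \<open>auto intro!: derivative_eq_intros\<close>)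
    ultimately have "(\<phi> has_field_derivative excess N (x + t) * 1 - excess N (x - t) * (- 1)) (at t)"
      unfolding \<phi>_def[abs_def] by (rule DERIV_diff)
    thus ?thesis by simp
  qed
  obtain t where t: "0 < t" "t < 1 / 2" "\<phi> (1 / 2) - \<phi> 0 = (1 / 2 - 0) * (excess N (x + t) + excess N (x - t))"
    using MVT2[of 0 "1/2" \<phi> "\<lambda>t. excess N (x + t) + excess N (x - t)"] d by auto
  have "excess N (x + t) + excess N (x - t) \<le> 2 * excess N x"
  proof -
    let ?a = "pi * x / real N" and ?b = "pi * t / real N"
    have s: "0 < sin (pi * (x + t) / real N)" "0 < sin (pi * (x - t) / real N)" "0 < sin ?a"
      using t assms by (auto intro!: sin_chord_pos)
    have "sin (pi * (x + t) / real N) * sin (pi * (x - t) / real N) = sin (?a + ?b) * sin (?a - ?b)"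
      by (simp add: algebra_simps add_divide_distrib diff_divide_distrib)
    also have "\<dots> = (sin ?a)^2 - (sin ?b)\<^sup>2"
    proof -
      have "sin (?a + ?b) * sin (?a - ?b) = (sin ?a)^2 * (cos ?b)^2 - (cos ?a)\<^sup>2 * (sin ?b)^2"
        by (simp add: sin_add sin_diff power2_eq_square algebra_simps)
      thus ?thesis by (simp add: cos_squared_eq algebra_simps)
    qed
    also have "\<dots> \<le> (sin ?a)^2" by simp
    finally have le: "sin (pi * (x + t) / real N) * sin (pi * (x - t) / real N) \<le> sin ?a * sin ?a"
      by (simp add: power2_eq_square)
    have "lg_chord N (x + t) + lg_chord N (x - t) = ln ((2 * sin (pi * (x + t) / real N)) * (2 * sin (pi * (x - t) / real N)))"
      unfolding lg_chord_def using s by (subst ln_mult) auto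
    also have "\<dots> \<le> ln ((2 * sin ?a) * (2 * sin ?a))"
      using s le by (subst ln_le_cancel_iff) auto
    also have "\<dots> = 2 * lg_chord N x"
      unfolding lg_chord_def using s by (subst ln_mult) auto
    finally show ?thesis by (simp add: excess_def)
  qed
  thus ?thesis using t(3) by (simp add: \<phi>_def)
qed

section \<open>Sums of logarithmic chord lengths\<close>

text \<open>The largest sum of excesses over any set of indices.\<close>

definition excess_cap :: "nat \<Rightarrow> real" where
  "excess_cap N = (\<Sum>k\<in>{1..<N}. max 0 (excess N (real k)))"

abbreviation (input) excess_sum :: "nat \<Rightarrow> nat set \<Rightarrow> real" where
  "excess_sum N X \<equiv> (\<Sum>k\<in>X. excess N (real k))"

text \<open>An index that \<open>X\<close> contains despite a negative excess, or omits despite a positive one, loses the absolute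
value of its excess compared to the cap.\<close>

lemma excess_sum_le_cap:
  assumes "X \<subseteq> {1..<N}" "D \<subseteq> {1..<N}"
    and "\<And>k. k \<in> D \<Longrightarrow> if k \<in> X then excess N (real k) \<le> 0 else 0 \<le> excess N (real k)"
  shows "excess_sum N X \<le> excess_cap N - (\<Sum>k\<in>D. \<bar>excess N (real k)\<bar>)"
proof -
  have X: "excess_sum N X = (\<Sum>k\<in>{1..<N}. if k \<in> X then excess N (real k) else 0)"
    using assms(1) by (simp add: sum.inter_restrict[symmetric] Int_absorb1)
  have D: "(\<Sum>k\<in>D. \<bar>excess N (real k)\<bar>) = (\<Sum>k\<in>{1..<N}. if k \<in> D then \<bar>excess N (real k)\<bar> else 0)"
    using assms(2) by (simp add: sum.inter_restrict[symmetric] Int_absorb1)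
  have "excess_sum N X + (\<Sum>k\<in>D. \<bar>excess N (real k)\<bar>) \<le> excess_cap N"
    unfolding X D excess_cap_def sum.distrib[symmetric]
    by (rule sum_mono) (use assms(3) in \<open>auto simp: max_def split: if_splits\<close>)
  thus ?thesis by simp
qed

text \<open>The excess is positive exactly between \<open>N/4\<close> and \<open>3N/4\<close>, increases up to \<open>N/2\<close> and decreases afterwards.
On each side the sum is compared with the integral by monotonicity; at most two indices next to \<open>N/2\<close>
remain, and each contributes at most \<open>1/2\<close>.\<close>

lemma excess_cap_le:
  assumes "N > 0"
  shows "excess_cap N \<le> excess_int N (3 * real N / 4) - excess_int N (real N / 4) + 1"
proof -
  let ?F = "excess_int N" and ?e = "\<lambda>k. excess N (real k)"
  define a where "a = (N + 3) div 4"
  define b where "b = N div 2"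
  define c where "c = (N + 1) div 2"
  define d where "d = 3 * N div 4"
  have a: "real N / 4 \<le> real a" unfolding a_def by linarith
  have b: "real b \<le> real N / 2" unfolding b_def by linarith
  have c: "real N / 2 \<le> real c" unfolding c_def by linarith
  have d: "real d \<le> 3 * real N / 4" unfolding d_def by linarith
  have cells: "(\<Sum>k\<in>{l..<m}. e k) \<le> ?F y - ?F x"
    if "real N / 4 \<le> x" "x \<le> y" "y \<le> 3 * real N / 4" "x \<le> real l" "real m \<le> y"
      and le: "\<And>k z. l \<le> k \<Longrightarrow> k < m \<Longrightarrow> real k < z \<Longrightarrow> z < real k + 1 \<Longrightarrow> e k \<le> excess N z"
    for e :: "nat \<Rightarrow> real" and l m x y
  proof (cases "l \<le> m")
    case True
    have "(\<Sum>k\<in>{l..<m}. e k) \<le> (\<Sum>k\<in>{l..<m}. ?F (real (Suc k)) - ?F (real k))"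
    proof (rule sum_mono)
      fix k assume k: "k \<in> {l..<m}"
      hence "real l \<le> real k" "real k + 1 \<le> real m" by auto
      hence "0 < real k" "real k + 1 < real N" using that assms by linarith+
      then obtain z where z: "real k < z" "z < real k + 1" "?F (real k + 1) - ?F (real k) = (real k + 1 - real k) * excess N z"
        using excess_int_diff[of "real k" "real k + 1" N] by auto
      show "e k \<le> ?F (real (Suc k)) - ?F (real k)" using le[of k z] z k by (simp add: add.commute)
    qed
    also have "\<dots> = ?F (real m) - ?F (real l)"
      using sum_Suc_diff'[OF True, of "\<lambda>k. ?F (real k)"] by simp
    also have "\<dots> \<le> ?F y - ?F x"
      by (rule diff_mono; rule excess_int_mono) (use that assms True in auto)
    finally show ?thesis .
  next
    case False
    thus ?thesis using excess_int_mono[of N x y] that assms by auto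
  qed
  \<comment> \<open>Left of \<open>N/2\<close> the excess at \<open>k\<close> is at most that on the cell to the right of \<open>k\<close>.\<close>
  have left: "(\<Sum>k\<in>{a..<b}. ?e k) \<le> ?F (real N / 2) - ?F (real N / 4)"
  proof (rule cells)
    fix k z assume k: "a \<le> k" "k < b" "real k < z" "z < real k + 1"
    hence "0 < real k" "real k + 1 \<le> real N / 2" using a b assms by auto
    thus "?e k \<le> excess N z" using k assms by (intro excess_mono) auto
  qed (use a b in auto)
  \<comment> \<open>Right of \<open>N/2\<close> the index \<open>k + 1\<close> is compared with the cell to its left.\<close>
  have right: "(\<Sum>k\<in>{c..<d}. ?e (Suc k)) \<le> ?F (3 * real N / 4) - ?F (real N / 2)"
  proof (rule cells)
    fix k z assume k: "c \<le> k" "k < d" "real k < z" "z < real k + 1"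
    hence "real N / 2 \<le> real k" "real k + 1 < real N" using c d assms by auto
    hence "excess N (real N - (real k + 1)) \<le> excess N (real N - z)" using k assms by (intro excess_mono) auto
    thus "?e (Suc k) \<le> excess N z" using assms by (simp add: excess_reflect add.commute)
  qed (use c d in auto)
  let ?M = "{k\<in>{1..<N}. N \<le> 4 * k \<and> 4 * k \<le> 3 * N}"
  have "excess_cap N = (\<Sum>k\<in>?M. max 0 (?e k))"
    unfolding excess_cap_def
  proof (rule sum.mono_neutral_right)
    show "\<forall>k\<in>{1..<N} - ?M. max 0 (?e k) = 0"
    proof
      fix k assume "k \<in> {1..<N} - ?M"
      hence "excess N (real k) \<le> 0" by (intro excess_nonpos) auto
      thus "max 0 (?e k) = 0" by simp
    qed
  qed auto
  also have "\<dots> = (\<Sum>k\<in>?M. ?e k)"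
    by (rule sum.cong) (use assms excess_nonneg[of N] in \<open>auto simp: max_def intro!: antisym\<close>)
  also have "\<dots> \<le> (\<Sum>k\<in>{a..<b} \<union> Suc ` {c..<d} \<union> (?M \<inter> {b..c}). ?e k)"
  proof (rule sum_mono2)
    show "?M \<subseteq> {a..<b} \<union> Suc ` {c..<d} \<union> (?M \<inter> {b..c})"
    proof
      fix k assume k: "k \<in> ?M"
      show "k \<in> {a..<b} \<union> Suc ` {c..<d} \<union> (?M \<inter> {b..c})"
      proof (cases "k < b")
        case True
        thus ?thesis using k by (auto simp: a_def)
      next
        case kb: False
        show ?thesis
        proof (cases "k \<le> c")
          case True
          thus ?thesis using k kb by auto
        next
          case False
          hence "k = Suc (k - 1)" "k - 1 \<in> {c..<d}" using k by (auto simp: d_def)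
          thus ?thesis by blast
        qed
      qed
    qed
    fix k assume k: "k \<in> {a..<b} \<union> Suc ` {c..<d} \<union> (?M \<inter> {b..c}) - ?M"
    have "real N / 4 \<le> real k \<and> real k \<le> 3 * real N / 4" using k a b c d by auto
    thus "0 \<le> ?e k" using assms by (intro excess_nonneg) auto
  qed auto
  also have "\<dots> \<le> (\<Sum>k\<in>{a..<b} \<union> Suc ` {c..<d}. ?e k) + (\<Sum>k\<in>?M \<inter> {b..c}. ?e k)"
  proof -
    have "0 \<le> (\<Sum>k\<in>({a..<b} \<union> Suc ` {c..<d}) \<inter> (?M \<inter> {b..c}). ?e k)"
      by (rule sum_nonneg) (use assms excess_nonneg[of N] in auto)
    thus ?thesis by (subst sum_Un) auto
  qed
  also have "(\<Sum>k\<in>{a..<b} \<union> Suc ` {c..<d}. ?e k) = (\<Sum>k\<in>{a..<b}. ?e k) + (\<Sum>k\<in>Suc ` {c..<d}. ?e k)"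
    by (rule sum.union_disjoint) (auto simp: b_def c_def)
  also have "(\<Sum>k\<in>Suc ` {c..<d}. ?e k) = (\<Sum>k\<in>{c..<d}. ?e (Suc k))"
    by (subst sum.reindex) auto
  also have "(\<Sum>k\<in>?M \<inter> {b..c}. ?e k) \<le> 1"
  proof -
    have "(\<Sum>k\<in>?M \<inter> {b..c}. ?e k) \<le> (\<Sum>k\<in>?M \<inter> {b..c}. 1 / 2)"
      by (rule sum_mono, rule excess_le) auto
    also have "\<dots> \<le> (\<Sum>k\<in>{b..c}. 1 / 2 :: real)" by (rule sum_mono2) auto
    also have "\<dots> \<le> 1" by (simp add: b_def c_def) 
    finally show ?thesis .
  qed
  finally show ?thesis using left right by linarith
qed

lemma sum_above_lower:
  fixes A :: real
  assumes "a \<le> m"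
  shows "((real m - 1 - A)^2 - (real a - 1 - A)\<^sup>2) / 2 \<le> (\<Sum>k\<in>{a..<m}. real k - A)"
  using assms by (induction m rule: dec_induct) (auto simp: power2_eq_square field_simps)

lemma sum_below_lower:
  fixes A :: real
  assumes "a \<le> m"
  shows "((A - real a)^2 - (A - real m)\<^sup>2) / 2 \<le> (\<Sum>k\<in>{a..<m}. A - real k)"
  using assms by (induction m rule: dec_induct) (auto simp: power2_eq_square field_simps)

text \<open>If \<open>X\<close> omits the indices from \<open>N/4\<close> to \<open>B\<close>, it misses excesses that grow linearly, so the loss is
quadratic. The condition \<open>3 * B \<le> N\<close> keeps these indices in the range where the slope is at least \<open>1/N\<close>.\<close>

lemma deficit_above:
  assumes "X \<subseteq> {1..<N}" "3 * B \<le> N" "N \<le> 4 * (B + 1)" "\<And>k. k \<in> X \<Longrightarrow> N \<le> 4 * k \<Longrightarrow> B < k" "N > 0"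
  shows "excess_sum N X \<le> excess_cap N - (real B - real N / 4)\<^sup>2 / (2 * real N) + 1"
proof -
  define a where "a = (N + 3) div 4"
  have a: "a \<le> B + 1" "real N / 4 \<le> real a" "real a \<le> real N / 4 + 1" "a \<ge> 1"
  proof -
    have "N \<le> 4 * a" "4 * a \<le> N + 3" unfolding a_def by presburger+
    hence "real N / 4 \<le> real a \<and> real a \<le> real N / 4 + 1" by linarith
    thus "real N / 4 \<le> real a" "real a \<le> real N / 4 + 1" by auto
    show "a \<le> B + 1" "a \<ge> 1" using assms(3,5) \<open>N \<le> 4 * a\<close> \<open>4 * a \<le> N + 3\<close> by auto
  qed
  have "excess_sum N X \<le> excess_cap N - (\<Sum>k\<in>{a..<B+1}. \<bar>excess N (real k)\<bar>)"
  proof (rule excess_sum_le_cap)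
    fix k assume k: "k \<in> {a..<B+1}"
    have "N \<le> 4 * k" using a(2) k by auto
    hence "k \<notin> X" using assms(4)[of k] k by auto
    moreover have "0 \<le> excess N (real k)"
      using k a assms by (intro excess_nonneg) auto
    ultimately show "if k \<in> X then excess N (real k) \<le> 0 else 0 \<le> excess N (real k)" by simp
  qed (use assms a in auto)
  moreover have "(\<Sum>k\<in>{a..<B+1}. (real k - real N / 4) / real N) \<le> (\<Sum>k\<in>{a..<B+1}. \<bar>excess N (real k)\<bar>)"
  proof (rule sum_mono)
    fix k assume k: "k \<in> {a..<B+1}"
    have "(real k - real N / 4) / real N \<le> excess N (real k) - excess N (real N / 4)"
      using k a assms by (intro excess_slope_lower) auto
    thus "(real k - real N / 4) / real N \<le> \<bar>excess N (real k)\<bar>"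
      using excess_quarter[OF assms(5)] by simp
  qed
  moreover have "(\<Sum>k\<in>{a..<B+1}. (real k - real N / 4) / real N) = (\<Sum>k\<in>{a..<B+1}. real k - real N / 4) / real N"
    by (rule sum_divide_distrib[symmetric])
  moreover have "(((real B - real N / 4)^2 - 1) / 2) / real N \<le> (\<Sum>k\<in>{a..<B+1}. real k - real N / 4) / real N"
  proof (rule divide_right_mono)
    have "(real a - 1 - real N / 4)^2 \<le> 1" using a by (simp add: abs_square_le_1)
    thus "((real B - real N / 4)^2 - 1) / 2 \<le> (\<Sum>k\<in>{a..<B+1}. real k - real N / 4)"
      using sum_above_lower[OF a(1), of "real N / 4"] by simp
  qed simp
  moreover have "(((real B - real N / 4)^2 - 1) / 2) / real N \<ge> (real B - real N / 4)^2 / (2 * real N) - 1"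
    using assms(5) by (simp add: field_simps)
  ultimately show ?thesis by linarith
qed

text \<open>If \<open>X\<close> contains the indices from \<open>u\<close> to \<open>N/4\<close>, perhaps except one, it pays negative excesses that grow
linearly with the distance from \<open>N/4\<close>.\<close>

lemma deficit_below:
  assumes "X \<subseteq> {1..<N}" "4 * u \<le> N" "\<And>k. u < k \<Longrightarrow> 4 * k \<le> N \<Longrightarrow> k \<noteq> k0 \<Longrightarrow> k \<in> X" "N > 0"
  shows "excess_sum N X \<le> excess_cap N - (real u - real N / 4)\<^sup>2 / (2 * real N) + 2"
proof -
  define m where "m = N div 4 + 1"
  have m: "u + 1 \<le> m" "real N / 4 \<le> real m" "real m \<le> real N / 4 + 1"
  proof -
    have "N \<le> 4 * m" "4 * m \<le> N + 4" unfolding m_def by presburger+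
    hence "real N / 4 \<le> real m \<and> real m \<le> real N / 4 + 1" by linarith
    thus "real N / 4 \<le> real m" "real m \<le> real N / 4 + 1" by auto
    show "u + 1 \<le> m" using assms(2) unfolding m_def by presburger
  qed
  have "excess_sum N X \<le> excess_cap N - (\<Sum>k\<in>{u+1..<m}-{k0}. \<bar>excess N (real k)\<bar>)"
  proof (rule excess_sum_le_cap)
    fix k assume k: "k \<in> {u+1..<m}-{k0}"
    have "k \<in> X" using assms(3)[of k] k by (auto simp: m_def)
    moreover have "excess N (real k) \<le> 0"
      using k m assms by (intro excess_nonpos) (auto simp: m_def)
    ultimately show "if k \<in> X then excess N (real k) \<le> 0 else 0 \<le> excess N (real k)" by simp
  qed (use assms m in \<open>auto simp: m_def\<close>)
  moreover have "(\<Sum>k\<in>{u+1..<m}-{k0}. (real N / 4 - real k) / real N) \<le> (\<Sum>k\<in>{u+1..<m}-{k0}. \<bar>excess N (real k)\<bar>)"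
  proof (rule sum_mono)
    fix k assume k: "k \<in> {u+1..<m}-{k0}"
    have "(real N / 4 - real k) / real N \<le> excess N (real N / 4) - excess N (real k)"
      using k m assms by (intro excess_slope_lower) (auto simp: m_def)
    thus "(real N / 4 - real k) / real N \<le> \<bar>excess N (real k)\<bar>"
      using excess_quarter[OF assms(4)] by simp
  qed
  moreover have "(\<Sum>k\<in>{u+1..<m}. (real N / 4 - real k) / real N) - 1 \<le> (\<Sum>k\<in>{u+1..<m}-{k0}. (real N / 4 - real k) / real N)"
  proof (cases "k0 \<in> {u+1..<m}")
    case True
    have "(real N / 4 - real k0) / real N \<le> 1" using assms(4) by (simp add: field_simps)
    thus ?thesis using sum.remove[OF _ True, of "\<lambda>k. (real N / 4 - real k) / real N"] by simp
  qed auto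
  moreover have "(\<Sum>k\<in>{u+1..<m}. (real N / 4 - real k) / real N) = (\<Sum>k\<in>{u+1..<m}. real N / 4 - real k) / real N"
    by (rule sum_divide_distrib[symmetric])
  moreover have "(((real N / 4 - real (u + 1))^2 - 1) / 2) / real N \<le> (\<Sum>k\<in>{u+1..<m}. real N / 4 - real k) / real N"
  proof (rule divide_right_mono)
    have "(real N / 4 - real m)^2 \<le> 1" using m by (simp add: abs_square_le_1)
    thus "((real N / 4 - real (u + 1))^2 - 1) / 2 \<le> (\<Sum>k\<in>{u+1..<m}. real N / 4 - real k)"
      using sum_below_lower[OF m(1), of "real N / 4"] by simp
  qed simp
  moreover have "(((real N / 4 - real (u + 1))^2 - 1) / 2) / real N \<ge> (real u - real N / 4)^2 / (2 * real N) - 1"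
  proof -
    have "(real N / 4 - real (u + 1))^2 = (real u - real N / 4)^2 - 2 * (real N / 4 - real u) + 1"
      by (simp add: power2_eq_square algebra_simps)
    hence "((real N / 4 - real (u + 1))^2 - 1) / 2 \<ge> (real u - real N / 4)^2 / 2 - real N"
      by simp
    hence "(((real N / 4 - real (u + 1))^2 - 1) / 2) / real N \<ge> ((real u - real N / 4)^2 / 2 - real N) / real N"
      by (rule divide_right_mono) simp
    thus ?thesis using assms(4) by (simp add: diff_divide_distrib)
  qed
  ultimately show ?thesis by linarith
qed

text \<open>An interval whose left end \<open>u\<close> lies right of \<open>N/4\<close> misses positive excesses. If \<open>u\<close> lies left of \<open>N/4\<close>, the
interval either reaches \<open>N/4\<close> and contains negative excesses, or is so short that it misses the whole middle
part. The exceptional index \<open>k0\<close> stands for the chord between the two nodes of a Lagrange basis value, which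
is absent from the product.\<close>

lemma deficit_interval:
  assumes "X \<subseteq> {u<..u + n}" "{u<..u + n} - {k0} \<subseteq> X" "u + n < N"
  shows "excess_sum N X \<le> excess_cap N - (real u - real N / 4)\<^sup>2 / (162 * real N) + 2"
proof -
  have N: "N > 0" using assms by simp
  have X: "X \<subseteq> {1..<N}" using assms(1,3) by force
  have weaken: "(real u - real N / 4)^2 / (162 * real N) \<le> (real u - real N / 4)^2 / (2 * real N)"
    using N by (intro divide_left_mono) auto
  define B where "B = N div 3"
  have B: "3 * B \<le> N" "N \<le> 4 * (B + 1)" "real N / 12 - 1 \<le> real B - real N / 4" 
  proof -
    show "3 * B \<le> N" unfolding B_def by presburger
    show "N \<le> 4 * (B + 1)" unfolding B_def by presburger
    have "N \<le> 3 * B + 2" unfolding B_def by presburger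
    hence "real N \<le> 3 * real B + 2" by linarith
    thus "real N / 12 - 1 \<le> real B - real N / 4" by simp
  qed
  \<comment> \<open>In two of the four cases all indices from \<open>N/4\<close> to \<open>N/3\<close> are missed.\<close>
  have far: ?thesis if *: "\<And>k. k \<in> X \<Longrightarrow> N \<le> 4 * k \<Longrightarrow> B < k"
  proof -
    have "real u \<le> real N" using assms(3) by simp
    hence "\<bar>real u - real N / 4\<bar> \<le> 3 * real N / 4" by linarith
    hence "(real u - real N / 4)^2 \<le> (3 * real N / 4)^2" using abs_le_square_iff[of "real u - real N / 4" "3 * real N / 4"] by simp
    hence u: "(real u - real N / 4)^2 \<le> 9 * real N * real N / 16" by (simp add: power2_eq_square)
    have "(real u - real N / 4)^2 / 162 \<le> (real B - real N / 4)^2 / 2 + real N"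
    proof (cases "N \<ge> 12")
      case True
      hence "(real N / 12 - 1)^2 \<le> (real B - real N / 4)^2" using B(3) by (intro power_mono) auto
      moreover have "(real N / 12 - 1)^2 = real N * real N / 144 - real N / 6 + 1"
        by (simp add: power2_eq_square field_simps)
      ultimately show ?thesis using u by linarith
    next
      case False
      hence "real N * real N \<le> 12 * real N" by (intro mult_right_mono) auto
      thus ?thesis using u zero_le_power2[of "real B - real N / 4"] by linarith
    qed
    hence "((real u - real N / 4)^2 / 162) / real N \<le> ((real B - real N / 4)^2 / 2 + real N) / real N"
      by (rule divide_right_mono) simp
    hence "(real u - real N / 4)^2 / (162 * real N) \<le> (real B - real N / 4)^2 / (2 * real N) + 1"
      using N by (simp add: add_divide_distrib)
    thus ?thesis using deficit_above[OF X B(1,2) *  N] by simp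
  qed
  show ?thesis
  proof (cases "4 * u \<le> N")
    case u: True
    show ?thesis
    proof (cases "N \<le> 4 * (u + n)")
      case True
      have *: "k \<in> X" if "u < k" "4 * k \<le> N" "k \<noteq> k0" for k using that True assms(2) by auto
      have "excess_sum N X \<le> excess_cap N - (real u - real N / 4)\<^sup>2 / (2 * real N) + 2"
        using X u _ N by (rule deficit_below[where ?k0.0 = k0]) (rule *)
      thus ?thesis using weaken by linarith
    next
      case False
      show ?thesis by (rule far) (use assms(1) False in force)
    qed
  next
    case u: False
    show ?thesis
    proof (cases "3 * u \<le> N")
      case True
      have "u < k" if "k \<in> X" for k using that assms(1) by auto
      thus ?thesis using deficit_above[OF X True _ _ N] u weaken by fastforce
    next
      case False
      show ?thesis
      proof (rule far)
        fix k assume "k \<in> X"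
        hence "u < k" using assms(1) by auto
        thus "B < k" using False B(1) by linarith
      qed
    qed
  qed
qed

text \<open>Each term with \<open>|u - a| \<ge> 1\<close> is at most an increment of \<open>M arctan ((x - a) / M)\<close> over an interval of
length one next to \<open>u\<close>, on the side of \<open>a\<close>. At most two terms remain. Increments over
\<open>[u - 1, u + 1]\<close> serve both sides of \<open>a\<close> and telescope with step two.\<close>

lemma sum_lorentzian_le:
  fixes a M :: real
  assumes "M > 0"
  shows "(\<Sum>u<n. 1 / (1 + ((real u - a) / M)^2)) \<le> 2 * pi * M + 2"
proof -
  define g where "g x = M * arctan ((x - a) / M)" for x :: real
  have g_mono: "g x \<le> g y" if "x \<le> y" for x y
    unfolding g_def using that assms by (intro mult_left_mono) (auto simp: arctan_le_iff divide_right_mono)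
  have g_deriv: "(g has_field_derivative 1 / (1 + ((x - a) / M)^2)) (at x)" for x
  proof -
    have "((\<lambda>x. (x - a) / M) has_field_derivative 1 / M) (at x)" using assms by (auto intro!: derivative_eq_intros)
    from DERIV_cmult[OF DERIV_chain2[OF DERIV_arctan this], of M] show ?thesis
      unfolding g_def[abs_def] using assms by (simp add: inverse_eq_divide)
  qed
  have pt: "1 / (1 + ((x - a) / M)^2) \<le> g (x + 1) - g (x - 1) + (if \<bar>x - a\<bar> < 1 then 1 else 0)" for x
  proof (cases "\<bar>x - a\<bar> < 1")
    case True
    have "1 / (1 + ((x - a) / M)^2) \<le> 1 / 1" by (intro divide_left_mono) (auto intro: add_pos_nonneg)
    thus ?thesis using True g_mono[of "x - 1" "x + 1"] by simp
  next
    case False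
    have "\<exists>z. \<bar>z - a\<bar> \<le> \<bar>x - a\<bar> \<and> 1 / (1 + ((z - a) / M)^2) \<le> g (x + 1) - g (x - 1)"
    proof (cases "x \<ge> a")
      case True
      obtain z where "x - 1 < z" "z < x" "g x - g (x - 1) = (x - (x - 1)) * (1 / (1 + ((z - a) / M)^2))"
        using MVT2[of "x - 1" x g "\<lambda>z. 1 / (1 + ((z - a) / M)^2)"] g_deriv by auto
      thus ?thesis using True False g_mono[of x "x + 1"] by (intro exI[of _ z]) auto
    next
      case False2: False
      obtain z where "x < z" "z < x + 1" "g (x + 1) - g x = (x + 1 - x) * (1 / (1 + ((z - a) / M)^2))"
        using MVT2[of x "x + 1" g "\<lambda>z. 1 / (1 + ((z - a) / M)^2)"] g_deriv by auto
      thus ?thesis using False2 False g_mono[of "x - 1" x] by (intro exI[of _ z]) auto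
    qed
    then obtain z where z: "\<bar>z - a\<bar> \<le> \<bar>x - a\<bar>" "1 / (1 + ((z - a) / M)^2) \<le> g (x + 1) - g (x - 1)" by blast
    have "\<bar>(z - a) / M\<bar> \<le> \<bar>(x - a) / M\<bar>" using z(1) assms by (simp add: divide_right_mono)
    hence "((z - a) / M)^2 \<le> ((x - a) / M)^2" by (simp only: abs_le_square_iff)
    hence "1 / (1 + ((x - a) / M)^2) \<le> 1 / (1 + ((z - a) / M)^2)"
      by (intro divide_left_mono) (auto intro!: mult_pos_pos add_pos_nonneg)
    thus ?thesis using z(2) False by simp
  qed
  have tele: "(\<Sum>u<n. g (real u + 1) - g (real u - 1)) = g (real n) + g (real n - 1) - g 0 - g (- 1)"
    by (induction n) (auto simp: add.commute)
  have "(\<Sum>u<n. if \<bar>real u - a\<bar> < 1 then 1 else 0 :: real) = real (card {u\<in>{..<n}. \<bar>real u - a\<bar> < 1})"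
    by (subst sum.inter_filter[symmetric]) auto
  also have "\<dots> \<le> real (card {nat \<lfloor>a\<rfloor>, nat (\<lfloor>a\<rfloor> + 1)})"
  proof -
    have "u \<in> {nat \<lfloor>a\<rfloor>, nat (\<lfloor>a\<rfloor> + 1)}" if "\<bar>real u - a\<bar> < 1" for u
    proof -
      have "\<lfloor>a\<rfloor> = int u \<or> \<lfloor>a\<rfloor> + 1 = int u" using that by linarith
      thus ?thesis by auto
    qed
    thus ?thesis by (intro of_nat_mono card_mono) auto
  qed
  also have "\<dots> \<le> 2" by (simp add: card_insert_if)
  finally have ind: "(\<Sum>u<n. if \<bar>real u - a\<bar> < 1 then 1 else 0 :: real) \<le> 2" .
  have gb: "g x \<le> M * (pi / 2)" "- (M * (pi / 2)) \<le> g x" for x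
    unfolding g_def using assms arctan_bounded[of "(x - a) / M"] 
      mult_left_mono[of "arctan ((x - a) / M)" "pi / 2" M] mult_left_mono[of "- (pi / 2)" "arctan ((x - a) / M)" M] by auto
  have "(\<Sum>u<n. 1 / (1 + ((real u - a) / M)^2)) \<le> (\<Sum>u<n. g (real u + 1) - g (real u - 1) + (if \<bar>real u - a\<bar> < 1 then 1 else 0))"
    by (intro sum_mono pt)
  also have "\<dots> = g (real n) + g (real n - 1) - g 0 - g (- 1) + (\<Sum>u<n. if \<bar>real u - a\<bar> < 1 then 1 else 0)"
    by (simp add: sum.distrib tele)
  also have "\<dots> \<le> 2 * pi * M + 2"
    using ind gb(1)[of "real n"] gb(1)[of "real n - 1"] gb(2)[of 0] gb(2)[of "- 1"] by (simp add: algebra_simps)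
  finally show ?thesis .
qed

lemma run_excess_lower:
  assumes "u + n < N"
  shows "excess_int N (real (u + n) + 1 / 2) - excess_int N (real u + 1 / 2) \<le> excess_sum N {u<..u + n}"
  using assms
proof (induction n)
  case (Suc n)
  define x where "x = real (u + n)"
  have "{u<..u + Suc n} = insert (Suc (u + n)) {u<..u + n}" by auto
  hence "excess_sum N {u<..u + Suc n} = excess N (real (Suc (u + n))) + excess_sum N {u<..u + n}"
    by simp
  moreover have "real (Suc (u + n)) = x + 1" "real (u + Suc n) = x + 1" by (simp_all add: x_def)
  moreover have "excess_int N (x + 1 + 1 / 2) - excess_int N (x + 1 - 1 / 2) \<le> excess N (x + 1)"
    using Suc.prems by (intro midpoint_excess) (auto simp: x_def)
  moreover have "x + 1 - 1 / 2 = x + 1 / 2" by simp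
  moreover have "excess_int N (x + 1 / 2) - excess_int N (real u + 1 / 2) \<le> excess_sum N {u<..u + n}"
    unfolding x_def using Suc by simp
  ultimately show ?case by (simp only:)
qed auto

text \<open>Both ends of the run lie within \<open>O(sqrt N)\<close> of the critical points \<open>N/4\<close> and \<open>3N/4\<close> of \<open>excess_int\<close>, so the
sum falls below the integral over the middle half by at most a constant.\<close>

lemma central_run_lower:
  assumes "u + n < N" "N \<ge> 400" "\<bar>real n - real N / 2\<bar> \<le> 1" "\<bar>real u - real N / 4\<bar> \<le> sqrt (real N) + 1"
  shows "excess_int N (3 * real N / 4) - excess_int N (real N / 4) - 200 \<le> excess_sum N {u<..u + n}"
proof -
  let ?F = "excess_int N"
  define s where "s = sqrt (real N)"
  have "sqrt 400 \<le> s" unfolding s_def using assms(2) by (subst real_sqrt_le_iff) simp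
  hence s: "20 \<le> s" by simp
  have ss: "s * s = real N" by (simp add: s_def)
  have "20 * s \<le> real N" unfolding ss[symmetric] using s by (intro mult_right_mono) auto
  hence sN: "s + 3 \<le> real N / 12" using s by linarith
  have near: "\<bar>?F x - ?F (real N / 4)\<bar> \<le> 32" if "\<bar>x - real N / 4\<bar> \<le> s + 3" for x
  proof -
    have "\<bar>?F x - ?F (real N / 4)\<bar> \<le> 8 * (x - real N / 4)^2 / real N"
      using that sN assms(2) by (intro excess_int_near_quarter) (auto simp: abs_le_iff)
    also have "\<dots> \<le> 8 * (2 * s)^2 / real N"
    proof -
      have "\<bar>x - real N / 4\<bar> \<le> \<bar>2 * s\<bar>" using that s by linarith
      hence "(x - real N / 4)^2 \<le> (2 * s)^2" by (simp only: abs_le_square_iff)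
      thus ?thesis by (intro divide_right_mono mult_left_mono) auto
    qed
    also have "\<dots> = 32" using assms(2) by (simp add: power2_eq_square ss)
    finally show ?thesis .
  qed
  have N: "N > 0" using assms by simp
  have "?F (real (u + n) + 1 / 2) = - ?F (real N - (real (u + n) + 1 / 2)) - ln 2 / 2 * real N"
    using excess_int_reflect[OF N, of "real (u + n) + 1 / 2"] by simp
  moreover have "?F (3 * real N / 4) = - ?F (real N / 4) - ln 2 / 2 * real N"
    using excess_int_reflect[OF N, of "real N / 4"] by simp
  moreover have "\<bar>?F (real N - (real (u + n) + 1 / 2)) - ?F (real N / 4)\<bar> \<le> 32"
    by (rule near) (use assms in \<open>auto simp: s_def\<close>)
  moreover have "\<bar>?F (real u + 1 / 2) - ?F (real N / 4)\<bar> \<le> 32"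
    by (rule near) (use assms in \<open>auto simp: s_def\<close>)
  ultimately show ?thesis using run_excess_lower[OF assms(1)] by linarith
qed

section \<open>Interpolation at roots of unity\<close>

text \<open>The \<open>N\<close>-th roots of unity, enumerated from the \<open>b\<close>-th one on. The offset allows every cyclic interval to be
indexed by an initial segment of the natural numbers.\<close>

definition node :: "nat \<Rightarrow> nat \<Rightarrow> nat \<Rightarrow> complex" where
  "node N b i = cis (2 * pi * real (b + i) / real N)"

definition chord :: "nat \<Rightarrow> nat \<Rightarrow> nat \<Rightarrow> nat \<Rightarrow> real" where
  "chord N b i j = cmod (node N b i - node N b j)"

lemma cis_diff: "cis x - cis y = 2 * \<i> * of_real (sin ((x - y) / 2)) * cis ((x + y) / 2)"
proof -
  have "x = (x + y) / 2 + (x - y) / 2" "y = (x + y) / 2 - (x - y) / 2" by (auto simp: field_simps)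
  hence "cis x - cis y = cis ((x + y) / 2 + (x - y) / 2) - cis ((x + y) / 2 - (x - y) / 2)" by simp
  also have "\<dots> = 2 * \<i> * of_real (sin ((x - y) / 2)) * cis ((x + y) / 2)"
    by (simp add: complex_eq_iff cos_add cos_diff sin_add sin_diff)
  finally show ?thesis .
qed

lemma node_diff:
  "node N b j - node N b i = \<i> * of_real (2 * sin (pi * (real j - real i) / real N)) * (cis (pi * real (b + j) / real N) * cis (pi * real (b + i) / real N))"
proof -
  have minus: "(2 * pi * x / real N - 2 * pi * y / real N) / 2 = pi * (x - y) / real N" for x y
    by (simp add: right_diff_distrib diff_divide_distrib)
  have plus: "(2 * pi * x / real N + 2 * pi * y / real N) / 2 = pi * x / real N + pi * y / real N" for x y
    by (simp add: add_divide_distrib)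
  have "real (b + j) - real (b + i) = real j - real i" by simp
  thus ?thesis unfolding node_def cis_diff minus plus by (simp add: cis_mult)
qed

lemma chord_commute: "chord N b i j = chord N b j i"
  unfolding chord_def by (rule norm_minus_commute)

lemma chord_eq:
  assumes "i < j" "j < N"
  shows "chord N b j i = exp (lg_chord N (real (j - i)))"
proof -
  have s: "0 < sin (pi * (real j - real i) / real N)" using assms by (intro sin_chord_pos) auto
  have "chord N b j i = 2 * sin (pi * (real j - real i) / real N)"
    unfolding chord_def node_diff using s by (simp add: norm_mult)
  thus ?thesis using s assms by (simp add: lg_chord_def of_nat_diff)
qed

lemma chord_le_2: "chord N b i j \<le> 2"
  unfolding chord_def using norm_triangle_ineq4[of "node N b i" "node N b j"] by (simp add: node_def)

text \<open>The cyclic distance from \<open>i\<close> to \<open>j\<close> in positive direction, for \<open>i, j < N\<close>. In contrast to \<open>|j - i|\<close> it is injective in each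
argument, so products of chords become sums over sets of indices.\<close>

definition gap :: "nat \<Rightarrow> nat \<Rightarrow> nat \<Rightarrow> nat" where
  "gap N j i = (if i \<le> j then j - i else j + N - i)"

lemma chord_gap:
  assumes "i < N" "j < N" "i \<noteq> j"
  shows "chord N b j i = exp (lg_chord N (real (gap N j i)))"
proof (cases "i < j")
  case True
  thus ?thesis using chord_eq[OF True assms(2)] by (simp add: gap_def)
next
  case False
  hence "j < i" using assms by simp
  hence "chord N b j i = exp (lg_chord N (real (i - j)))"
    using chord_eq[of j i N b] assms chord_commute by simp
  also have "lg_chord N (real (i - j)) = lg_chord N (real (gap N j i))"
  proof -
    have "real (gap N j i) = real N - real (i - j)" using \<open>j < i\<close> assms by (simp add: gap_def of_nat_diff)
    thus ?thesis using excess_reflect[of N "real (i - j)"] assms by (simp add: excess_def)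
  qed
  finally show ?thesis .
qed

lemma gap_range: "i < N \<Longrightarrow> j < N \<Longrightarrow> i \<noteq> j \<Longrightarrow> gap N j i \<in> {1..<N}"
  by (auto simp: gap_def)

lemma chord_pos: "i < N \<Longrightarrow> j < N \<Longrightarrow> i \<noteq> j \<Longrightarrow> 0 < chord N b j i"
  by (simp add: chord_gap)

lemma inj_on_gap1: "j < N \<Longrightarrow> inj_on (gap N j) {..<N}"
  by (auto simp: inj_on_def gap_def split: if_splits)

lemma inj_on_gap2: "i < N \<Longrightarrow> inj_on (\<lambda>j. gap N j i) {..<N}"
  by (auto simp: inj_on_def gap_def split: if_splits)

lemma inj_on_node: "inj_on (node N b) {..<N}"
proof (rule inj_onI)
  fix i j assume *: "i \<in> {..<N}" "j \<in> {..<N}" "node N b i = node N b j"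
  thus "i = j" using chord_pos[of i N j b] by (cases "i = j") (auto simp: chord_def)
qed

lemma node_power_N: "N > 0 \<Longrightarrow> node N b i ^ N = 1"
proof -
  assume "N > 0"
  hence "node N b i ^ N = cis (2 * pi * real (b + i))" unfolding node_def Complex.DeMoivre by simp
  thus ?thesis using cis_multiple_2pi[of "real (b + i)"] by simp
qed

lemma sum_node_powers:
  assumes "N > 0" "t < N" "u < N"
  shows "(\<Sum>i<N. node N b i ^ t * cnj (node N b i) ^ u) = (if t = u then of_nat N else 0)"
proof -
  define z where "z = cis (2 * pi * (real t - real u) / real N)"
  define c where "c = cis (2 * pi * real b * (real t - real u) / real N)"
  have pt: "node N b i ^ t * cnj (node N b i) ^ u = c * z ^ i" for i
    unfolding node_def c_def z_def cis_cnj Complex.DeMoivre cis_mult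
    by (rule arg_cong[where f = cis]) (use assms in \<open>simp add: field_simps\<close>)
  show ?thesis
  proof (cases "t = u")
    case True
    thus ?thesis using pt by (simp add: c_def z_def)
  next
    case False
    have zN: "z ^ N = 1"
    proof -
      have "z ^ N = cis (2 * pi * (real t - real u))" unfolding z_def Complex.DeMoivre using assms by simp
      also have "real t - real u = of_int (int t - int u)" by simp
      also have "cis (2 * pi * of_int (int t - int u)) = 1"
        by (rule cis_multiple_2pi) simp
      finally show ?thesis .
    qed
    have z1: "z \<noteq> 1"
    proof
      assume "z = 1"
      hence "cos (2 * pi * (real t - real u) / real N) = 1" by (simp add: z_def complex_eq_iff)
      then obtain m :: int where "2 * pi * (real t - real u) / real N = of_int m * 2 * pi"
        using cos_one_2pi_int by auto
      hence "2 * pi * (real t - real u) = of_int m * 2 * pi * real N" using assms(1) by (simp add: divide_eq_eq)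
      hence "(2 * pi) * (real t - real u) = (2 * pi) * (of_int m * real N)" by (simp only: mult_ac)
      hence "real t - real u = of_int m * real N" by (subst (asm) mult_cancel_left) simp
      hence "of_int (int t - int u) = (of_int (m * int N) :: real)" by simp
      hence tu: "int t - int u = m * int N" by (simp only: of_int_eq_iff)
      have "\<bar>int t - int u\<bar> < int N" using assms by auto
      hence "\<bar>m\<bar> * int N < 1 * int N" unfolding tu by (simp add: abs_mult)
      hence "m = 0" using mult_less_cancel_right_disj[of "\<bar>m\<bar>" "int N" 1] by auto
      thus False using tu False by simp
    qed
    have "(\<Sum>i<N. z ^ i) = 0" using geometric_sum[OF z1, of N] zN by simp
    thus ?thesis using False pt by (simp flip: sum_distrib_left)
  qed
qed

lemma parseval:
  assumes "N > 0" "n \<le> N"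
  shows "(\<Sum>i<N. (cmod (\<Sum>t<n. v t * node N b i ^ t))^2) = real N * (\<Sum>t<n. (cmod (v t))^2)"
proof -
  have "complex_of_real (\<Sum>i<N. (cmod (\<Sum>t<n. v t * node N b i ^ t))^2) = (\<Sum>i<N. (\<Sum>t<n. v t * node N b i ^ t) * cnj (\<Sum>t<n. v t * node N b i ^ t))"
    unfolding of_real_sum by (simp only: complex_norm_square)
  also have "\<dots> = (\<Sum>i<N. \<Sum>t<n. \<Sum>u<n. v t * cnj (v u) * (node N b i ^ t * cnj (node N b i) ^ u))"
    unfolding cnj_sum sum_product by (intro sum.cong refl) (simp add: mult_ac)
  also have "\<dots> = (\<Sum>t<n. \<Sum>i<N. \<Sum>u<n. v t * cnj (v u) * (node N b i ^ t * cnj (node N b i) ^ u))"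
    by (rule sum.swap)
  also have "\<dots> = (\<Sum>t<n. \<Sum>u<n. \<Sum>i<N. v t * cnj (v u) * (node N b i ^ t * cnj (node N b i) ^ u))"
    by (rule sum.cong[OF refl], rule sum.swap)
  also have "\<dots> = (\<Sum>t<n. \<Sum>u<n. v t * cnj (v u) * (if t = u then of_nat N else 0))"
    using assms by (intro sum.cong refl) (simp add: sum_node_powers flip: sum_distrib_left)
  also have "\<dots> = (\<Sum>t<n. v t * cnj (v t) * of_nat N)"
    by (intro sum.cong refl) (simp add: if_distrib[of "\<lambda>x. _ * x"] sum.delta' cong: if_cong)
  also have "\<dots> = (\<Sum>t<n. complex_of_real ((cmod (v t))^2) * of_nat N)"
    by (simp only: complex_norm_square)
  also have "\<dots> = complex_of_real (real N * (\<Sum>t<n. (cmod (v t))^2))"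
    by (simp add: sum_distrib_left mult.commute)
  finally show ?thesis by (simp only: of_real_eq_iff)
qed

text \<open>The Lagrange basis polynomial of the nodes in \<open>I\<close> that is \<open>1\<close> at the node \<open>s\<close>.\<close>

definition lagr :: "nat \<Rightarrow> nat \<Rightarrow> nat set \<Rightarrow> nat \<Rightarrow> complex poly" where
  "lagr N b I s = smult (1 / (\<Prod>t\<in>I-{s}. node N b s - node N b t)) (\<Prod>t\<in>I-{s}. [:- node N b t, 1:])"

lemma poly_lagr: "poly (lagr N b I s) w = (\<Prod>t\<in>I-{s}. w - node N b t) / (\<Prod>t\<in>I-{s}. node N b s - node N b t)"
  by (simp add: lagr_def poly_prod)

lemma degree_lagr:
  assumes "finite I" "s \<in> I"
  shows "degree (lagr N b I s) < card I"
proof -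
  have "degree (lagr N b I s) \<le> degree (\<Prod>t\<in>I-{s}. [:- node N b t, 1:])" unfolding lagr_def by (rule degree_smult_le)
  also have "\<dots> \<le> (\<Sum>t\<in>I-{s}. degree [:- node N b t, 1:])" using degree_prod_sum_le[of "I - {s}" "\<lambda>t. [:- node N b t, 1:]"] assms(1) by (simp add: o_def)
  also have "\<dots> = card I - 1" using assms by simp
  also have "\<dots> < card I" 
  proof -
    have "card I > 0" using assms by (auto simp: card_gt_0_iff)
    thus ?thesis by simp
  qed
  finally show ?thesis .
qed

lemma poly_lagr_node:
  assumes "I \<subseteq> {..<N}" "s \<in> I" "i \<in> I"
  shows "poly (lagr N b I s) (node N b i) = (if i = s then 1 else 0)"
proof -
  have fin: "finite I" using assms(1) finite_subset by blast
  show ?thesis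
  proof (cases "i = s")
    case True
    have "(\<Prod>t\<in>I-{s}. node N b s - node N b t) \<noteq> 0"
      using assms fin inj_on_node[of N b] by (auto simp: inj_on_def)
    thus ?thesis using True by (simp add: poly_lagr)
  next
    case False
    hence "(\<Prod>t\<in>I-{s}. node N b i - node N b t) = 0" using fin assms by (intro prod_zero) auto
    thus ?thesis using False by (simp add: poly_lagr)
  qed
qed

lemma poly_lagr_sum_node:
  assumes I: "I \<subseteq> {..<N}" and W: "W \<subseteq> I" and i: "i \<in> I"
  shows "poly (\<Sum>s\<in>W. smult (z s) (lagr N b I s)) (node N b i) = (if i \<in> W then z i else 0)"
proof -
  have fin: "finite W" using I W by (meson finite_lessThan finite_subset)
  have "poly (\<Sum>s\<in>W. smult (z s) (lagr N b I s)) (node N b i) = (\<Sum>s\<in>W. z s * (if i = s then 1 else 0))"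
    unfolding poly_sum
  proof (intro sum.cong refl)
    fix s assume "s \<in> W"
    hence "poly (lagr N b I s) (node N b i) = (if i = s then 1 else 0)"
      using W by (intro poly_lagr_node[OF I _ i]) blast
    thus "poly (smult (z s) (lagr N b I s)) (node N b i) = z s * (if i = s then 1 else 0)" by simp
  qed
  also have "\<dots> = (if i \<in> W then z i else 0)" using fin by (simp add: if_distrib[of "\<lambda>x. _ * x"] cong: if_cong)
  finally show ?thesis .
qed

lemma degree_lagr_sum:
  assumes "finite I" "I \<noteq> {}" "W \<subseteq> I"
  shows "degree (\<Sum>s\<in>W. smult (z s) (lagr N b I s)) < card I"
proof -
  have "degree (\<Sum>s\<in>W. smult (z s) (lagr N b I s)) \<le> card I - 1"
  proof (rule degree_sum_le[OF finite_subset[OF assms(3,1)]])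
    fix s assume "s \<in> W"
    hence "degree (lagr N b I s) < card I" using assms by (intro degree_lagr) auto
    thus "degree (smult (z s) (lagr N b I s)) \<le> card I - 1"
      using degree_smult_le[of "z s" "lagr N b I s"] by linarith
  qed
  moreover have "card I > 0" using assms by (auto simp: card_gt_0_iff)
  ultimately show ?thesis by linarith
qed

lemma poly_coeff_sum:
  fixes f :: "complex poly"
  assumes "degree f < n"
  shows "poly f w = (\<Sum>t<n. coeff f t * w ^ t)"
proof -
  have "{..n - 1} = {..<n}" using assms by auto
  hence "f = (\<Sum>t<n. monom (coeff f t) t)" using poly_as_sum_of_monoms'[of f "n - 1"] assms by simp
  hence "poly f w = poly (\<Sum>t<n. monom (coeff f t) t) w" by (rule arg_cong)
  thus ?thesis unfolding poly_sum Polynomial.poly_monom .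
qed

lemma lagrange_interpolation:
  assumes I: "I \<subseteq> {..<N}" and deg: "degree f < card I"
  shows "f = (\<Sum>s\<in>I. smult (poly f (node N b s)) (lagr N b I s))"
proof (rule poly_eqI_degree)
  have fin: "finite I" "I \<noteq> {}" using I finite_subset deg by auto
  have card: "card (node N b ` I) = card I"
    using inj_on_subset[OF inj_on_node I] by (rule card_image)
  show "poly f x = poly (\<Sum>s\<in>I. smult (poly f (node N b s)) (lagr N b I s)) x" if "x \<in> node N b ` I" for x
    using that poly_lagr_sum_node[OF I subset_refl, of _ "\<lambda>s. poly f (node N b s)" b] by auto
  show "degree f < card (node N b ` I)" using deg card by simp
  show "degree (\<Sum>s\<in>I. smult (poly f (node N b s)) (lagr N b I s)) < card (node N b ` I)"
    unfolding card by (rule degree_lagr_sum[OF fin subset_refl])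
qed

text \<open>The product is the absolute value of the derivative of \<open>X^N - 1\<close> at the node \<open>x\<close>. The polynomial
\<open>f = (X^N - x^N) / (X - x)\<close> vanishes at all other nodes, so it is a multiple of a Lagrange basis polynomial, and
its leading coefficient \<open>1\<close> determines the product.\<close>

lemma prod_chords:
  assumes s: "s < N"
  shows "(\<Prod>t\<in>{..<N}-{s}. chord N b s t) = real N"
proof -
  have N: "N > 0" using s by simp
  let ?x = "node N b s"
  define f where "f = (\<Sum>t<N. monom (?x ^ (N - 1 - t)) t)"
  have deg: "degree f \<le> N - 1"
    unfolding f_def by (rule degree_sum_le) (auto intro: order_trans[OF degree_monom_le])
  have val: "poly f (node N b i) = (if i = s then of_nat N * ?x ^ (N - 1) else 0)" if i: "i < N" for i
  proof -
    have pf: "poly f w = (\<Sum>t<N. ?x ^ (N - Suc t) * w ^ t)" for w by (simp add: f_def poly_sum poly_monom)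
    show ?thesis
    proof (cases "i = s")
      case True
      have "(\<Sum>t<N. ?x ^ (N - Suc t) * ?x ^ t) = (\<Sum>t<N. ?x ^ (N - 1))"
        by (intro sum.cong refl) (simp flip: power_add)
      thus ?thesis using True by (simp add: pf)
    next
      case False
      have "(node N b i - ?x) * poly f (node N b i) = node N b i ^ N - ?x ^ N"
        unfolding pf by (subst power_diff_sumr2) (simp add: mult_ac)
      also have "\<dots> = 0" using node_power_N[OF N] by simp
      finally show ?thesis using False inj_on_node[of N b] i s by (auto simp: inj_on_def)
    qed
  qed
  have "f = (\<Sum>i<N. smult (poly f (node N b i)) (lagr N b {..<N} i))"
    using deg N by (intro lagrange_interpolation) auto
  also have "\<dots> = (\<Sum>i<N. if i = s then smult (of_nat N * ?x ^ (N - 1)) (lagr N b {..<N} s) else 0)"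
    by (intro sum.cong refl) (auto simp: val)
  also have "\<dots> = smult (of_nat N * ?x ^ (N - 1)) (lagr N b {..<N} s)" using s by simp
  finally have "coeff f (N - 1) = of_nat N * ?x ^ (N - 1) * coeff (lagr N b {..<N} s) (N - 1)" by simp
  moreover have "coeff f (N - 1) = 1"
  proof -
    have "coeff f (N - 1) = (\<Sum>t<N. if t = N - 1 then 1 else 0)"
      unfolding f_def coeff_sum by (intro sum.cong refl) (auto simp: coeff_monom)
    thus ?thesis using N by simp
  qed
  moreover have "coeff (\<Prod>t\<in>{..<N}-{s}. [:- node N b t, 1:]) (N - 1) = 1"
  proof -
    have "degree (\<Prod>t\<in>{..<N}-{s}. [:- node N b t, 1:]) = N - 1"
      using s by (subst degree_prod_eq_sum_degree) auto
    moreover have "lead_coeff (\<Prod>t\<in>{..<N}-{s}. [:- node N b t, 1:]) = 1" by (simp add: lead_coeff_prod)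
    ultimately show ?thesis by simp
  qed
  ultimately have eq: "1 = of_nat N * ?x ^ (N - 1) / (\<Prod>t\<in>{..<N}-{s}. ?x - node N b t)"
    by (simp add: lagr_def)
  hence "cmod 1 = cmod (of_nat N * ?x ^ (N - 1) / (\<Prod>t\<in>{..<N}-{s}. ?x - node N b t))" by simp
  hence "1 = real N / (\<Prod>t\<in>{..<N}-{s}. chord N b s t)"
    using N by (simp add: norm_divide norm_mult norm_power node_def chord_def prod_norm)
  thus ?thesis using eq by (auto simp: field_simps split: if_splits)
qed

section \<open>Energy of the Lagrange basis\<close>

abbreviation (input) lagr_value :: "nat \<Rightarrow> nat \<Rightarrow> nat set \<Rightarrow> nat \<Rightarrow> nat \<Rightarrow> complex" where
  "lagr_value N b I s j \<equiv> poly (lagr N b I s) (node N b j)"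

text \<open>The denominator of the Lagrange basis polynomial is replaced by the product of the chords from \<open>s\<close> to
the nodes outside \<open>I\<close>. The number of chords is then \<open>N - 1\<close> for every \<open>I\<close>.\<close>

lemma cmod_lagr:
  assumes I: "I \<subseteq> {..<N}" and s: "s \<in> I" and j: "j < N" "j \<notin> I"
  shows "cmod (lagr_value N b I s j) =
    chord N b s j * (\<Prod>t\<in>I-{s}. chord N b j t) * (\<Prod>t\<in>{..<N}-I-{j}. chord N b s t) / real N"
proof -
  have fin: "finite I" using I finite_subset by blast
  have sN: "s < N" "N > 0" using I s by auto
  have pos: "0 < (\<Prod>t\<in>I-{s}. chord N b s t)"
    using I sN s by (intro prod_pos) (auto intro!: chord_pos)
  have "real N = (\<Prod>t\<in>(I-{s}) \<union> ({..<N}-I). chord N b s t)"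
    unfolding prod_chords[OF sN(1), of b, symmetric] by (rule prod.cong) (use I s in auto)
  also have "\<dots> = (\<Prod>t\<in>I-{s}. chord N b s t) * (\<Prod>t\<in>{..<N}-I. chord N b s t)"
    using fin by (intro prod.union_disjoint) auto
  also have "(\<Prod>t\<in>{..<N}-I. chord N b s t) = chord N b s j * (\<Prod>t\<in>{..<N}-I-{j}. chord N b s t)"
    using j by (intro prod.remove) auto
  finally have N: "real N = (\<Prod>t\<in>I-{s}. chord N b s t) * (chord N b s j * (\<Prod>t\<in>{..<N}-I-{j}. chord N b s t))" .
  have "cmod (lagr_value N b I s j) = (\<Prod>t\<in>I-{s}. chord N b j t) / (\<Prod>t\<in>I-{s}. chord N b s t)"
    by (simp add: poly_lagr norm_divide prod_norm chord_def)
  also have "\<dots> = chord N b s j * (\<Prod>t\<in>I-{s}. chord N b j t) * (\<Prod>t\<in>{..<N}-I-{j}. chord N b s t) / real N"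
  proof -
    have gen: "x / y = c * x * z / (y * (c * z))" if "y \<noteq> 0" "c * z \<noteq> 0" for x y c z :: real
      using that by simp
    have "chord N b s j * (\<Prod>t\<in>{..<N}-I-{j}. chord N b s t) \<noteq> 0"
      using N sN(2) by (metis mult_zero_right of_nat_0_eq_iff less_irrefl)
    thus ?thesis unfolding N using pos by (intro gen) auto
  qed
  finally show ?thesis .
qed

lemma prod_exp_lg_chord:
  assumes fin: "finite T" and h: "\<And>t. t \<in> T \<Longrightarrow> h t = exp (lg_chord N (real (g t)))" and inj: "inj_on g T"
  shows "(\<Prod>t\<in>T. h t) = exp (excess_sum N (g ` T) + real (card T) * (ln 2 / 2))"
proof -
  have "(\<Prod>t\<in>T. h t) = (\<Prod>t\<in>T. exp (excess N (real (g t)) + ln 2 / 2))"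
    by (intro prod.cong refl) (simp add: h excess_def)
  also have "\<dots> = exp (\<Sum>t\<in>T. excess N (real (g t)) + ln 2 / 2)" by (rule exp_sum[OF fin, symmetric])
  also have "(\<Sum>t\<in>T. excess N (real (g t)) + ln 2 / 2) = (\<Sum>t\<in>T. excess N (real (g t))) + real (card T) * (ln 2 / 2)"
    by (simp add: sum.distrib)
  also have "(\<Sum>t\<in>T. excess N (real (g t))) = excess_sum N (g ` T)"
    by (simp add: sum.reindex[OF inj])
  finally show ?thesis .
qed

lemma prod_chord_exp1:
  assumes "T \<subseteq> {..<N}" "j < N" "j \<notin> T"
  shows "(\<Prod>t\<in>T. chord N b j t) = exp (excess_sum N (gap N j ` T) + real (card T) * (ln 2 / 2))"
    and "gap N j ` T \<subseteq> {1..<N}"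
proof -
  have ne: "t < N" "t \<noteq> j" if "t \<in> T" for t using that assms by auto
  show "(\<Prod>t\<in>T. chord N b j t) = exp (excess_sum N (gap N j ` T) + real (card T) * (ln 2 / 2))"
    using finite_subset[OF assms(1)] inj_on_subset[OF inj_on_gap1[OF assms(2)] assms(1)] ne assms(2)
    by (intro prod_exp_lg_chord chord_gap) auto
  show "gap N j ` T \<subseteq> {1..<N}" using assms gap_range by blast
qed

lemma prod_chord_exp2:
  assumes "T \<subseteq> {..<N}" "s < N" "s \<notin> T"
  shows "(\<Prod>t\<in>T. chord N b s t) = exp (excess_sum N ((\<lambda>t. gap N t s) ` T) + real (card T) * (ln 2 / 2))"
    and "(\<lambda>t. gap N t s) ` T \<subseteq> {1..<N}"
proof -
  have ne: "t < N" "s \<noteq> t" if "t \<in> T" for t using that assms by auto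
  show "(\<Prod>t\<in>T. chord N b s t) = exp (excess_sum N ((\<lambda>t. gap N t s) ` T) + real (card T) * (ln 2 / 2))"
    unfolding chord_commute[of N b s]
    using finite_subset[OF assms(1)] inj_on_subset[OF inj_on_gap2[OF assms(2)] assms(1)] ne assms(2)
    by (intro prod_exp_lg_chord chord_gap) auto
  show "(\<lambda>t. gap N t s) ` T \<subseteq> {1..<N}" using assms gap_range by blast
qed

text \<open>The levels \<open>ln 2 / 2\<close> of the at most \<open>N\<close> chords and the two caps combine to the exponent
\<open>2 G N / \<pi>\<close> by \<open>excess_int_total\<close>; \<open>p\<close> and \<open>q\<close> record how far the two sums are from their caps.\<close>

lemma cmod_lagr_upper:
  assumes I: "I \<subseteq> {..<N}" and s: "s \<in> I" and j: "j < N" "j \<notin> I"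
    and X: "excess_sum N (gap N j ` (I-{s})) \<le> excess_cap N + p"
    and Y: "excess_sum N ((\<lambda>t. gap N t s) ` ({..<N}-I-{j})) \<le> excess_cap N + q"
  shows "cmod (lagr_value N b I s j) \<le> 2 / real N * exp (main_term N + p + q + 2)"
proof -
  have sN: "s < N" "N > 0" using I s by auto
  have fin: "finite I" using I finite_subset by blast
  let ?P = "\<Prod>t\<in>I-{s}. chord N b j t" and ?Q = "\<Prod>t\<in>{..<N}-I-{j}. chord N b s t"
  have P: "?P = exp (excess_sum N (gap N j ` (I-{s})) + real (card (I-{s})) * (ln 2 / 2))"
    using I j by (intro prod_chord_exp1) auto
  have Q: "?Q = exp (excess_sum N ((\<lambda>t. gap N t s) ` ({..<N}-I-{j})) + real (card ({..<N}-I-{j})) * (ln 2 / 2))"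
    using sN s by (intro prod_chord_exp2) auto
  have card: "card (I-{s}) + card ({..<N}-I-{j}) \<le> N"
  proof -
    have "card (I-{s}) + card ({..<N}-I-{j}) = card ((I-{s}) \<union> ({..<N}-I-{j}))"
      using fin by (subst card_Un_disjoint) auto
    also have "\<dots> \<le> card {..<N}" using I by (intro card_mono) auto
    finally show ?thesis by simp
  qed
  have "real (card (I-{s})) * (ln 2 / 2) + real (card ({..<N}-I-{j})) * (ln 2 / 2) \<le> ln 2 / 2 * real N"
  proof -
    have "real (card (I-{s}) + card ({..<N}-I-{j})) * (ln 2 / 2) \<le> real N * (ln 2 / 2)"
      by (intro mult_right_mono of_nat_mono card) simp
    thus ?thesis by (simp add: algebra_simps)
  qed
  moreover have "2 * excess_cap N + ln 2 / 2 * real N \<le> main_term N + 2"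
    using excess_cap_le[OF sN(2)] excess_int_total[OF sN(2)] by argo
  ultimately have PQ: "?P * ?Q \<le> exp (main_term N + p + q + 2)"
    unfolding P Q exp_add[symmetric] exp_le_cancel_iff using X Y by linarith
  have "cmod (lagr_value N b I s j) = chord N b s j * (?P * ?Q) / real N"
    using cmod_lagr[OF I s j] by simp
  also have "\<dots> \<le> 2 * exp (main_term N + p + q + 2) / real N"
    using chord_le_2 PQ by (intro divide_right_mono mult_mono) (auto simp: P Q)
  finally show ?thesis by simp
qed

text \<open>The squared Hilbert-Schmidt norm of the map that interpolates the values at the nodes outside \<open>I\<close> from those on \<open>I\<close>.\<close>

definition lagr_energy :: "nat \<Rightarrow> nat \<Rightarrow> nat set \<Rightarrow> real" where
  "lagr_energy N b I = (\<Sum>j\<in>{..<N}-I. \<Sum>s\<in>I. (cmod (lagr_value N b I s j))^2)"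

lemma lagr_energy_nonneg: "0 \<le> lagr_energy N b I"
  unfolding lagr_energy_def by (intro sum_nonneg) auto

text \<open>By Parseval the left-hand side is the sum of the squared values at all nodes. The values on \<open>I\<close> are
counted by the summand \<open>1\<close>; those outside are interpolated and bounded by the Cauchy-Schwarz inequality.\<close>

lemma coefficient_norm_le_node_values:
  assumes I: "I \<subseteq> {..<N}"
  shows "real N * (\<Sum>t<card I. (cmod (v t))^2) \<le> (1 + lagr_energy N b I) * (\<Sum>i\<in>I. (cmod (\<Sum>t<card I. v t * node N b i ^ t))^2)"
proof (cases "I = {}")
  case False
  have fin: "finite I" using I finite_subset by blast
  have n: "card I > 0" using fin False by auto
  have cN: "card I \<le> N" using card_mono[OF _ I] by simp
  have N: "N > 0" using n cN by simp
  define f where "f = (\<Sum>t<card I. monom (v t) t)"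
  have pf: "poly f w = (\<Sum>t<card I. v t * w ^ t)" for w by (simp add: f_def poly_sum poly_monom)
  have "degree f \<le> card I - 1"
    unfolding f_def by (rule degree_sum_le) (auto intro: order_trans[OF degree_monom_le])
  hence deg: "degree f < card I" using n by simp
  let ?S = "\<Sum>i\<in>I. (cmod (poly f (node N b i)))^2"
  have pt: "(cmod (poly f (node N b j)))^2 \<le> ?S * (\<Sum>s\<in>I. (cmod (lagr_value N b I s j))^2)" for j
  proof -
    have "poly f (node N b j) = (\<Sum>s\<in>I. poly f (node N b s) * lagr_value N b I s j)"
      by (subst lagrange_interpolation[OF I deg, of b]) (simp add: poly_sum)
    hence "cmod (poly f (node N b j)) \<le> (\<Sum>s\<in>I. cmod (poly f (node N b s)) * cmod (lagr_value N b I s j))"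
      by (auto intro!: sum_norm_le simp: norm_mult)
    hence "(cmod (poly f (node N b j)))^2 \<le> (\<Sum>s\<in>I. cmod (poly f (node N b s)) * cmod (lagr_value N b I s j))^2"
      by (intro power_mono) auto
    also have "\<dots> \<le> ?S * (\<Sum>s\<in>I. (cmod (lagr_value N b I s j))^2)"
      by (rule Cauchy_Schwarz_ineq_sum)
    finally show ?thesis .
  qed
  have "real N * (\<Sum>t<card I. (cmod (v t))^2) = (\<Sum>j<N. (cmod (poly f (node N b j)))^2)"
    using parseval[OF N cN, of v b] by (simp add: pf)
  also have "\<dots> = (\<Sum>j\<in>{..<N}-I. (cmod (poly f (node N b j)))^2) + ?S"
    using sum.subset_diff[OF I, of "\<lambda>j. (cmod (poly f (node N b j)))^2"] by simp
  also have "\<dots> \<le> (\<Sum>j\<in>{..<N}-I. ?S * (\<Sum>s\<in>I. (cmod (lagr_value N b I s j))^2)) + ?S"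
    by (intro add_right_mono sum_mono pt)
  also have "\<dots> = (1 + lagr_energy N b I) * ?S"
    unfolding lagr_energy_def by (simp add: sum_distrib_left[symmetric] algebra_simps)
  finally show ?thesis by (simp add: pf)
qed auto

lemma lagr_energy_le:
  assumes I: "I \<subseteq> {..<N}"
  shows "lagr_energy N b I \<le> (2 * exp (main_term N + 2))^2"
proof (cases "N = 0")
  case False
  let ?M = "2 / real N * exp (main_term N + 2)"
  have fin: "finite I" using I finite_subset by blast
  have "lagr_energy N b I \<le> (\<Sum>j\<in>{..<N}-I. \<Sum>s\<in>I. ?M\<^sup>2)"
    unfolding lagr_energy_def
  proof (intro sum_mono power_mono)
    fix j s assume *: "j \<in> {..<N} - I" "s \<in> I"
    have "cmod (lagr_value N b I s j) \<le> 2 / real N * exp (main_term N + 0 + 0 + 2)"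
    proof (rule cmod_lagr_upper)
      have "gap N j ` (I-{s}) \<subseteq> {1..<N}" by (rule prod_chord_exp1(2)) (use * I in auto)
      from excess_sum_le_cap[OF this, of "{}"]
      show "excess_sum N (gap N j ` (I-{s})) \<le> excess_cap N + 0" by simp
      have "(\<lambda>t. gap N t s) ` ({..<N}-I-{j}) \<subseteq> {1..<N}" by (rule prod_chord_exp2(2)) (use * I in auto)
      from excess_sum_le_cap[OF this, of "{}"]
      show "excess_sum N ((\<lambda>t. gap N t s) ` ({..<N}-I-{j})) \<le> excess_cap N + 0" by simp
    qed (use * I in auto)
    thus "cmod (lagr_value N b I s j) \<le> ?M" by simp
  qed simp
  also have "\<dots> = real (card ({..<N}-I)) * real (card I) * ?M\<^sup>2" by simp
  also have "\<dots> \<le> real N * real N * ?M\<^sup>2"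
    using card_mono[OF _ I] card_mono[of "{..<N}" "{..<N}-I"] by (intro mult_right_mono mult_mono) auto
  also have "\<dots> = (2 * exp (main_term N + 2))^2"
    using False by (simp add: power2_eq_square field_simps)
  finally show ?thesis .
qed (use I in \<open>simp add: lagr_energy_def\<close>)

lemma exp_neg_double_le: "0 \<le> x \<Longrightarrow> (exp (- x))^2 \<le> 1 / (1 + 2 * (x :: real))"
proof -
  assume "0 \<le> x"
  hence "1 + 2 * x \<le> exp (2 * x)" using exp_ge_add_one_self by simp
  hence "1 / exp (2 * x) \<le> 1 / (1 + 2 * x)" using \<open>0 \<le> x\<close> by (intro divide_left_mono) auto
  moreover have "(exp (- x))^2 = 1 / exp (2 * x)" by (simp add: exp_minus power_inverse divide_inverse exp_double)
  ultimately show ?thesis by simp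
qed

text \<open>The bound \<open>exp (- y) \<le> 1 / (1 + y)\<close> reduces the Gaussian sum to a Lorentzian one of width \<open>9 sqrt N\<close>,
where \<open>162 = 2 * 9\<^sup>2\<close>. Since \<open>\<pi> < 4\<close> and \<open>1 \<le> sqrt N\<close>, the value \<open>74\<close> bounds \<open>2 \<pi> * 9 + 2\<close>.\<close>

lemma sum_gaussian_le:
  assumes "N > 0"
  shows "(\<Sum>u<N. (exp (- ((real u - real N / 4)^2 / (162 * real N))))^2) \<le> 74 * sqrt (real N)"
proof -
  let ?M = "9 * sqrt (real N)"
  have "(\<Sum>u<N. (exp (- ((real u - real N / 4)^2 / (162 * real N))))^2) \<le> (\<Sum>u<N. 1 / (1 + ((real u - real N / 4) / ?M)^2))"
  proof (rule sum_mono)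
    fix u
    have "2 * ((real u - real N / 4)^2 / (162 * real N)) = ((real u - real N / 4) / ?M)^2"
      by (simp add: power_divide power_mult_distrib)
    thus "(exp (- ((real u - real N / 4)^2 / (162 * real N))))^2 \<le> 1 / (1 + ((real u - real N / 4) / ?M)^2)"
      using exp_neg_double_le[of "(real u - real N / 4)^2 / (162 * real N)"] by simp
  qed
  also have "\<dots> \<le> 2 * pi * ?M + 2" using assms by (intro sum_lorentzian_le) auto
  also have "\<dots> \<le> 2 * 4 * ?M + 2 * sqrt (real N)"
  proof (intro add_mono mult_right_mono mult_left_mono)
    show "2 \<le> 2 * sqrt (real N)" using assms by simp
  qed (use pi_less_4 in auto)
  finally show ?thesis by simp
qed

text \<open>For an interval \<open>I\<close>, the gaps in the two products of \<open>cmod_lagr\<close> form intervals that start after \<open>u = j - n\<close>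
and \<open>v = n - 1 - s\<close>, apart from the missing gap between \<open>s\<close> and \<open>j\<close>. The deficits turn into Gaussian factors in \<open>u\<close> and \<open>v\<close>, and the
sum over each variable is \<open>O(sqrt N)\<close> instead of \<open>O(N)\<close>. The factor \<open>148\<close> is \<open>2 * 74\<close>, and \<open>6\<close> collects the additive
constants of the two deficits and of the caps.\<close>

lemma lagr_energy_interval_le:
  assumes "n \<le> N" "N > 0"
  shows "lagr_energy N b {..<n} \<le> (148 * exp (main_term N + 6))^2 / real N"
proof -
  define D where "D u = (real u - real N / 4)^2 / (162 * real N)" for u :: nat
  define M where "M = 2 / real N * exp (main_term N + 6)"
  have D0: "0 \<le> D u" for u by (simp add: D_def)
  have bound: "(cmod (lagr_value N b {..<n} s j))^2 \<le> M\<^sup>2 * (exp (- D (j - n)))^2 * (exp (- D (n - 1 - s)))^2"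
    if sj: "j \<in> {..<N} - {..<n}" "s \<in> {..<n}" for s j
  proof -
    define u where "u = j - n"
    define v where "v = n - 1 - s"
    have j: "j = u + n" "j < N" using sj by (auto simp: u_def)
    have s: "s < n" "n = v + s + 1" using sj by (auto simp: v_def)
    have X: "gap N j ` ({..<n}-{s}) = {u<..u + n} - {j - s}"
    proof -
      have "gap N j ` ({..<n}-{s}) = (\<lambda>t. j - t) ` ({..<n}-{s})"
        using j by (intro image_cong refl) (auto simp: gap_def)
      also have "\<dots> = {u<..u + n} - {j - s}"
      proof (intro equalityI subsetI)
        fix k assume k: "k \<in> {u<..u + n} - {j - s}"
        hence "k = j - (j - k)" "j - k \<in> {..<n} - {s}" using j s by auto
        thus "k \<in> (\<lambda>t. j - t) ` ({..<n}-{s})" by blast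
      qed (use j s in auto)
      finally show ?thesis .
    qed
    have Y: "(\<lambda>t. gap N t s) ` ({..<N}-{..<n}-{j}) = {v<..v + (N - n)} - {j - s}"
    proof -
      have "(\<lambda>t. gap N t s) ` ({..<N}-{..<n}-{j}) = (\<lambda>t. t - s) ` ({..<N}-{..<n}-{j})"
        using s by (intro image_cong refl) (auto simp: gap_def)
      also have "\<dots> = {v<..v + (N - n)} - {j - s}"
      proof (intro equalityI subsetI)
        fix k assume k: "k \<in> {v<..v + (N - n)} - {j - s}"
        hence "k = (k + s) - s" "k + s \<in> {..<N}-{..<n}-{j}" using j s assms by auto
        thus "k \<in> (\<lambda>t. t - s) ` ({..<N}-{..<n}-{j})" by blast
      qed (use j s assms in auto)
      finally show ?thesis .
    qed
    have "cmod (lagr_value N b {..<n} s j) \<le> 2 / real N * exp (main_term N + (- D u + 2) + (- D v + 2) + 2)"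
    proof (rule cmod_lagr_upper)
      show "excess_sum N (gap N j ` ({..<n}-{s})) \<le> excess_cap N + (- D u + 2)"
        using deficit_interval[of "{u<..u + n} - {j - s}" u n "j - s" N] j unfolding X D_def by auto
      show "excess_sum N ((\<lambda>t. gap N t s) ` ({..<N}-{..<n}-{j})) \<le> excess_cap N + (- D v + 2)"
        using deficit_interval[of "{v<..v + (N - n)} - {j - s}" v "N - n" "j - s" N] s assms unfolding Y D_def by auto
    qed (use sj assms in auto)
    also have "\<dots> = M * exp (- D u) * exp (- D v)"
      unfolding M_def by (simp add: exp_add[symmetric] algebra_simps)
    finally have "(cmod (lagr_value N b {..<n} s j))^2 \<le> (M * exp (- D u) * exp (- D v))^2"
      by (intro power_mono) auto
    thus ?thesis by (simp add: power_mult_distrib u_def v_def)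
  qed
  have sumD: "(\<Sum>u<m. (exp (- D u))^2) \<le> 74 * sqrt (real N)" if "m \<le> N" for m
  proof -
    have "(\<Sum>u<m. (exp (- D u))^2) \<le> (\<Sum>u<N. (exp (- D u))^2)" using that by (intro sum_mono2) auto
    thus ?thesis using sum_gaussian_le[OF assms(2)] unfolding D_def by linarith
  qed
  have "lagr_energy N b {..<n} \<le> (\<Sum>j\<in>{..<N}-{..<n}. \<Sum>s\<in>{..<n}. M\<^sup>2 * (exp (- D (j - n)))^2 * (exp (- D (n - 1 - s)))^2)"
    unfolding lagr_energy_def by (intro sum_mono bound)
  also have "\<dots> = M\<^sup>2 * (\<Sum>j\<in>{..<N}-{..<n}. (exp (- D (j - n)))^2) * (\<Sum>s<n. (exp (- D (n - 1 - s)))^2)"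
    by (simp add: sum_distrib_left sum_distrib_right mult_ac)
  also have "(\<Sum>j\<in>{..<N}-{..<n}. (exp (- D (j - n)))^2) = (\<Sum>u<N - n. (exp (- D u))^2)"
    by (rule sum.reindex_bij_witness[of _ "\<lambda>u. u + n" "\<lambda>j. j - n"]) auto
  also have "(\<Sum>s<n. (exp (- D (n - 1 - s)))^2) = (\<Sum>v<n. (exp (- D v))^2)"
    by (rule sum.reindex_bij_witness[of _ "\<lambda>v. n - 1 - v" "\<lambda>s. n - 1 - s"]) auto
  also have "M\<^sup>2 * (\<Sum>u<N - n. (exp (- D u))^2) * (\<Sum>v<n. (exp (- D v))^2) \<le> M\<^sup>2 * (74 * sqrt (real N)) * (74 * sqrt (real N))"
    using assms by (intro mult_mono sumD) (auto intro!: sum_nonneg mult_nonneg_nonneg)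
  also have "\<dots> = (148 * exp (main_term N + 6))^2 / real N"
  proof -
    have "M\<^sup>2 * (74 * sqrt (real N)) * (74 * sqrt (real N)) = M\<^sup>2 * (74 * 74) * (sqrt (real N) * sqrt (real N))"
      by (simp only: mult_ac)
    also have "\<dots> = M\<^sup>2 * (74 * 74) * real N" by simp
    also have "\<dots> = (148 * exp (main_term N + 6))^2 / real N"
      unfolding M_def using assms(2) by (simp add: power2_eq_square field_simps)
    finally show ?thesis .
  qed
  finally show ?thesis .
qed

section \<open>A nearly extremal polynomial on half of the circle\<close>

text \<open>By \<open>node_diff\<close> the difference of two nodes is \<open>\<i>\<close> times a real number times the half-angle phases \<open>\<alpha>\<close> of both
nodes, and the real number is positive if the first node follows the second. In the basis polynomial the phases thus split into a factor that depends on
\<open>j\<close> and one that depends on \<open>s\<close>.\<close>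

lemma lagr_interval_phases:
  fixes N b n :: nat
  obtains y \<beta> :: "nat \<Rightarrow> complex" where
    "\<And>s. s < n \<Longrightarrow> n \<le> N \<Longrightarrow> cmod (y s) = 1" "\<And>j. cmod (\<beta> j) = 1"
    "\<And>s j. s < n \<Longrightarrow> n \<le> j \<Longrightarrow> j < N \<Longrightarrow>
      y s * lagr_value N b {..<n} s j = \<beta> j * of_real (cmod (lagr_value N b {..<n} s j))"
proof -
  define \<alpha> where "\<alpha> k = cis (pi * real (b + k) / real N)" for k
  define c where "c s = (\<Prod>t\<in>{..<n}-{s}. node N b s - node N b t)" for s
  define g where "g s = 1 / (\<alpha> s * c s)" for s
  define y where "y s = of_real (cmod (g s)) / g s" for s
  define \<beta> where "\<beta> j = (\<i> * \<alpha> j) ^ (n - 1) * (\<Prod>t<n. \<alpha> t)" for j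
  have a0: "\<alpha> k \<noteq> 0" for k by (simp add: \<alpha>_def)
  have ca: "cmod (\<alpha> k) = 1" for k by (simp add: \<alpha>_def)
  have c0: "c s \<noteq> 0" if "s < n" "n \<le> N" for s
    unfolding c_def using that inj_on_node[of N b] by (auto simp: inj_on_def)
  have g0: "g s \<noteq> 0" if "s < n" "n \<le> N" for s using c0[OF that] a0 by (simp add: g_def)
  show ?thesis
  proof (rule that[of y \<beta>])
    show "cmod (y s) = 1" if "s < n" "n \<le> N" for s
      using g0[OF that] by (simp add: y_def norm_divide)
    show b1: "cmod (\<beta> j) = 1" for j
      by (simp add: \<beta>_def norm_mult norm_power ca flip: prod_norm)
    fix s j assume *: "s < n" "n \<le> j" "j < N"
    have nN: "n \<le> N" using * by simp
    define r where "r = (\<Prod>t\<in>{..<n}-{s}. 2 * sin (pi * (real j - real t) / real N))"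
    have r: "0 \<le> r" unfolding r_def
    proof (rule prod_nonneg)
      fix t assume "t \<in> {..<n}-{s}"
      hence "0 < sin (pi * (real j - real t) / real N)" using * by (intro sin_chord_pos) auto
      thus "0 \<le> 2 * sin (pi * (real j - real t) / real N)" by simp
    qed
    have "(\<Prod>t\<in>{..<n}-{s}. node N b j - node N b t)
        = (\<Prod>t\<in>{..<n}-{s}. (\<i> * \<alpha> j) * of_real (2 * sin (pi * (real j - real t) / real N)) * \<alpha> t)"
      unfolding node_diff \<alpha>_def by (intro prod.cong refl) (simp only: mult_ac)
    also have "\<dots> = (\<i> * \<alpha> j) ^ (n - 1) * of_real r * (\<Prod>t\<in>{..<n}-{s}. \<alpha> t)"
    proof -
      have "card ({..<n} - {s}) = n - 1" using * by simp
      moreover have "(\<Prod>t\<in>A. c * f t * h t) = c ^ card A * (\<Prod>t\<in>A. f t) * (\<Prod>t\<in>A. h t)" for A c and f h :: "nat \<Rightarrow> complex"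
        by (simp add: prod.distrib)
      ultimately show ?thesis by (simp only: r_def of_real_prod)
    qed
    also have "(\<Prod>t\<in>{..<n}-{s}. \<alpha> t) = (\<Prod>t<n. \<alpha> t) / \<alpha> s"
      using * a0 by (subst prod.remove[of "{..<n}" s]) auto
    finally have prd: "(\<Prod>t\<in>{..<n}-{s}. node N b j - node N b t) = (\<i> * \<alpha> j) ^ (n - 1) * of_real r * ((\<Prod>t<n. \<alpha> t) / \<alpha> s)" .
    have p: "lagr_value N b {..<n} s j = \<beta> j * g s * of_real r"
      unfolding poly_lagr prd c_def[symmetric] \<beta>_def g_def by simp
    have "cmod (lagr_value N b {..<n} s j) = cmod (g s) * r"
      unfolding p using r by (simp add: norm_mult b1)
    moreover have "y s * (\<beta> j * g s * of_real r) = \<beta> j * of_real (cmod (g s) * r)"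
      using g0[OF *(1) nN] by (simp add: y_def)
    ultimately show "y s * lagr_value N b {..<n} s j = \<beta> j * of_real (cmod (lagr_value N b {..<n} s j))"
      unfolding p by simp
  qed
qed

text \<open>The two products of chords are completed by the chord between \<open>s\<close> and \<open>j\<close>, so that their gaps form full intervals;
that chord then appears in the denominator and is at most \<open>2\<close>.\<close>

lemma cmod_lagr_central_lower:
  assumes "N \<ge> 400" "\<bar>real n - real N / 2\<bar> \<le> 1" and s: "s < n" and j: "n \<le> j" "j < N"
    and near_j: "\<bar>real (j - n) - real N / 4\<bar> \<le> sqrt (real N) + 1"
    and near_s: "\<bar>real (n - 1 - s) - real N / 4\<bar> \<le> sqrt (real N) + 1"
  shows "exp (main_term N - 400) / (2 * real N) \<le> cmod (lagr_value N b {..<n} s j)"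
proof -
  define u where "u = j - n"
  define v where "v = n - 1 - s"
  have ju: "j = u + n" "u + n < N" using j by (auto simp: u_def)
  have sv: "n = v + s + 1" "v + (N - n) < N" using s j by (auto simp: v_def)
  let ?P = "\<Prod>t\<in>{..<n}. chord N b j t" and ?Q = "\<Prod>t\<in>{..<N}-{..<n}. chord N b s t" and ?d = "chord N b s j"
  have X: "gap N j ` {..<n} = {u<..u + n}"
  proof (intro equalityI subsetI)
    fix k assume k: "k \<in> {u<..u + n}"
    hence "k = gap N j (j - k)" "j - k \<in> {..<n}" using ju by (auto simp: gap_def)
    thus "k \<in> gap N j ` {..<n}" by blast
  qed (use ju in \<open>auto simp: gap_def\<close>)
  have Y: "(\<lambda>t. gap N t s) ` ({..<N}-{..<n}) = {v<..v + (N - n)}"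
  proof (intro equalityI subsetI)
    fix k assume k: "k \<in> {v<..v + (N - n)}"
    hence "k = gap N (k + s) s" "k + s \<in> {..<N}-{..<n}" using sv ju by (auto simp: gap_def)
    thus "k \<in> (\<lambda>t. gap N t s) ` ({..<N}-{..<n})" by blast
  qed (use sv ju in \<open>auto simp: gap_def\<close>)
  let ?x = "\<Sum>k\<in>{u<..u + n}. excess N (real k)" and ?y = "\<Sum>k\<in>{v<..v + (N - n)}. excess N (real k)"
  have P: "?P = exp (?x + real n * (ln 2 / 2))"
    using prod_chord_exp1(1)[of "{..<n}" N j b] j unfolding X by simp
  have Q: "?Q = exp (?y + real (N - n) * (ln 2 / 2))"
  proof -
    have cd: "card ({..<N}-{..<n}) = N - n" by (subst card_Diff_subset) (use j in auto)
    have "{..<N}-{..<n} \<subseteq> {..<N}" "s < N" "s \<notin> {..<N}-{..<n}" using s j by auto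
    from prod_chord_exp2(1)[OF this, of b] show ?thesis unfolding Y cd .
  qed
  have "exp (main_term N - 400) \<le> ?P * ?Q"
  proof -
    define D where "D = excess_int N (3 * real N / 4) - excess_int N (real N / 4)"
    have nN: "real (N - n) = real N - real n" using j by (simp add: of_nat_diff)
    have x: "D - 200 \<le> ?x"
      unfolding D_def by (rule central_run_lower[OF ju(2) assms(1,2) near_j[folded u_def]])
    have y: "D - 200 \<le> ?y"
      unfolding D_def
    proof (rule central_run_lower[OF sv(2) assms(1) _ near_s[folded v_def]])
      show "\<bar>real (N - n) - real N / 2\<bar> \<le> 1" unfolding nN using assms(2) by (simp add: abs_le_iff)
    qed
    have "2 * D + ln 2 / 2 * real N = main_term N"
      unfolding D_def by (rule excess_int_total) (use assms in simp)
    moreover have "real n * (ln 2 / 2) + real (N - n) * (ln 2 / 2) = ln 2 / 2 * real N"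
      unfolding nN by (simp add: field_simps)
    ultimately show ?thesis using x y unfolding P Q exp_add[symmetric] exp_le_cancel_iff by linarith
  qed
  moreover have "cmod (lagr_value N b {..<n} s j) = ?P * ?Q / (?d * real N)"
  proof -
    have d: "0 < ?d" using s j by (intro chord_pos) auto
    have "?P = ?d * (\<Prod>t\<in>{..<n}-{s}. chord N b j t)"
      using s chord_commute[of N b j s] by (subst prod.remove[of _ s]) auto
    moreover have "?Q = ?d * (\<Prod>t\<in>{..<N}-{..<n}-{j}. chord N b s t)"
      using j by (subst prod.remove[of _ j]) auto
    ultimately show ?thesis
      using d cmod_lagr[of "{..<n}" N s j b] s j by (simp add: field_simps)
  qed
  moreover have "?P * ?Q / (2 * real N) \<le> ?P * ?Q / (?d * real N)"
  proof -
    have "0 \<le> ?P * ?Q" unfolding P Q by simp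
    thus ?thesis using s j chord_le_2[of N b s j] chord_pos[of j N s b]
      by (intro divide_left_mono mult_right_mono mult_pos_pos) simp_all
  qed
  moreover have "exp (main_term N - 400) / (2 * real N) \<le> ?P * ?Q / (2 * real N)"
    by (intro divide_right_mono calculation(1)) simp
  ultimately show ?thesis by linarith
qed

text \<open>About \<open>sqrt N\<close> central basis polynomials are added with aligned phases. On the interval the squared values sum to the
number \<open>r + 1\<close> of polynomials, while at each of \<open>r + 1\<close> opposite nodes the value is at least
\<open>(r + 1) M\<close>, where \<open>M\<close> is the lower bound for one basis polynomial.\<close>

lemma central_test_vector:
  assumes "N \<ge> 400" "\<bar>real n - real N / 2\<bar> \<le> 1"
  obtains v :: "nat \<Rightarrow> complex" where
    "0 < (\<Sum>t<n. (cmod (v t))^2)"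
    "(\<Sum>i<n. (cmod (\<Sum>t<n. v t * node N b i ^ t))^2)
       \<le> (2 * real N / exp (main_term N - 400))^2 * (\<Sum>t<n. (cmod (v t))^2)"
proof -
  define k0 where "k0 = N div 4"
  define r where "r = nat \<lfloor>sqrt (real N)\<rfloor>"
  define M where "M = exp (main_term N - 400) / (2 * real N)"
  have M: "M > 0" using assms by (simp add: M_def)
  have "sqrt 400 \<le> sqrt (real N)" using assms(1) by (subst real_sqrt_le_iff) simp
  hence s20: "20 \<le> sqrt (real N)" by simp
  have "20 * sqrt (real N) \<le> sqrt (real N) * sqrt (real N)" using s20 by (intro mult_right_mono) auto
  hence s20': "20 * sqrt (real N) \<le> real N" by simp
  have r: "real r \<le> sqrt (real N)" "sqrt (real N) \<le> real (r + 1)"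
    unfolding r_def using s20 by linarith+
  have k0: "real k0 \<le> real N / 4" "real N / 4 - 1 \<le> real k0" unfolding k0_def by linarith+
  have nN: "n \<le> N" "k0 + r + 1 \<le> n" "k0 + r + n < N"
  proof -
    have "real n \<le> real N / 2 + 1" "real N / 2 - 1 \<le> real n" using assms(2) by (auto simp: abs_le_iff)
    moreover have "real N \<ge> 400" using assms by simp
    ultimately have "real n \<le> real N" "real (k0 + r + 1) \<le> real n" "real (k0 + r + n) < real N"
      using r(1) k0(1) s20' unfolding of_nat_add of_nat_1 by linarith+
    thus "n \<le> N" "k0 + r + 1 \<le> n" "k0 + r + n < N" by (simp_all only: of_nat_le_iff of_nat_less_iff)
  qed
  have near: "\<bar>real (k0 + i) - real N / 4\<bar> \<le> sqrt (real N) + 1" if "i \<le> r" for i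
  proof -
    have "real i \<le> real r" "0 \<le> real i" using that by simp_all
    hence "real k0 + real i \<le> real N / 4 + (sqrt (real N) + 1)" "real N / 4 \<le> real k0 + real i + (sqrt (real N) + 1)"
      using k0 r(1) s20 by linarith+
    thus ?thesis unfolding of_nat_add abs_le_iff by auto
  qed
  obtain y \<beta> where y: "\<And>s. s < n \<Longrightarrow> n \<le> N \<Longrightarrow> cmod (y s) = 1" and \<beta>: "\<And>j. cmod (\<beta> j) = 1"
    and ph: "\<And>s j. s < n \<Longrightarrow> n \<le> j \<Longrightarrow> j < N \<Longrightarrow>
      y s * lagr_value N b {..<n} s j = \<beta> j * of_real (cmod (lagr_value N b {..<n} s j))"
    by (rule lagr_interval_phases[of n N b]) blast
  define W where "W = (\<lambda>i. n - 1 - (k0 + i)) ` {..r}"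
  define J where "J = (\<lambda>i. n + (k0 + i)) ` {..r}"
  have W: "W \<subseteq> {..<n}" "finite W" using nN by (auto simp: W_def)
  have cW: "card W = r + 1" unfolding W_def using nN by (subst card_image) (auto simp: inj_on_def)
  have J: "J \<subseteq> {..<N}" "finite J" using nN by (auto simp: J_def)
  have cJ: "card J = r + 1" unfolding J_def by (subst card_image) (auto simp: inj_on_def)
  define f where "f = (\<Sum>s\<in>W. smult (y s) (lagr N b {..<n} s))"
  have "degree f < n"
  proof -
    have "{..<n} \<noteq> {}" using nN by (auto simp: lessThan_empty_iff)
    thus ?thesis unfolding f_def using degree_lagr_sum[of "{..<n}" W y N b] W by simp
  qed
  note pf = poly_coeff_sum[OF this]
  have small: "(\<Sum>i<n. (cmod (poly f (node N b i)))^2) = real (r + 1)"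
  proof -
    have "(cmod (poly f (node N b i)))^2 = (if i \<in> W then 1 else 0)" if i: "i < n" for i
    proof -
      have "poly f (node N b i) = (if i \<in> W then y i else 0)"
        unfolding f_def using i nN by (intro poly_lagr_sum_node W) auto
      thus ?thesis using y[OF i nN(1)] by simp
    qed
    hence "(\<Sum>i<n. (cmod (poly f (node N b i)))^2) = (\<Sum>i<n. if i \<in> W then 1 else 0)" by simp
    also have "\<dots> = real (card W)" using W by (simp add: sum.inter_restrict[symmetric] Int_absorb1)
    finally show ?thesis by (simp add: cW)
  qed
  have large: "real (r + 1) * M \<le> cmod (poly f (node N b j))" if j: "j \<in> J" for j
  proof -
    obtain i where i: "j = n + (k0 + i)" "i \<le> r" using j by (auto simp: J_def)
    have jN: "n \<le> j" "j < N" using i nN by auto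
    have "poly f (node N b j) = (\<Sum>s\<in>W. y s * lagr_value N b {..<n} s j)"
      by (simp add: f_def poly_sum)
    also have "\<dots> = (\<Sum>s\<in>W. \<beta> j * of_real (cmod (lagr_value N b {..<n} s j)))"
      using W jN by (intro sum.cong refl ph) auto
    also have "\<dots> = \<beta> j * of_real (\<Sum>s\<in>W. cmod (lagr_value N b {..<n} s j))"
      by (simp add: sum_distrib_left)
    finally have "cmod (poly f (node N b j)) = (\<Sum>s\<in>W. cmod (lagr_value N b {..<n} s j))"
      by (simp add: norm_mult \<beta> sum_nonneg del: of_real_sum)
    moreover have "(\<Sum>s\<in>W. M) \<le> (\<Sum>s\<in>W. cmod (lagr_value N b {..<n} s j))"
    proof (rule sum_mono)
      fix s assume "s \<in> W"
      then obtain i' where i': "s = n - 1 - (k0 + i')" "i' \<le> r" by (auto simp: W_def)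
      have e: "j - n = k0 + i" "n - 1 - s = k0 + i'" using i i' nN by auto
      show "M \<le> cmod (lagr_value N b {..<n} s j)"
        unfolding M_def
      proof (rule cmod_lagr_central_lower[OF assms _ jN])
        show "\<bar>real (j - n) - real N / 4\<bar> \<le> sqrt (real N) + 1" unfolding e by (rule near[OF i(2)])
        show "\<bar>real (n - 1 - s) - real N / 4\<bar> \<le> sqrt (real N) + 1" unfolding e by (rule near[OF i'(2)])
      qed (use i' nN in auto)
    qed
    ultimately show ?thesis by (simp add: cW)
  qed
  have "real (r + 1) * (real (r + 1) * M)^2 \<le> (\<Sum>j\<in>J. (cmod (poly f (node N b j)))^2)"
  proof -
    have "(\<Sum>j\<in>J. (real (r + 1) * M)^2) \<le> (\<Sum>j\<in>J. (cmod (poly f (node N b j)))^2)"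
      using M by (intro sum_mono power_mono large) auto
    thus ?thesis by (simp add: cJ)
  qed
  also have "\<dots> \<le> (\<Sum>j<N. (cmod (poly f (node N b j)))^2)" using J by (intro sum_mono2) auto
  also have "\<dots> = real N * (\<Sum>t<n. (cmod (coeff f t))^2)"
    using parseval[of N n "coeff f" b] assms nN by (simp add: pf)
  finally have big: "real (r + 1) * (real (r + 1) * M)^2 \<le> real N * (\<Sum>t<n. (cmod (coeff f t))^2)" .
  have N0: "real N > 0" using assms by simp
  show ?thesis
  proof (rule that[of "coeff f"])
    have "0 < real (r + 1) * (real (r + 1) * M)^2" using M by simp
    hence "0 < real N * (\<Sum>t<n. (cmod (coeff f t))^2)" using big by linarith
    thus "0 < (\<Sum>t<n. (cmod (coeff f t))^2)" using N0 by (simp add: zero_less_mult_iff)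
    have "real N \<le> (real (r + 1))^2"
    proof -
      have "(sqrt (real N))^2 \<le> (real (r + 1))^2" by (rule power_mono[OF r(2)]) simp
      thus ?thesis by simp
    qed
    hence "real N * (real (r + 1) * M\<^sup>2) \<le> (real (r + 1))^2 * (real (r + 1) * M\<^sup>2)"
      by (rule mult_right_mono) simp
    also have "\<dots> = real (r + 1) * (real (r + 1) * M)^2" by (simp add: power_mult_distrib)
    finally have "real N * (real (r + 1) * M\<^sup>2) \<le> real N * (\<Sum>t<n. (cmod (coeff f t))^2)" using big by linarith
    hence "real (r + 1) * M\<^sup>2 \<le> (\<Sum>t<n. (cmod (coeff f t))^2)" using N0 by simp
    hence "real (r + 1) \<le> (1 / M)^2 * (\<Sum>t<n. (cmod (coeff f t))^2)"
      using M by (simp add: power_divide field_simps)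
    moreover have "1 / M = 2 * real N / exp (main_term N - 400)" by (simp add: M_def)
    ultimately show "(\<Sum>i<n. (cmod (\<Sum>t<n. coeff f t * node N b i ^ t))^2)
       \<le> (2 * real N / exp (main_term N - 400))^2 * (\<Sum>t<n. (cmod (coeff f t))^2)"
      using small by (simp only: pf)
  qed
qed

section \<open>Singular values and Hermitian forms\<close>

definition nrm2 :: "complex vec \<Rightarrow> real" where
  "nrm2 v = (\<Sum>i<dim_vec v. (cmod (v $ i))^2)"

definition cip :: "complex vec \<Rightarrow> complex vec \<Rightarrow> complex" where
  "cip x y = (\<Sum>i<dim_vec y. cnj (x $ i) * y $ i)"

lemma nrm2_nonneg: "0 \<le> nrm2 v"
  unfolding nrm2_def by (intro sum_nonneg) auto

lemma nrm2_pos: "v \<in> carrier_vec n \<Longrightarrow> v \<noteq> 0\<^sub>v n \<Longrightarrow> 0 < nrm2 v"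
proof -
  assume v: "v \<in> carrier_vec n" "v \<noteq> 0\<^sub>v n"
  then obtain i where i: "i < n" "v $ i \<noteq> 0" by (metis carrier_vecD eq_vecI index_zero_vec(1) index_zero_vec(2))
  have "0 < (cmod (v $ i))^2" using i by simp
  also have "\<dots> \<le> nrm2 v" unfolding nrm2_def using v i by (intro member_le_sum) auto
  finally show ?thesis .
qed

lemma cip_self: "cip v v = of_real (nrm2 v)"
  unfolding cip_def nrm2_def of_real_sum
  by (intro sum.cong refl) (simp only: complex_norm_square mult.commute)

lemma cip_cauchy_schwarz:
  assumes "x \<in> carrier_vec n" "y \<in> carrier_vec n"
  shows "(cmod (cip x y))^2 \<le> nrm2 x * nrm2 y"
proof -
  have "cmod (cip x y) \<le> (\<Sum>i<n. cmod (x $ i) * cmod (y $ i))"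
    unfolding cip_def using assms by (auto intro!: sum_norm_le simp: norm_mult)
  hence "(cmod (cip x y))^2 \<le> (\<Sum>i<n. cmod (x $ i) * cmod (y $ i))^2" by (intro power_mono) auto
  also have "\<dots> \<le> (\<Sum>i<n. (cmod (x $ i))^2) * (\<Sum>i<n. (cmod (y $ i))^2)"
    by (rule Cauchy_Schwarz_ineq_sum)
  also have "\<dots> = nrm2 x * nrm2 y" using assms by (simp add: nrm2_def)
  finally show ?thesis .
qed

lemma cip_smult: "x \<in> carrier_vec n \<Longrightarrow> y \<in> carrier_vec n \<Longrightarrow> cip x (c \<cdot>\<^sub>v y) = c * cip x y"
  unfolding cip_def by (simp add: sum_distrib_left mult_ac)

lemma mat_adjoint_carrier: "A \<in> carrier_mat p q \<Longrightarrow> mat_adjoint A \<in> carrier_mat q p"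
  unfolding mat_adjoint_def by (auto simp: mat_of_rows_def)

lemma mat_adjoint_index:
  "A \<in> carrier_mat p q \<Longrightarrow> i < q \<Longrightarrow> j < p \<Longrightarrow> mat_adjoint A $$ (i, j) = cnj (A $$ (j, i))"
  unfolding mat_adjoint_def by (auto simp: mat_of_rows_def)

lemma mat_adjoint_adjoint: "A \<in> carrier_mat p q \<Longrightarrow> mat_adjoint (mat_adjoint A) = (A :: complex mat)"
  using mat_adjoint_carrier[of A p q] mat_adjoint_carrier[of "mat_adjoint A" q p]
  by (intro eq_matI) (auto simp: mat_adjoint_index[of _ p q] mat_adjoint_index[of _ q p])

lemma cip_adjoint:
  assumes "A \<in> carrier_mat p q" "v \<in> carrier_vec q" "w \<in> carrier_vec p"
  shows "cip v (mat_adjoint A *\<^sub>v w) = cip (A *\<^sub>v v) w"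
proof -
  have "cip v (mat_adjoint A *\<^sub>v w) = (\<Sum>i<q. \<Sum>l<p. cnj (v $ i) * (cnj (A $$ (l, i)) * w $ l))"
    using assms mat_adjoint_carrier[OF assms(1)]
    by (auto simp: cip_def scalar_prod_def sum_distrib_left mat_adjoint_index lessThan_atLeast0 intro!: sum.cong)
  also have "\<dots> = (\<Sum>l<p. \<Sum>i<q. cnj (v $ i) * (cnj (A $$ (l, i)) * w $ l))" by (rule sum.swap)
  also have "\<dots> = cip (A *\<^sub>v v) w"
    using assms
    by (auto simp: cip_def scalar_prod_def sum_distrib_left sum_distrib_right lessThan_atLeast0 mult_ac intro!: sum.cong)
  finally show ?thesis .
qed

lemma cip_gram:
  assumes "A \<in> carrier_mat p q" "v \<in> carrier_vec q" "w \<in> carrier_vec q"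
  shows "cip v ((mat_adjoint A * A) *\<^sub>v w) = cip (A *\<^sub>v v) (A *\<^sub>v w)"
  using cip_adjoint[OF assms(1,2), of "A *\<^sub>v w"] assms mat_adjoint_carrier[OF assms(1)] by auto

lemma gram_carrier: "A \<in> carrier_mat p q \<Longrightarrow> mat_adjoint A * A \<in> carrier_mat q q"
  using mat_adjoint_carrier[of A p q] by auto

lemma gram_eigenvalue:
  assumes A: "A \<in> carrier_mat p q" and z: "poly (char_poly (mat_adjoint A * A)) z = 0"
  obtains v where "v \<in> carrier_vec q" "0 < nrm2 v" "Re z * nrm2 v = nrm2 (A *\<^sub>v v)" "z = of_real (Re z)" "0 \<le> Re z"
proof -
  from z have "eigenvalue (mat_adjoint A * A) z" using eigenvalue_root_char_poly[OF gram_carrier[OF A]] by simp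
  then obtain v where v: "v \<in> carrier_vec q" "v \<noteq> 0\<^sub>v q" "(mat_adjoint A * A) *\<^sub>v v = z \<cdot>\<^sub>v v"
    unfolding eigenvalue_def eigenvector_def using gram_carrier[OF A] by auto
  have pos: "0 < nrm2 v" using nrm2_pos v by blast
  have "z * of_real (nrm2 v) = of_real (nrm2 (A *\<^sub>v v))"
    using cip_gram[OF A v(1) v(1)] v by (simp add: cip_smult[OF v(1) v(1)] cip_self)
  hence "z = of_real (nrm2 (A *\<^sub>v v)) / of_real (nrm2 v)" using pos by (simp add: field_simps)
  hence z: "z = of_real (nrm2 (A *\<^sub>v v) / nrm2 v)" by simp
  show ?thesis
    by (rule that[OF v(1) pos]) (use z pos nrm2_nonneg in auto)
qed

lemma singular_values_set:
  assumes "A \<in> carrier_mat p q"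
  shows "set (singular_values A) = (\<lambda>z. sqrt (Re z)) ` {z. poly (char_poly (mat_adjoint A * A)) z = 0}"
    and "length (singular_values A) = q" and "sorted (rev (singular_values A))"
proof -
  have deg: "degree (char_poly (mat_adjoint A * A)) = q" "coeff (char_poly (mat_adjoint A * A)) q = 1"
    using degree_monic_char_poly[OF gram_carrier[OF assms]] by auto
  hence nz: "char_poly (mat_adjoint A * A) \<noteq> 0" by auto
  show "set (singular_values A) = (\<lambda>z. sqrt (Re z)) ` {z. poly (char_poly (mat_adjoint A * A)) z = 0}"
    unfolding singular_values_def using nz by simp
  have "size (mset (singular_values A)) = q"
    unfolding singular_values_def by (simp add: size_proots_complex deg)
  thus "length (singular_values A) = q" by simp
  show "sorted (rev (singular_values A))" unfolding singular_values_def by simp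
qed

lemma sigma_eigenvector:
  assumes "A \<in> carrier_mat p q" "1 \<le> i" "i \<le> q"
  obtains v where "v \<in> carrier_vec q" "0 < nrm2 v" "(sigma A i)^2 * nrm2 v = nrm2 (A *\<^sub>v v)" "0 \<le> sigma A i"
proof -
  have "sigma A i \<in> set (singular_values A)"
    unfolding sigma_def using assms singular_values_set(2)[OF assms(1)] by (intro nth_mem) auto
  then obtain z where z: "sigma A i = sqrt (Re z)" "poly (char_poly (mat_adjoint A * A)) z = 0"
    unfolding singular_values_set(1)[OF assms(1)] by auto
  from gram_eigenvalue[OF assms(1) z(2)] show ?thesis using that z(1) by (metis real_sqrt_ge_zero real_sqrt_pow2)
qed

lemma sigma_nonneg: "A \<in> carrier_mat p q \<Longrightarrow> 1 \<le> i \<Longrightarrow> i \<le> q \<Longrightarrow> 0 \<le> sigma A i"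
  using sigma_eigenvector by metis

lemma sigma_decreasing:
  assumes "A \<in> carrier_mat p q" "1 \<le> i" "i \<le> j" "j \<le> q"
  shows "sigma A j \<le> sigma A i"
  unfolding sigma_def using singular_values_set(2,3)[OF assms(1)] assms
  by (intro sorted_rev_nth_mono) auto

lemma sigma_le:
  assumes "A \<in> carrier_mat p q" "1 \<le> i" "i \<le> q"
    and "\<And>v. v \<in> carrier_vec q \<Longrightarrow> nrm2 (A *\<^sub>v v) \<le> M * nrm2 v"
  shows "sigma A i \<le> sqrt M"
proof -
  obtain v where v: "v \<in> carrier_vec q" "0 < nrm2 v" "(sigma A i)^2 * nrm2 v = nrm2 (A *\<^sub>v v)"
    using sigma_eigenvector[OF assms(1-3)] by metis
  hence "(sigma A i)^2 * nrm2 v \<le> M * nrm2 v" using assms(4) by simp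
  hence "(sigma A i)^2 \<le> M" using v(2) by simp
  thus ?thesis using real_le_rsqrt by blast
qed

lemma sigma_ge:
  assumes "A \<in> carrier_mat p q" "1 \<le> i" "i \<le> q"
    and "\<And>v. v \<in> carrier_vec q \<Longrightarrow> m * nrm2 v \<le> nrm2 (A *\<^sub>v v)"
  shows "sqrt m \<le> sigma A i"
proof -
  obtain v where v: "v \<in> carrier_vec q" "0 < nrm2 v" "(sigma A i)^2 * nrm2 v = nrm2 (A *\<^sub>v v)" "0 \<le> sigma A i"
    using sigma_eigenvector[OF assms(1-3)] by metis
  hence "m * nrm2 v \<le> (sigma A i)^2 * nrm2 v" using assms(4) by simp
  hence "m \<le> (sigma A i)^2" using v(2) by simp
  thus ?thesis using v(4) by (intro real_le_lsqrt) auto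
qed

text \<open>Both sides are \<open>X^q\<close> times the determinant of the block matrix with rows \<open>(X, A)\<close> and \<open>(B, 1)\<close>. Eliminating \<open>B\<close> by
columns gives the left-hand side; scaling the second block row by \<open>X\<close> and eliminating \<open>B\<close> by rows gives the right-hand side.\<close>

lemma char_poly_mult_swap:
  fixes A B :: "'a :: idom mat"
  assumes A: "A \<in> carrier_mat p q" and B: "B \<in> carrier_mat q p"
  shows "monom 1 q * char_poly (A * B) = monom 1 p * char_poly (B * A)"
proof -
  define X where "X = [:0, 1 :: 'a:]"
  define C where "C = (\<lambda>M. map_mat (\<lambda>a. [:a :: 'a:]) M)"
  have CA: "C A \<in> carrier_mat p q" and CB: "C B \<in> carrier_mat q p" using A B by (auto simp: C_def)
  have hom: "C (M * M') = C M * C M'" if "M \<in> carrier_mat a b" "M' \<in> carrier_mat b c" for M M' a b c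
  proof -
    interpret semiring_hom "\<lambda>a. [:a :: 'a:]" by unfold_locales (auto simp: one_pCons)
    show ?thesis unfolding C_def by (rule mat_hom_mult[OF that])
  qed
  have cp: "char_poly M = det (X \<cdot>\<^sub>m 1\<^sub>m n - C M)" if "M \<in> carrier_mat n n" for M n
    unfolding char_poly_defs X_def C_def
    by (rule arg_cong[where f = det], rule eq_matI) (use that in auto)
  let ?M = "four_block_mat (X \<cdot>\<^sub>m 1\<^sub>m p) (C A) (C B) (1\<^sub>m q)"
  let ?P = "four_block_mat (1\<^sub>m p) (0\<^sub>m p q) (- C B) (1\<^sub>m q)"
  let ?Q = "four_block_mat (1\<^sub>m p) (0\<^sub>m p q) (- C B) (X \<cdot>\<^sub>m 1\<^sub>m q)"
  have M: "?M \<in> carrier_mat (p + q) (p + q)" and P: "?P \<in> carrier_mat (p + q) (p + q)"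
    and Q: "?Q \<in> carrier_mat (p + q) (p + q)" using CA CB by auto
  have car: "X \<cdot>\<^sub>m 1\<^sub>m p - C A * C B \<in> carrier_mat p p" "X \<cdot>\<^sub>m 1\<^sub>m q - C B * C A \<in> carrier_mat q q"
    using CA CB by (auto intro!: minus_carrier_mat)
  have mono: "X \<cdot>\<^sub>m 1\<^sub>m n * M = X \<cdot>\<^sub>m M" if "M \<in> carrier_mat n k" for M n k
    using that by (metis mult_smult_assoc_mat one_carrier_mat left_mult_one_mat)
  have e1: "?M * ?P = four_block_mat (X \<cdot>\<^sub>m 1\<^sub>m p - C A * C B) (C A) (0\<^sub>m q p) (1\<^sub>m q)"
  proof -
    have "C A * - C B = - (C A * C B)" using CA CB by (intro eq_matI) auto
    hence "X \<cdot>\<^sub>m 1\<^sub>m p * 1\<^sub>m p + C A * - C B = X \<cdot>\<^sub>m 1\<^sub>m p - C A * C B" using CA CB by (intro eq_matI) auto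
    moreover have "X \<cdot>\<^sub>m 1\<^sub>m p * 0\<^sub>m p q + C A * 1\<^sub>m q = C A" using CA by simp
    moreover have "C B * 1\<^sub>m p + 1\<^sub>m q * - C B = 0\<^sub>m q p" using CB by (intro eq_matI) auto
    moreover have "C B * 0\<^sub>m p q + 1\<^sub>m q * 1\<^sub>m q = 1\<^sub>m q" using CB by simp
    ultimately show ?thesis
      by (subst mult_four_block_mat[of _ p p _ q _ q _ _ p _ q]) (use CA CB in \<open>simp_all only: uminus_carrier_iff_mat zero_carrier_mat one_carrier_mat smult_carrier_mat\<close>)
  qed
  have "det (?M * ?P) = det (X \<cdot>\<^sub>m 1\<^sub>m p - C A * C B)"
    unfolding e1 by (subst det_four_block_mat_lower_left_zero[of _ p _ q]) (use CA CB car in simp_all)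
  also have "\<dots> = char_poly (A * B)" using cp[of "A * B" p] A B hom[OF A B] by simp
  finally have 1: "det ?M * det ?P = char_poly (A * B)" unfolding det_mult[OF M P] .
  have e2: "?Q * ?M = four_block_mat (X \<cdot>\<^sub>m 1\<^sub>m p) (C A) (0\<^sub>m q p) (X \<cdot>\<^sub>m 1\<^sub>m q - C B * C A)"
  proof -
    have "- C B * C A = - (C B * C A)" using CA CB by (intro eq_matI) auto
    hence "- C B * C A + X \<cdot>\<^sub>m 1\<^sub>m q * 1\<^sub>m q = X \<cdot>\<^sub>m 1\<^sub>m q - C B * C A" using CA CB by (intro eq_matI) auto
    moreover have "1\<^sub>m p * (X \<cdot>\<^sub>m 1\<^sub>m p) + 0\<^sub>m p q * C B = X \<cdot>\<^sub>m 1\<^sub>m p" using CB by simp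
    moreover have "1\<^sub>m p * C A + 0\<^sub>m p q * 1\<^sub>m q = C A" using CA by simp
    moreover have "- C B * (X \<cdot>\<^sub>m 1\<^sub>m p) + X \<cdot>\<^sub>m 1\<^sub>m q * C B = 0\<^sub>m q p"
    proof -
      have "- C B * (X \<cdot>\<^sub>m 1\<^sub>m p) = X \<cdot>\<^sub>m (- C B)"
        using CB mult_smult_distrib[of "- C B" q p "1\<^sub>m p" p X] by simp
      thus ?thesis using CB mono[OF CB] by (intro eq_matI) auto
    qed
    ultimately show ?thesis
      by (subst mult_four_block_mat[of _ p p _ q _ q _ _ p _ q]) (use CA CB in \<open>simp_all only: uminus_carrier_iff_mat zero_carrier_mat one_carrier_mat smult_carrier_mat\<close>)
  qed
  have "det (?Q * ?M) = det (X \<cdot>\<^sub>m 1\<^sub>m p) * det (X \<cdot>\<^sub>m 1\<^sub>m q - C B * C A)"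
    unfolding e2 by (subst det_four_block_mat_lower_left_zero[of _ p _ q]) (use CA CB car in simp_all)
  also have "\<dots> = X ^ p * char_poly (B * A)" using cp[of "B * A" q] A B hom[OF B A] by (simp add: det_smult)
  finally have 2: "det ?Q * det ?M = X ^ p * char_poly (B * A)" unfolding det_mult[OF Q M] .
  have "det ?P = 1" by (subst det_four_block_mat_upper_right_zero[of _ p _ q]) (use CB in simp_all)
  moreover have "det ?Q = X ^ q" by (subst det_four_block_mat_upper_right_zero[of _ p _ q]) (use CB in \<open>simp_all add: det_smult\<close>)
  ultimately have "X ^ q * char_poly (A * B) = X ^ p * char_poly (B * A)" using 1 2 by simp
  thus ?thesis by (simp add: X_def monom_altdef)
qed

text \<open>The eigenvalues of \<open>A\<^sup>* A\<close> are those of \<open>A A\<^sup>*\<close> together with \<open>q - p\<close> zeros, which come last in the decreasing order.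
For a matrix with fewer rows than columns this identifies its \<open>p\<close>-th singular value, which is not
controlled by the smallest eigenvalue of \<open>A\<^sup>* A\<close>.\<close>

lemma sigma_adjoint:
  assumes A: "A \<in> carrier_mat p q" and "p \<le> q" and i: "1 \<le> i" "i \<le> p"
  shows "sigma A i = sigma (mat_adjoint A) i"
proof -
  let ?G = "char_poly (mat_adjoint A * A)" and ?H = "char_poly (A * mat_adjoint A)"
  have A': "mat_adjoint A \<in> carrier_mat q p" by (rule mat_adjoint_carrier[OF A])
  have nz: "?G \<noteq> 0" "?H \<noteq> 0"
    using degree_monic_char_poly[of "mat_adjoint A * A" q] degree_monic_char_poly[of "A * mat_adjoint A" p] A A' by auto
  have "monom 1 p * (monom 1 (q - p) * ?H) = monom 1 p * ?G"
    using char_poly_mult_swap[OF A A'] assms(2) by (simp add: mult_monom flip: mult.assoc)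
  hence "?G = monom 1 (q - p) * ?H" by simp
  also have "monom 1 (q - p) = [:0, 1 :: complex:] ^ (q - p)" by (simp add: monom_altdef)
  finally have "proots ?G = repeat_mset (q - p) {#0#} + proots ?H"
    using nz by (simp add: proots_mult proots_power)
  hence "image_mset (\<lambda>z. sqrt (Re z)) (proots ?G) = replicate_mset (q - p) 0 + image_mset (\<lambda>z. sqrt (Re z)) (proots ?H)"
    by (simp add: repeat_mset_replicate_mset flip: replicate_mset_def) 
  hence "singular_values A = rev (sorted_list_of_multiset (replicate_mset (q - p) 0 + image_mset (\<lambda>z. sqrt (Re z)) (proots ?H)))"
    by (simp add: singular_values_def)
  also have "sorted_list_of_multiset (replicate_mset (q - p) 0 + image_mset (\<lambda>z. sqrt (Re z)) (proots ?H)) = 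
     replicate (q - p) 0 @ rev (singular_values (mat_adjoint A))"
  proof -
    let ?ys = "replicate (q - p) 0 @ rev (singular_values (mat_adjoint A))"
    have "mset ?ys = replicate_mset (q - p) 0 + image_mset (\<lambda>z. sqrt (Re z)) (proots ?H)"
      by (simp add: singular_values_def mat_adjoint_adjoint[OF A])
    moreover have "0 \<le> x" if x: "x \<in> set (singular_values (mat_adjoint A))" for x
    proof -
      obtain z where "x = sqrt (Re z)" "poly (char_poly (mat_adjoint (mat_adjoint A) * mat_adjoint A)) z = 0"
        using x unfolding singular_values_set(1)[OF A'] by blast
      thus ?thesis using gram_eigenvalue[OF A'] by (metis real_sqrt_ge_zero)
    qed
    hence "sorted ?ys" using singular_values_set(3)[OF A'] by (auto simp: sorted_append)
    hence "sort ?ys = ?ys" by (rule sorted_sort_id)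
    ultimately show ?thesis using sorted_list_of_multiset_mset[of ?ys] by simp
  qed
  finally have "singular_values A = singular_values (mat_adjoint A) @ replicate (q - p) 0" by simp
  moreover have "i - 1 < p" using i by auto
  ultimately show ?thesis unfolding sigma_def using singular_values_set(2)[OF A'] by (simp add: nth_append)
qed

lemma cip_swap: "dim_vec x = dim_vec y \<Longrightarrow> cip x y = cnj (cip y x)"
  by (simp add: cip_def mult.commute)

lemma cip_diff: "u \<in> carrier_vec n \<Longrightarrow> w \<in> carrier_vec n \<Longrightarrow> cip x (u - w) = cip x u - cip x w"
  by (simp add: cip_def sum_subtractf right_diff_distrib)

lemma pow_mat_add:
  assumes H: "H \<in> carrier_mat n n"
  shows "H ^\<^sub>m (j + k) = H ^\<^sub>m j * H ^\<^sub>m k"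
proof (induction k)
  case 0
  show ?case unfolding add_0_right pow_mat.simps carrier_matD(1)[OF H]
    by (rule right_mult_one_mat[OF pow_carrier_mat[OF H], symmetric])
next
  case (Suc k)
  have "H ^\<^sub>m (j + Suc k) = H ^\<^sub>m (j + k) * H" by (simp only: add_Suc_right pow_mat.simps)
  also have "\<dots> = H ^\<^sub>m j * (H ^\<^sub>m k * H)"
    unfolding Suc by (rule assoc_mult_mat[OF pow_carrier_mat[OF H] pow_carrier_mat[OF H] H])
  finally show ?case unfolding pow_mat.simps .
qed

lemma hermitian_pow:
  assumes H: "H \<in> carrier_mat n n"
    and herm: "\<And>x y. x \<in> carrier_vec n \<Longrightarrow> y \<in> carrier_vec n \<Longrightarrow> cip x (H *\<^sub>v y) = cip (H *\<^sub>v x) y"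
    and "x \<in> carrier_vec n" "y \<in> carrier_vec n"
  shows "cip x (H ^\<^sub>m k *\<^sub>v y) = cip (H ^\<^sub>m k *\<^sub>v x) y"
  using assms(3,4)
proof (induction k arbitrary: x y)
  case 0
  thus ?case using H by auto
next
  case (Suc k)
  have Hk: "H ^\<^sub>m k \<in> carrier_mat n n" by (rule pow_carrier_mat[OF H])
  have comm: "H ^\<^sub>m Suc k = H * H ^\<^sub>m k" using pow_mat_add[OF H, of 1 k] H by simp
  have Hy: "H *\<^sub>v y \<in> carrier_vec n" using H Suc.prems by auto
  have Hx: "H ^\<^sub>m k *\<^sub>v x \<in> carrier_vec n" by (rule mult_mat_vec_carrier[OF Hk Suc.prems(1)])
  have "cip x (H ^\<^sub>m Suc k *\<^sub>v y) = cip x (H ^\<^sub>m k *\<^sub>v (H *\<^sub>v y))"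
    using assoc_mult_mat_vec[OF Hk H Suc.prems(2)] by simp
  also have "\<dots> = cip (H ^\<^sub>m k *\<^sub>v x) (H *\<^sub>v y)" by (rule Suc.IH[OF Suc.prems(1) Hy])
  also have "\<dots> = cip (H *\<^sub>v (H ^\<^sub>m k *\<^sub>v x)) y" by (rule herm[OF Hx Suc.prems(2)])
  also have "H *\<^sub>v (H ^\<^sub>m k *\<^sub>v x) = H ^\<^sub>m Suc k *\<^sub>v x"
    unfolding comm by (rule assoc_mult_mat_vec[OF H Hk Suc.prems(1), symmetric])
  finally show ?case .
qed

lemma nrm2_pow_bounded:
  assumes H: "H \<in> carrier_mat n n" and "spectral_radius H < 1" and v: "v \<in> carrier_vec n"
  shows "\<exists>C. \<forall>k. nrm2 (H ^\<^sub>m k *\<^sub>v v) \<le> C"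
proof -
  obtain c where c: "\<And>k. norm_bound (H ^\<^sub>m k) c"
    using spectral_radius_jnf_norm_bound_less_1_upper_triangular[OF assms(1,2)] by blast
  have "nrm2 (H ^\<^sub>m k *\<^sub>v v) \<le> (\<Sum>i<n. (\<Sum>j<n. c * cmod (v $ j))^2)" for k
  proof -
    have Hk: "H ^\<^sub>m k \<in> carrier_mat n n" by (rule pow_carrier_mat[OF H])
    have entry: "(P *\<^sub>v v) $ i = (\<Sum>j<n. P $$ (i, j) * v $ j)" if "i < n" "P \<in> carrier_mat n n" for i P
      using that v by (auto simp: scalar_prod_def lessThan_atLeast0 intro!: sum.cong)
    have "cmod ((H ^\<^sub>m k *\<^sub>v v) $ i) \<le> (\<Sum>j<n. c * cmod (v $ j))" if "i < n" for i
    proof -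
      have "(H ^\<^sub>m k *\<^sub>v v) $ i = (\<Sum>j<n. (H ^\<^sub>m k) $$ (i, j) * v $ j)"
        by (rule entry[OF that Hk])
      also have "cmod \<dots> \<le> (\<Sum>j<n. c * cmod (v $ j))"
      proof (rule sum_norm_le)
        fix j assume "j \<in> {..<n}"
        hence "cmod ((H ^\<^sub>m k) $$ (i, j)) \<le> c"
          using c[of k] that unfolding norm_bound_def carrier_matD[OF Hk] by blast
        thus "cmod ((H ^\<^sub>m k) $$ (i, j) * v $ j) \<le> c * cmod (v $ j)"
          unfolding norm_mult by (rule mult_right_mono) simp
      qed
      finally show ?thesis .
    qed
    moreover have "dim_vec (H ^\<^sub>m k *\<^sub>v v) = n"
      by (rule carrier_vecD[OF mult_mat_vec_carrier[OF Hk v]])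
    ultimately show ?thesis unfolding nrm2_def by (simp only:) (intro sum_mono power_mono, simp_all)
  qed
  thus ?thesis by blast
qed

text \<open>Let \<open>t\<close> be the normalised absolute value of the form at \<open>v\<close>. Repeated use of the Cauchy-Schwarz inequality gives
\<open>t^(2^(k+1)) \<le> |H^(2^k) v|\<^sup>2 / |v|\<^sup>2\<close>, and the right-hand side stays bounded because the powers of \<open>H\<close> do.
Hence \<open>t \<le> 1\<close>.\<close>

lemma hermitian_spectral_radius_less_1:
  assumes H: "H \<in> carrier_mat n n"
    and herm: "\<And>x y. x \<in> carrier_vec n \<Longrightarrow> y \<in> carrier_vec n \<Longrightarrow> cip x (H *\<^sub>v y) = cip (H *\<^sub>v x) y"
    and sr: "spectral_radius H < 1" and v: "v \<in> carrier_vec n" and pos: "0 < nrm2 v"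
  shows "cmod (cip v (H *\<^sub>v v)) \<le> nrm2 v"
proof (rule ccontr)
  assume not_le: "\<not> ?thesis"
  define t where "t = cmod (cip v (H *\<^sub>v v)) / nrm2 v"
  have t: "t > 1" using not_le pos by (simp add: t_def)
  define a where "a k = nrm2 (H ^\<^sub>m (2 ^ k) *\<^sub>v v) / nrm2 v" for k
  have Hk: "H ^\<^sub>m k \<in> carrier_mat n n" "H ^\<^sub>m k *\<^sub>v v \<in> carrier_vec n" for k
    by (rule pow_carrier_mat[OF H], rule mult_mat_vec_carrier[OF pow_carrier_mat[OF H] v])
  have ratio: "(x / c)^2 \<le> y / c" if "x\<^sup>2 \<le> c * y" "0 < c" for x y c :: real
    using that by (simp add: power2_eq_square field_simps)
  have step: "(a k)^2 \<le> a (Suc k)" for k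
  proof -
    let ?w = "H ^\<^sub>m (2 ^ k) *\<^sub>v v"
    have "cip v (H ^\<^sub>m (2 ^ Suc k) *\<^sub>v v) = cip v (H ^\<^sub>m (2 ^ k) *\<^sub>v ?w)"
      unfolding power_Suc mult_2 pow_mat_add[OF H] by (simp only: assoc_mult_mat_vec[OF Hk(1) Hk(1) v])
    also have "\<dots> = of_real (nrm2 ?w)"
      by (rule trans[OF hermitian_pow[OF H _ v Hk(2)] cip_self], rule herm)
    finally have "(nrm2 ?w)^2 = (cmod (cip v (H ^\<^sub>m (2 ^ Suc k) *\<^sub>v v)))^2"
      using nrm2_nonneg[of ?w] by simp
    also have "\<dots> \<le> nrm2 v * nrm2 (H ^\<^sub>m (2 ^ Suc k) *\<^sub>v v)"
      using v Hk(2) by (rule cip_cauchy_schwarz)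
    finally show ?thesis unfolding a_def by (rule ratio[OF _ pos])
  qed
  have "t\<^sup>2 \<le> a 0"
  proof -
    have "(cmod (cip v (H *\<^sub>v v)))^2 \<le> nrm2 v * nrm2 (H *\<^sub>v v)"
      using v H by (intro cip_cauchy_schwarz) auto
    hence "t\<^sup>2 \<le> nrm2 (H *\<^sub>v v) / nrm2 v" unfolding t_def by (rule ratio[OF _ pos])
    moreover have "H ^\<^sub>m (2 ^ 0) = H" using H by simp
    ultimately show ?thesis unfolding a_def by (simp only:)
  qed
  have lower: "t ^ (2 ^ Suc k) \<le> a k" for k
  proof (induction k)
    case 0
    thus ?case using \<open>t\<^sup>2 \<le> a 0\<close> by simp
  next
    case (Suc k)
    have "t ^ (2 ^ Suc (Suc k)) = (t ^ (2 ^ Suc k))^2"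
      unfolding power_mult[symmetric] by (simp only: power_Suc2)
    also have "\<dots> \<le> (a k)^2" using t by (intro power_mono Suc) simp
    finally show ?case using step[of k] by simp
  qed
  obtain C where C: "\<And>k. nrm2 (H ^\<^sub>m k *\<^sub>v v) \<le> C" using nrm2_pow_bounded[OF H sr v] by blast
  obtain k where k: "C / nrm2 v < t ^ k" using real_arch_pow[OF t] by blast
  have "t ^ k \<le> t ^ (2 ^ Suc k)"
  proof (rule power_increasing)
    have "k < 2 ^ k" by (rule less_exp)
    also have "(2::nat) ^ k \<le> 2 ^ Suc k" by simp
    finally show "k \<le> 2 ^ Suc k" by (rule less_imp_le)
  qed (use t in simp)
  also have "\<dots> \<le> a k" by (rule lower)
  also have "\<dots> \<le> C / nrm2 v" unfolding a_def by (rule divide_right_mono[OF C nrm2_nonneg])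
  finally show False using k by linarith
qed

text \<open>Scaling by \<open>1 / r\<close> for \<open>r > \<rho>\<close> makes the spectral radius less than one; then \<open>r\<close> tends to \<open>\<rho>\<close>.\<close>

lemma hermitian_rayleigh_le:
  assumes H: "H \<in> carrier_mat n n"
    and herm: "\<And>x y. x \<in> carrier_vec n \<Longrightarrow> y \<in> carrier_vec n \<Longrightarrow> cip x (H *\<^sub>v y) = cip (H *\<^sub>v x) y"
    and ev: "\<And>z. eigenvalue H z \<Longrightarrow> cmod z \<le> \<rho>"
    and v: "v \<in> carrier_vec n" and pos: "0 < nrm2 v"
  shows "cmod (cip v (H *\<^sub>v v)) \<le> \<rho> * nrm2 v"
proof -
  have n: "n > 0" using v pos by (cases n) (auto simp: nrm2_def)
  have rho: "0 \<le> \<rho>"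
    using spectrum_non_empty[OF H n] ev unfolding spectrum_def by (metis Collect_empty_eq norm_ge_zero order_trans)
  have "cmod (cip v (H *\<^sub>v v)) \<le> r * nrm2 v" if r: "r > \<rho>" for r
  proof -
    have r0: "r > 0" using r rho by simp
    define c where "c = complex_of_real (1 / r)"
    define H' where "H' = c \<cdot>\<^sub>m H"
    have H': "H' \<in> carrier_mat n n" using H by (simp add: H'_def)
    have H'v: "H' *\<^sub>v x = c \<cdot>\<^sub>v (H *\<^sub>v x)" if "x \<in> carrier_vec n" for x
      using H that unfolding H'_def by (intro eq_vecI) auto
    have herm': "cip x (H' *\<^sub>v y) = cip (H' *\<^sub>v x) y" if "x \<in> carrier_vec n" "y \<in> carrier_vec n" for x y
    proof -
      have "cip (c \<cdot>\<^sub>v (H *\<^sub>v x)) y = c * cip (H *\<^sub>v x) y"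
        using H that by (auto simp: cip_def sum_distrib_left c_def mult_ac intro!: sum.cong)
      thus ?thesis using that H herm by (simp add: H'v cip_smult[of _ n])
    qed
    have "spectral_radius H' < 1"
    proof -
      obtain z where z: "z \<in> spectrum H'" "spectral_radius H' = cmod z"
        using spectral_radius_mem_max(1)[OF H' n] by blast
      then obtain x where x: "x \<in> carrier_vec n" "x \<noteq> 0\<^sub>v n" "H' *\<^sub>v x = z \<cdot>\<^sub>v x"
        unfolding spectrum_def eigenvalue_def eigenvector_def using H' by auto
      have "H *\<^sub>v x = (of_real r * z) \<cdot>\<^sub>v x"
      proof -
        have "of_real r \<cdot>\<^sub>v (c \<cdot>\<^sub>v (H *\<^sub>v x)) = of_real r \<cdot>\<^sub>v (z \<cdot>\<^sub>v x)" using x H'v by simp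
        thus ?thesis using r0 by (simp add: smult_smult_assoc c_def)
      qed
      hence "eigenvalue H (of_real r * z)"
        unfolding eigenvalue_def eigenvector_def using x H by auto
      hence "r * cmod z \<le> \<rho>" using ev r0 by (force simp: norm_mult)
      also have "\<rho> < r * 1" using r by simp
      finally have "cmod z < 1" using r0 by simp
      thus ?thesis using z by simp
    qed
    from hermitian_spectral_radius_less_1[OF H' herm' this v pos]
    have "cmod (c * cip v (H *\<^sub>v v)) \<le> nrm2 v" using v H by (simp add: H'v cip_smult[of _ n])
    thus ?thesis using r0 by (simp add: c_def norm_mult norm_divide field_simps)
  qed
  hence "cmod (cip v (H *\<^sub>v v)) / nrm2 v \<le> r" if "r > \<rho>" for r
    using that pos by (simp add: field_simps)
  hence "cmod (cip v (H *\<^sub>v v)) / nrm2 v \<le> \<rho>" by (rule dense_ge)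
  thus ?thesis using pos by (simp add: field_simps)
qed

lemma gram_eigenvalue_sigma:
  assumes A: "A \<in> carrier_mat p q" and z: "eigenvalue (mat_adjoint A * A) z"
  shows "z = of_real (Re z)" "(sigma A q)^2 \<le> Re z" "Re z \<le> (sigma A 1)^2"
proof -
  have z': "poly (char_poly (mat_adjoint A * A)) z = 0"
    using z eigenvalue_root_char_poly[OF gram_carrier[OF A]] by simp
  obtain v where v: "z = of_real (Re z)" "0 \<le> Re z" using gram_eigenvalue[OF A z'] by metis
  show "z = of_real (Re z)" by (rule v)
  have "sqrt (Re z) \<in> set (singular_values A)" unfolding singular_values_set(1)[OF A] using z' by blast
  then obtain i where i: "i < q" "sqrt (Re z) = sigma A (Suc i)"
    unfolding sigma_def using singular_values_set(2)[OF A] by (auto simp: in_set_conv_nth)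
  have "sigma A q \<le> sqrt (Re z)" "sqrt (Re z) \<le> sigma A 1" "0 \<le> sigma A q"
    unfolding i(2) using i(1) sigma_decreasing[OF A] sigma_nonneg[OF A] by auto
  thus "(sigma A q)^2 \<le> Re z" "Re z \<le> (sigma A 1)^2"
    using v(2) by (metis power_mono real_sqrt_pow2) (metis \<open>sqrt (Re z) \<le> sigma A 1\<close> v(2) power_mono real_sqrt_ge_zero real_sqrt_pow2)
qed

lemma nrm2_mult_le_sigma_max:
  assumes A: "A \<in> carrier_mat p q" and v: "v \<in> carrier_vec q" "0 < nrm2 v"
  shows "nrm2 (A *\<^sub>v v) \<le> (sigma A 1)^2 * nrm2 v"
proof -
  let ?H = "mat_adjoint A * A"
  have "cmod (cip v (?H *\<^sub>v v)) \<le> (sigma A 1)^2 * nrm2 v"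
  proof (rule hermitian_rayleigh_le[OF gram_carrier[OF A] _ _ v])
    show "cip x (?H *\<^sub>v y) = cip (?H *\<^sub>v x) y" if "x \<in> carrier_vec q" "y \<in> carrier_vec q" for x y
    proof -
      have "cip x (?H *\<^sub>v y) = cip (A *\<^sub>v x) (A *\<^sub>v y)" by (rule cip_gram[OF A that])
      also have "\<dots> = cnj (cip (A *\<^sub>v y) (A *\<^sub>v x))" by (rule cip_swap) simp
      also have "\<dots> = cnj (cip y (?H *\<^sub>v x))" using cip_gram[OF A that(2,1)] by simp
      also have "\<dots> = cip (?H *\<^sub>v x) y" using gram_carrier[OF A] that by (intro cip_swap[symmetric]) auto
      finally show ?thesis .
    qed
    fix z assume z: "eigenvalue ?H z"
    note g = gram_eigenvalue_sigma[OF A z]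
    have "0 \<le> Re z" using g(2) by (meson order_trans zero_le_power2)
    hence "cmod z = Re z" using g(1) by (metis abs_of_nonneg norm_of_real)
    thus "cmod z \<le> (sigma A 1)^2" using g(3) by simp
  qed
  thus ?thesis using cip_gram[OF A v(1) v(1)] nrm2_nonneg by (simp add: cip_self)
qed

text \<open>The Rayleigh bound is applied to \<open>c - A\<^sup>* A\<close>, where \<open>c\<close> is the largest eigenvalue of \<open>A\<^sup>* A\<close>; the eigenvalues of
this matrix lie between \<open>0\<close> and \<open>c\<close> minus the smallest eigenvalue.\<close>

lemma nrm2_mult_ge_sigma_min:
  assumes A: "A \<in> carrier_mat p q" and v: "v \<in> carrier_vec q" "0 < nrm2 v"
  shows "(sigma A q)^2 * nrm2 v \<le> nrm2 (A *\<^sub>v v)"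
proof -
  let ?H = "mat_adjoint A * A"
  define c where "c = (sigma A 1)^2"
  define M where "M = of_real c \<cdot>\<^sub>m 1\<^sub>m q - ?H"
  have H: "?H \<in> carrier_mat q q" by (rule gram_carrier[OF A])
  have M: "M \<in> carrier_mat q q" unfolding M_def using H by (auto intro: minus_carrier_mat)
  have Mv: "M *\<^sub>v x = of_real c \<cdot>\<^sub>v x - ?H *\<^sub>v x" if "x \<in> carrier_vec q" for x
  proof -
    have "M *\<^sub>v x = (of_real c \<cdot>\<^sub>m 1\<^sub>m q) *\<^sub>v x - ?H *\<^sub>v x"
      unfolding M_def using that H by (intro minus_mult_distrib_mat_vec) auto
    also have "(of_real c \<cdot>\<^sub>m 1\<^sub>m q) *\<^sub>v x = of_real c \<cdot>\<^sub>v x" using that by (intro eq_vecI) auto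
    finally show ?thesis .
  qed
  have cipM: "cip x (M *\<^sub>v y) = of_real c * cip x y - cip (A *\<^sub>v x) (A *\<^sub>v y)"
    if "x \<in> carrier_vec q" "y \<in> carrier_vec q" for x y
  proof -
    have "cip x (M *\<^sub>v y) = of_real c * cip x y - cip x (?H *\<^sub>v y)"
      using that H cip_diff[of "of_real c \<cdot>\<^sub>v y" q "?H *\<^sub>v y" x] cip_smult[OF that]
      unfolding Mv[OF that(2)] by auto
    thus ?thesis using cip_gram[OF A that] by simp
  qed
  have "cmod (cip v (M *\<^sub>v v)) \<le> (c - (sigma A q)\<^sup>2) * nrm2 v"
  proof (rule hermitian_rayleigh_le[OF M _ _ v])
    show "cip x (M *\<^sub>v y) = cip (M *\<^sub>v x) y" if "x \<in> carrier_vec q" "y \<in> carrier_vec q" for x y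
    proof -
      note sw = cip_swap
      have "cip (M *\<^sub>v x) y = cnj (cip y (M *\<^sub>v x))" using M that by (intro sw) auto
      also have "\<dots> = of_real c * cnj (cip y x) - cnj (cip (A *\<^sub>v y) (A *\<^sub>v x))"
        using cipM[OF that(2,1)] by simp
      also have "\<dots> = cip x (M *\<^sub>v y)"
        using cipM[OF that] sw[of x y] sw[of "A *\<^sub>v x" "A *\<^sub>v y"] that by simp
      finally show ?thesis by simp
    qed
    fix z assume "eigenvalue M z"
    then obtain x where x: "x \<in> carrier_vec q" "x \<noteq> 0\<^sub>v q" "M *\<^sub>v x = z \<cdot>\<^sub>v x"
      unfolding eigenvalue_def eigenvector_def carrier_matD(1)[OF M] by blast
    have Hx: "?H *\<^sub>v x \<in> carrier_vec q" by (rule mult_mat_vec_carrier[OF H x(1)])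
    have "?H *\<^sub>v x = (of_real c - z) \<cdot>\<^sub>v x"
    proof (rule eq_vecI)
      fix i assume i: "i < dim_vec ((of_real c - z) \<cdot>\<^sub>v x)"
      have "(of_real c \<cdot>\<^sub>v x - ?H *\<^sub>v x) $ i = (z \<cdot>\<^sub>v x) $ i" using Mv[OF x(1)] x(3) by simp
      moreover have "(of_real c \<cdot>\<^sub>v x - w) $ i = of_real c * x $ i - w $ i" if "w \<in> carrier_vec q" for w
        using that i x(1) by simp
      ultimately have "of_real c * x $ i - (?H *\<^sub>v x) $ i = z * x $ i" using i Hx x(1) by simp
      thus "(?H *\<^sub>v x) $ i = ((of_real c - z) \<cdot>\<^sub>v x) $ i" using i by (simp add: algebra_simps)
    qed (use Hx x in \<open>simp_all only: carrier_vecD index_smult_vec\<close>)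
    hence "eigenvalue ?H (of_real c - z)"
      unfolding eigenvalue_def eigenvector_def carrier_matD(1)[OF H] using x(1,2) by blast
    note g = gram_eigenvalue_sigma[OF A this]
    have "z = of_real (Re z)" using g(1) by (simp add: complex_eq_iff)
    hence "cmod z = \<bar>Re z\<bar>" by (metis norm_of_real)
    thus "cmod z \<le> c - (sigma A q)\<^sup>2" using g(2,3) by (auto simp: c_def)
  qed
  moreover have "Re (cip v (M *\<^sub>v v)) = c * nrm2 v - nrm2 (A *\<^sub>v v)"
    unfolding cipM[OF v(1) v(1)] cip_self by simp
  ultimately have "c * nrm2 v - nrm2 (A *\<^sub>v v) \<le> (c - (sigma A q)\<^sup>2) * nrm2 v"
    using complex_Re_le_cmod[of "cip v (M *\<^sub>v v)"] by linarith
  thus ?thesis by (simp add: algebra_simps)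
qed

section \<open>Vandermonde matrices with phases\<close>

text \<open>The adjoint matrix inherits the lower bound. If \<open>f\<close> interpolates \<open>z\<close> on \<open>I\<close> and has coefficients \<open>C\<close>, then
\<open>|z|\<^sup>2\<close> is the inner product of \<open>C\<close> with the adjoint matrix applied to \<open>z\<close>, and \<open>|C|\<^sup>2\<close> is at most
\<open>(1 + lagr_energy) / N\<close> times \<open>|z|\<^sup>2\<close>, so the Cauchy-Schwarz inequality gives the claim.\<close>

lemma dual_node_values:
  assumes I: "I \<subseteq> {..<N}" and q: "card I \<le> q"
  shows "real N / (1 + lagr_energy N b I) * (\<Sum>i\<in>I. (cmod (z i))^2)
    \<le> (\<Sum>\<tau><q. (cmod (\<Sum>i\<in>I. cnj (node N b i) ^ \<tau> * z i))^2)"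
proof -
  have fin: "finite I" using I finite_subset by blast
  let ?Z = "\<Sum>i\<in>I. (cmod (z i))^2" and ?E = "1 + lagr_energy N b I"
  let ?g = "\<lambda>\<tau>. \<Sum>i\<in>I. cnj (node N b i) ^ \<tau> * z i"
  have E: "?E > 0" using lagr_energy_nonneg[of N b I] by linarith
  define f where "f = (\<Sum>s\<in>I. smult (z s) (lagr N b I s))"
  have val: "poly f (node N b i) = z i" if "i \<in> I" for i
    unfolding f_def using poly_lagr_sum_node[OF I subset_refl that] that by simp
  have pf: "poly f w = (\<Sum>\<tau><card I. coeff f \<tau> * w ^ \<tau>)" for w
  proof (cases "I = {}")
    case False
    show ?thesis unfolding f_def by (rule poly_coeff_sum[OF degree_lagr_sum[OF fin False subset_refl]])
  qed (simp add: f_def)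
  let ?C = "\<Sum>\<tau><card I. (cmod (coeff f \<tau>))^2"
  have C: "real N * ?C \<le> ?E * ?Z"
  proof -
    have "(\<Sum>i\<in>I. (cmod (\<Sum>t<card I. coeff f t * node N b i ^ t))^2) = ?Z"
      by (intro sum.cong refl) (simp add: val flip: pf)
    thus ?thesis using coefficient_norm_le_node_values[OF I, of "coeff f" b] by simp
  qed
  have "complex_of_real ?Z = (\<Sum>i\<in>I. z i * cnj (z i))" unfolding of_real_sum by (simp only: complex_norm_square)
  also have "\<dots> = (\<Sum>i\<in>I. \<Sum>\<tau><card I. coeff f \<tau> * (node N b i ^ \<tau> * cnj (z i)))"
  proof (intro sum.cong refl)
    fix i assume "i \<in> I"
    hence "z i * c = (\<Sum>\<tau><card I. coeff f \<tau> * node N b i ^ \<tau>) * c" for c using val[of i] by (simp flip: pf)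
    thus "z i * cnj (z i) = (\<Sum>\<tau><card I. coeff f \<tau> * (node N b i ^ \<tau> * cnj (z i)))"
      by (simp only: sum_distrib_right mult.assoc)
  qed
  also have "\<dots> = (\<Sum>\<tau><card I. \<Sum>i\<in>I. coeff f \<tau> * (node N b i ^ \<tau> * cnj (z i)))" by (rule sum.swap)
  also have "\<dots> = (\<Sum>\<tau><card I. coeff f \<tau> * cnj (?g \<tau>))" by (simp add: sum_distrib_left)
  finally have "cmod (complex_of_real ?Z) = cmod (\<Sum>\<tau><card I. coeff f \<tau> * cnj (?g \<tau>))" by simp
  hence "?Z = cmod (\<Sum>\<tau><card I. coeff f \<tau> * cnj (?g \<tau>))" by (simp only: norm_of_real abs_of_nonneg sum_nonneg zero_le_power2)
  also have "\<dots> \<le> (\<Sum>\<tau><card I. cmod (coeff f \<tau>) * cmod (?g \<tau>))"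
    by (rule sum_norm_le) (simp add: norm_mult del: cnj_sum)
  finally have "?Z\<^sup>2 \<le> (\<Sum>\<tau><card I. cmod (coeff f \<tau>) * cmod (?g \<tau>))^2"
    by (intro power_mono sum_nonneg) auto
  also have "\<dots> \<le> ?C * (\<Sum>\<tau><card I. (cmod (?g \<tau>))^2)" by (rule Cauchy_Schwarz_ineq_sum)
  also have "\<dots> \<le> ?C * (\<Sum>\<tau><q. (cmod (?g \<tau>))^2)"
    using q by (intro mult_left_mono sum_mono2 sum_nonneg) auto
  finally have CS: "?Z\<^sup>2 \<le> ?C * (\<Sum>\<tau><q. (cmod (?g \<tau>))^2)" .
  show ?thesis
  proof (cases "?Z = 0")
    case True
    thus ?thesis by (auto intro!: sum_nonneg)
  next
    case False
    have Z: "?Z > 0" using False sum_nonneg[of I "\<lambda>i. (cmod (z i))^2"] by auto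
    let ?G = "\<Sum>\<tau><q. (cmod (?g \<tau>))^2"
    have G: "0 \<le> ?G" by (intro sum_nonneg) auto
    have "real N * ?Z * ?Z \<le> real N * (?C * ?G)" using CS by (simp only: mult.assoc power2_eq_square) (intro mult_left_mono, auto)
    also have "\<dots> = (real N * ?C) * ?G" by (simp only: mult.assoc)
    also have "\<dots> \<le> (?E * ?Z) * ?G" by (rule mult_right_mono[OF C G])
    finally have "(real N * ?Z) * ?Z \<le> (?E * ?G) * ?Z" by (simp only: mult_ac)
    hence "real N * ?Z \<le> ?E * ?G" using Z by (rule mult_right_le_imp_le)
    thus ?thesis using E by (simp add: divide_le_eq mult.commute)
  qed
qed

text \<open>Up to permutations of rows and columns and unimodular row factors, \<open>A\<close> evaluates polynomials of degree below \<open>q\<close> at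
the nodes in \<open>I\<close>.\<close>

locale phased_vandermonde =
  fixes N b q :: nat and I :: "nat set" and A :: "complex mat" and r c :: "nat \<Rightarrow> nat" and \<phi> :: "nat \<Rightarrow> complex"
  assumes I: "I \<subseteq> {..<N}" "I \<noteq> {}" and q: "1 \<le> q" "q \<le> N"
    and A: "A \<in> carrier_mat (card I) q"
    and r: "bij_betw r I {..<card I}" and c: "bij_betw c {..<q} {..<q}"
    and \<phi>: "\<And>i. cmod (\<phi> i) = 1"
    and entry: "\<And>i \<tau>. i \<in> I \<Longrightarrow> \<tau> < q \<Longrightarrow> A $$ (r i, c \<tau>) = \<phi> i * node N b i ^ \<tau>"
begin

lemma finite_I: "finite I" using I finite_subset by blast

lemma card_I: "1 \<le> card I" "card I \<le> N" using finite_I I card_mono[OF _ I(1)] by (auto simp: Suc_le_eq card_gt_0_iff)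

lemma nrm2_cols: "v \<in> carrier_vec q \<Longrightarrow> nrm2 v = (\<Sum>\<tau><q. (cmod (v $ c \<tau>))^2)"
  unfolding nrm2_def by (simp add: sum.reindex_bij_betw[OF c, of "\<lambda>j. (cmod (v $ j))^2"])

lemma nrm2_rows: "w \<in> carrier_vec (card I) \<Longrightarrow> nrm2 w = (\<Sum>i\<in>I. (cmod (w $ r i))^2)"
  unfolding nrm2_def by (simp add: sum.reindex_bij_betw[OF r, of "\<lambda>j. (cmod (w $ j))^2"])

lemma nrm2_mult:
  assumes v: "v \<in> carrier_vec q"
  shows "nrm2 (A *\<^sub>v v) = (\<Sum>i\<in>I. (cmod (\<Sum>\<tau><q. v $ c \<tau> * node N b i ^ \<tau>))^2)"
proof -
  have "nrm2 (A *\<^sub>v v) = (\<Sum>i\<in>I. (cmod ((A *\<^sub>v v) $ r i))^2)" using A v by (intro nrm2_rows) auto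
  also have "\<dots> = (\<Sum>i\<in>I. (cmod (\<Sum>\<tau><q. v $ c \<tau> * node N b i ^ \<tau>))^2)"
  proof (intro sum.cong refl)
    fix i assume i: "i \<in> I"
    have ri: "r i < card I" using bij_betwE[OF r] i by auto
    have "(A *\<^sub>v v) $ r i = (\<Sum>j<q. A $$ (r i, j) * v $ j)"
      using A v ri by (auto simp: scalar_prod_def lessThan_atLeast0 intro!: sum.cong)
    also have "\<dots> = (\<Sum>\<tau><q. A $$ (r i, c \<tau>) * v $ c \<tau>)"
      by (rule sum.reindex_bij_betw[OF c, symmetric])
    also have "\<dots> = \<phi> i * (\<Sum>\<tau><q. v $ c \<tau> * node N b i ^ \<tau>)"
      unfolding sum_distrib_left by (intro sum.cong refl) (simp add: entry[OF i])
    finally show "(cmod ((A *\<^sub>v v) $ r i))^2 = (cmod (\<Sum>\<tau><q. v $ c \<tau> * node N b i ^ \<tau>))^2"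
      by (simp add: norm_mult \<phi>)
  qed
  finally show ?thesis .
qed

lemma nrm2_adjoint_mult:
  assumes w: "w \<in> carrier_vec (card I)"
  shows "nrm2 (mat_adjoint A *\<^sub>v w) = (\<Sum>\<tau><q. (cmod (\<Sum>i\<in>I. cnj (node N b i) ^ \<tau> * (cnj (\<phi> i) * w $ r i)))^2)"
proof -
  have A': "mat_adjoint A \<in> carrier_mat q (card I)" by (rule mat_adjoint_carrier[OF A])
  have "nrm2 (mat_adjoint A *\<^sub>v w) = (\<Sum>\<tau><q. (cmod ((mat_adjoint A *\<^sub>v w) $ c \<tau>))^2)"
    by (rule nrm2_cols[OF mult_mat_vec_carrier[OF A' w]])
  also have "\<dots> = (\<Sum>\<tau><q. (cmod (\<Sum>i\<in>I. cnj (node N b i) ^ \<tau> * (cnj (\<phi> i) * w $ r i)))^2)"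
  proof (intro sum.cong refl)
    fix \<tau> assume "\<tau> \<in> {..<q}"
    hence \<tau>: "\<tau> < q" by simp
    have ct: "c \<tau> < q" using bij_betwE[OF c] \<tau> by auto
    have "(mat_adjoint A *\<^sub>v w) $ c \<tau> = (\<Sum>k<card I. mat_adjoint A $$ (c \<tau>, k) * w $ k)"
      using A' w ct by (auto simp: scalar_prod_def lessThan_atLeast0 intro!: sum.cong)
    also have "\<dots> = (\<Sum>i\<in>I. mat_adjoint A $$ (c \<tau>, r i) * w $ r i)"
      by (rule sum.reindex_bij_betw[OF r, symmetric])
    also have "\<dots> = (\<Sum>i\<in>I. cnj (node N b i) ^ \<tau> * (cnj (\<phi> i) * w $ r i))"
    proof (intro sum.cong refl)
      fix i assume i: "i \<in> I"
      have ri: "r i < card I" using bij_betwE[OF r] i by auto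
      show "mat_adjoint A $$ (c \<tau>, r i) * w $ r i = cnj (node N b i) ^ \<tau> * (cnj (\<phi> i) * w $ r i)"
        by (simp add: mat_adjoint_index[OF A ct ri] entry[OF i \<tau>])
    qed
    finally show "(cmod ((mat_adjoint A *\<^sub>v w) $ c \<tau>))^2 = (cmod (\<Sum>i\<in>I. cnj (node N b i) ^ \<tau> * (cnj (\<phi> i) * w $ r i)))^2"
      by simp
  qed
  finally show ?thesis .
qed

lemma sigma_max_le: "sigma A 1 \<le> sqrt (real N)"
proof (rule sigma_le[OF A])
  fix v :: "complex vec" assume v: "v \<in> carrier_vec q"
  have "nrm2 (A *\<^sub>v v) \<le> (\<Sum>i<N. (cmod (\<Sum>\<tau><q. v $ c \<tau> * node N b i ^ \<tau>))^2)"
    unfolding nrm2_mult[OF v] using I by (intro sum_mono2) auto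
  also have "\<dots> = real N * nrm2 v" using parseval[of N q "\<lambda>\<tau>. v $ c \<tau>" b] q by (simp add: nrm2_cols[OF v])
  finally show "nrm2 (A *\<^sub>v v) \<le> real N * nrm2 v" .
qed (use q in auto)

text \<open>With at least as many rows as columns, the rows outside \<open>I'\<close> are dropped. With fewer rows, the adjoint matrix has the
same singular value, and its rows beyond the first \<open>card I\<close> are dropped.\<close>

lemma sigma_min_ge:
  assumes I': "I' \<subseteq> I" "card I' = min (card I) q"
  shows "sqrt (real N / (1 + lagr_energy N b I')) \<le> sigma A (min (card I) q)"
proof (cases "q \<le> card I")
  case True
  have E: "1 + lagr_energy N b I' > 0" using lagr_energy_nonneg[of N b I'] by linarith
  have cI': "card I' = q" using I' True by simp
  have "sqrt (real N / (1 + lagr_energy N b I')) \<le> sigma A q"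
  proof (rule sigma_ge[OF A])
    fix v :: "complex vec" assume v: "v \<in> carrier_vec q"
    have "real N * nrm2 v \<le> (1 + lagr_energy N b I') * (\<Sum>i\<in>I'. (cmod (\<Sum>\<tau><q. v $ c \<tau> * node N b i ^ \<tau>))^2)"
      using coefficient_norm_le_node_values[of I' N "\<lambda>\<tau>. v $ c \<tau>" b] I I'(1) by (simp add: cI' nrm2_cols[OF v])
    also have "\<dots> \<le> (1 + lagr_energy N b I') * nrm2 (A *\<^sub>v v)"
      unfolding nrm2_mult[OF v] using I' E finite_I by (intro mult_left_mono sum_mono2) auto
    finally show "real N / (1 + lagr_energy N b I') * nrm2 v \<le> nrm2 (A *\<^sub>v v)"
      using E by (simp add: divide_le_eq mult.commute)
  qed (use q in auto)
  thus ?thesis using True by (simp add: min_def)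
next
  case False
  hence m: "min (card I) q = card I" by simp
  have I'I: "I' = I" using I' finite_I unfolding m by (intro card_subset_eq) auto
  have A': "mat_adjoint A \<in> carrier_mat q (card I)" by (rule mat_adjoint_carrier[OF A])
  have "sqrt (real N / (1 + lagr_energy N b I)) \<le> sigma (mat_adjoint A) (card I)"
  proof (rule sigma_ge[OF A'])
    fix w :: "complex vec" assume w: "w \<in> carrier_vec (card I)"
    have "nrm2 w = (\<Sum>i\<in>I. (cmod (cnj (\<phi> i) * w $ r i))^2)"
      unfolding nrm2_rows[OF w] by (simp add: norm_mult \<phi>)
    thus "real N / (1 + lagr_energy N b I) * nrm2 w \<le> nrm2 (mat_adjoint A *\<^sub>v w)"
      unfolding nrm2_adjoint_mult[OF w] using False dual_node_values[OF I(1), of q b "\<lambda>i. cnj (\<phi> i) * w $ r i"] by simp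
  qed (use card_I in auto)
  also have "sigma (mat_adjoint A) (card I) = sigma A (card I)"
    using False card_I by (intro sigma_adjoint[OF A, symmetric]) auto
  finally show ?thesis unfolding m I'I .
qed

lemma log_cond_eq:
  assumes "0 < sigma A (min (card I) q)"
  shows "log_ereal (cond_number A) = ereal (ln (sigma A 1) - ln (sigma A (min (card I) q)))"
    and "sigma A (min (card I) q) \<le> sigma A 1"
proof -
  have d: "dim_row A = card I" "dim_col A = q" using A by auto
  show le: "sigma A (min (card I) q) \<le> sigma A 1"
    by (rule sigma_decreasing[OF A]) (use card_I q in auto)
  show "log_ereal (cond_number A) = ereal (ln (sigma A 1) - ln (sigma A (min (card I) q)))"
    unfolding cond_number_def log_ereal_def d Let_def using assms le by (simp add: ln_div)
qed

lemma log_cond_le: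
  assumes I': "I' \<subseteq> I" "card I' = min (card I) q"
  shows "0 < sigma A (min (card I) q)"
    and "log_ereal (cond_number A) \<le> ereal (ln (1 + lagr_energy N b I') / 2)"
proof -
  have E: "1 + lagr_energy N b I' > 0" using lagr_energy_nonneg[of N b I'] by linarith
  have N: "real N > 0" using q by simp
  let ?m = "sqrt (real N / (1 + lagr_energy N b I'))"
  have m: "0 < ?m" using E N by simp
  note ge = sigma_min_ge[OF I']
  show pos: "0 < sigma A (min (card I) q)" using m ge by linarith
  have "ln (sigma A 1) \<le> ln (sqrt (real N))"
    using log_cond_eq(2)[OF pos] pos sigma_max_le N by (subst ln_le_cancel_iff) auto
  moreover have "ln ?m \<le> ln (sigma A (min (card I) q))" using m pos ge by (subst ln_le_cancel_iff) auto
  moreover have "ln (sqrt (real N)) = ln (real N) / 2" using N by (simp add: ln_sqrt)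
  moreover have "ln ?m = (ln (real N) - ln (1 + lagr_energy N b I')) / 2"
    using N E by (simp add: ln_sqrt ln_div)
  ultimately show "log_ereal (cond_number A) \<le> ereal (ln (1 + lagr_energy N b I') / 2)"
    unfolding log_cond_eq(1)[OF pos] by simp
qed

text \<open>The test vector is the constant polynomial \<open>1\<close>.\<close>

lemma sigma_max_ge: "real (card I) \<le> (sigma A 1)^2"
proof -
  define v where "v = vec q (\<lambda>j. if j = c 0 then 1 else 0 :: complex)"
  have v: "v \<in> carrier_vec q" by (simp add: v_def)
  have inj: "inj_on c {..<q}" using c by (rule bij_betw_imp_inj_on)
  have vc: "v $ c \<tau> = (if \<tau> = 0 then 1 else 0)" if "\<tau> < q" for \<tau>
  proof -
    have "c \<tau> < q" using bij_betwE[OF c] that by auto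
    moreover have "c \<tau> = c 0 \<longleftrightarrow> \<tau> = 0" using inj that q by (auto simp: inj_on_def)
    ultimately show ?thesis by (simp add: v_def)
  qed
  have one: "nrm2 v = 1" 
  proof -
    have "nrm2 v = (\<Sum>\<tau><q. if \<tau> = 0 then 1 else 0)" unfolding nrm2_cols[OF v] by (intro sum.cong refl) (simp add: vc)
    thus ?thesis using q by simp
  qed
  have "nrm2 (A *\<^sub>v v) = (\<Sum>i\<in>I. 1)"
    unfolding nrm2_mult[OF v]
  proof (intro sum.cong refl)
    fix i
    have "(\<Sum>\<tau><q. v $ c \<tau> * node N b i ^ \<tau>) = (\<Sum>\<tau><q. if \<tau> = 0 then 1 else 0)"
      by (intro sum.cong refl) (simp add: vc)
    thus "(cmod (\<Sum>\<tau><q. v $ c \<tau> * node N b i ^ \<tau>))^2 = 1" using q by simp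
  qed
  thus ?thesis using nrm2_mult_le_sigma_max[OF A v] one by simp
qed

lemma sigma_min_le:
  assumes v: "0 < (\<Sum>\<tau><q. (cmod (v \<tau>))^2)"
    and le: "(\<Sum>i\<in>I. (cmod (\<Sum>\<tau><q. v \<tau> * node N b i ^ \<tau>))^2) \<le> M\<^sup>2 * (\<Sum>\<tau><q. (cmod (v \<tau>))^2)"
    and M: "0 \<le> M"
  shows "sigma A q \<le> M"
proof -
  define w where "w = vec q (\<lambda>j. v (inv_into {..<q} c j))"
  have w: "w \<in> carrier_vec q" by (simp add: w_def)
  have wc: "w $ c \<tau> = v \<tau>" if "\<tau> < q" for \<tau>
    using bij_betwE[OF c] that bij_betw_inv_into_left[OF c] by (auto simp: w_def)
  have nw: "nrm2 w = (\<Sum>\<tau><q. (cmod (v \<tau>))^2)" unfolding nrm2_cols[OF w] by (intro sum.cong refl) (simp add: wc)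
  have "(sigma A q)^2 * nrm2 w \<le> nrm2 (A *\<^sub>v w)"
    using nrm2_mult_ge_sigma_min[OF A w] v nw by simp
  also have "\<dots> = (\<Sum>i\<in>I. (cmod (\<Sum>\<tau><q. v \<tau> * node N b i ^ \<tau>))^2)"
    unfolding nrm2_mult[OF w] by (simp add: wc)
  also have "\<dots> \<le> M\<^sup>2 * nrm2 w" using le by (simp only: nw)
  finally have "(sigma A q)^2 \<le> M\<^sup>2" by (rule mult_right_le_imp_le) (use v nw in simp)
  thus ?thesis using M by (rule power2_le_imp_le)
qed

end

section \<open>Submatrices of the Fourier matrix\<close>

lemma pick_bij_betw:
  assumes "finite S"
  shows "bij_betw (pick S) {..<card S} S"
proof -
  have sub: "S \<subseteq> pick S ` {..<card S}"
  proof
    fix i assume i: "i \<in> S"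
    have "card {a \<in> S. a < i} < card S" using assms i by (intro psubset_card_mono) auto
    moreover have "pick S (card {a \<in> S. a < i}) = i" by (rule pick_card_in_set[OF i])
    ultimately show "i \<in> pick S ` {..<card S}" by force
  qed
  have eq: "pick S ` {..<card S} = S" using sub pick_in_set_le by auto
  hence "inj_on (pick S) {..<card S}" by (intro eq_card_imp_inj_on) auto
  with eq show ?thesis by (simp add: bij_betw_def)
qed

lemma inj_on_shift_mod: "inj_on (\<lambda>i. (b + i) mod N) {..<N :: nat}"
proof (rule inj_onI)
  fix i j assume *: "i \<in> {..<N}" "j \<in> {..<N}" "(b + i) mod N = (b + j) mod N"
  hence "[i = j] (mod N)" using cong_add_lcancel_nat[of b i j N] by (simp add: cong_def)
  thus "i = j" using * by (simp add: cong_def)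
qed

lemma bij_betw_diff1: "S \<subseteq> {1..N} \<Longrightarrow> bij_betw (\<lambda>s. s - 1) S ((\<lambda>s. s - 1) ` S)" for S :: "nat set"
proof (rule inj_on_imp_bij_betw, rule inj_onI)
  fix s t :: nat assume "S \<subseteq> {1..N}" "s \<in> S" "t \<in> S" "s - 1 = t - 1"
  moreover from this have "1 \<le> s" "1 \<le> t" by auto
  ultimately show "s = t" by linarith
qed

lemma diff1_image_subset: "S \<subseteq> {1..N} \<Longrightarrow> (\<lambda>s. s - 1) ` S \<subseteq> {..<N :: nat}"
proof (rule image_subsetI)
  fix s assume "S \<subseteq> {1..N}" "s \<in> S"
  hence "s \<in> {1..N}" by blast
  thus "s - 1 \<in> {..<N}" by auto
qed

lemma cis_mod_eq:
  assumes "N > 0" "x mod N = y mod N"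
  shows "cis (2 * pi * real x / real N) = cis (2 * pi * real y / real N)"
proof -
  have red: "cis (2 * pi * real x / real N) = cis (2 * pi * real (x mod N) / real N)" for x
  proof -
    have "real x = real (x div N) * real N + real (x mod N)"
      by (simp flip: of_nat_mult of_nat_add)
    hence "2 * pi * real x / real N = 2 * pi * real (x div N) + 2 * pi * real (x mod N) / real N"
      using assms(1) by (simp add: field_simps)
    thus ?thesis using cis_multiple_2pi[of "real (x div N)"] by (simp flip: cis_mult)
  qed
  show ?thesis using red[of x] red[of y] assms(2) by simp
qed

text \<open>If \<open>a\<close> starts the interval in the one-based convention, then \<open>a - 1\<close> starts it in the zero-based one; adding \<open>N\<close>
avoids a truncated subtraction for \<open>a = 0\<close>.\<close>

lemma cyclically_contiguous_shift:
  assumes "S \<subseteq> {1..N}" "S \<noteq> {}" "cyclically_contiguous N S" "N \<ge> 1"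
  obtains b where "(\<lambda>s. s - 1) ` S = (\<lambda>i. (b + i) mod N) ` {..<card S}"
proof -
  obtain a l where S: "S = {s \<in> {1..N}. \<exists>i<l. [s = a + i] (mod N)}"
    using assms(3) unfolding cyclically_contiguous_def by blast
  define b where "b = a + N - 1"
  define n where "n = min l N"
  have eq: "(\<lambda>s. s - 1) ` S = (\<lambda>i. (b + i) mod N) ` {..<n}"
  proof (intro equalityI subsetI)
    fix x assume "x \<in> (\<lambda>s. s - 1) ` S"
    then obtain s i where s: "x = s - 1" "s \<in> {1..N}" "i < l" "[s = a + i] (mod N)" unfolding S by auto
    have "(b + i mod N) mod N = (b + i) mod N" by (rule mod_add_right_eq)
    also have "\<dots> = (a + i + (N - 1)) mod N" using assms(4) by (simp add: b_def algebra_simps)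
    also have "\<dots> = (s + (N - 1)) mod N" using s(4) unfolding cong_def by (metis mod_add_left_eq)
    also have "s + (N - 1) = x + N" using s(1,2) assms(4) by auto
    also have "(x + N) mod N = x"
    proof -
      have "x < N" using s(1,2) by auto
      thus ?thesis by simp
    qed
    finally have "x = (b + i mod N) mod N" by simp
    moreover have "i mod N < n" using s(3) assms(4) unfolding n_def by (auto intro: le_less_trans[OF mod_less_eq_dividend])
    ultimately show "x \<in> (\<lambda>i. (b + i) mod N) ` {..<n}" by blast
  next
    fix x assume "x \<in> (\<lambda>i. (b + i) mod N) ` {..<n}"
    then obtain i where i: "i < n" "x = (b + i) mod N" by auto
    have "(x + 1) mod N = (b + i + 1) mod N" unfolding i(2) by (rule mod_add_left_eq)
    also have "b + i + 1 = (a + i) + N" using assms(4) by (simp add: b_def)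
    also have "\<dots> mod N = (a + i) mod N" by simp
    finally have "[x + 1 = a + i] (mod N)" by (simp add: cong_def)
    moreover have "x < N" using i(2) assms(4) by simp
    ultimately have "x + 1 \<in> S" unfolding S using i(1) by (auto simp: n_def)
    thus "x \<in> (\<lambda>s. s - 1) ` S" by force
  qed
  have "card S = card ((\<lambda>s. s - 1) ` S)" by (rule bij_betw_same_card[OF bij_betw_diff1[OF assms(1)]])
  also have "\<dots> = n" unfolding eq
    by (subst card_image[OF inj_on_subset[OF inj_on_shift_mod]]) (auto simp: n_def)
  finally show ?thesis using eq that by simp
qed

text \<open>If row and column indices are shifted by \<open>b\<close> and \<open>a\<close>, the entry at \<open>(i, \<tau>)\<close> is the \<open>N\<close>-th root of unity with
exponent \<open>(b + i) (a + \<tau>)\<close>. The shift of the columns contributes the row phase with exponent \<open>(b + i) a\<close>.\<close>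

lemma fourier_submatrix_phased_vandermonde:
  assumes N: "N \<ge> 1" and S: "S \<subseteq> {1..N}" "S \<noteq> {}" and T: "T \<subseteq> {1..N}" "T \<noteq> {}"
    and I: "I \<subseteq> {..<N}" "(\<lambda>s. s - 1) ` S = (\<lambda>i. (b + i) mod N) ` I"
    and a: "(\<lambda>s. s - 1) ` T = (\<lambda>\<tau>. (a + \<tau>) mod N) ` {..<card T}"
  obtains r c \<phi> where "phased_vandermonde N b (card T) I (submat (fourier_mat N) S T) r c \<phi>" "card I = card S"
proof -
  let ?S = "(\<lambda>s. s - 1) ` S" and ?T = "(\<lambda>s. s - 1) ` T"
  let ?A = "submat (fourier_mat N) S T"
  define \<phi> where "\<phi> i = cis (2 * pi * real ((b + i) * a) / real N)" for i
  have SN: "?S \<subseteq> {..<N}" "finite ?S" and TN: "?T \<subseteq> {..<N}" "finite ?T"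
    using diff1_image_subset[OF S(1)] diff1_image_subset[OF T(1)] finite_subset[OF S(1)] finite_subset[OF T(1)] by simp_all
  have bS: "bij_betw (\<lambda>i. (b + i) mod N) I ?S"
    unfolding I(2) by (intro inj_on_imp_bij_betw inj_on_subset[OF inj_on_shift_mod I(1)])
  have q: "card T \<le> N" using card_mono[OF _ T(1)] by simp
  have bT: "bij_betw (\<lambda>\<tau>. (a + \<tau>) mod N) {..<card T} ?T"
    unfolding a by (intro inj_on_imp_bij_betw inj_on_subset[OF inj_on_shift_mod]) (use q in auto)
  have cS: "card ?S = card I" using bij_betw_same_card[OF bS] by simp
  have cS': "card ?S = card S" using bij_betw_same_card[OF bij_betw_diff1[OF S(1)]] by simp
  have cT: "card ?T = card T" using bij_betw_same_card[OF bT] by simp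
  define r where "r = inv_into {..<card I} (pick ?S) \<circ> (\<lambda>i. (b + i) mod N)"
  define c where "c = inv_into {..<card T} (pick ?T) \<circ> (\<lambda>\<tau>. (a + \<tau>) mod N)"
  have pS: "bij_betw (pick ?S) {..<card I} ?S" by (rule pick_bij_betw[OF SN(2), unfolded cS])
  have pT: "bij_betw (pick ?T) {..<card T} ?T" by (rule pick_bij_betw[OF TN(2), unfolded cT])
  have r: "bij_betw r I {..<card I}" unfolding r_def by (rule bij_betw_trans[OF bS bij_betw_inv_into[OF pS]])
  have c: "bij_betw c {..<card T} {..<card T}" unfolding c_def by (rule bij_betw_trans[OF bT bij_betw_inv_into[OF pT]])
  have rows: "{i. i < dim_row (fourier_mat N) \<and> i \<in> ?S} = ?S" "{j. j < dim_col (fourier_mat N) \<and> j \<in> ?T} = ?T"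
    using SN TN by (auto simp: fourier_mat_def)
  have A: "?A \<in> carrier_mat (card I) (card T)"
    by (rule carrier_matI) (simp_all only: submat_def dim_submatrix rows cS cT)
  have "phased_vandermonde N b (card T) I ?A r c \<phi>"
  proof
    show "I \<noteq> {}" using I(2) S(2) by auto
    show "1 \<le> card T" using T TN(2) finite_subset[OF T(1)] by (simp add: Suc_le_eq card_gt_0_iff)
    show "cmod (\<phi> i) = 1" for i by (simp add: \<phi>_def)
    fix i \<tau> assume i: "i \<in> I" and \<tau>: "\<tau> < card T"
    have ri: "r i < card I" using bij_betwE[OF r] i by auto
    have ct: "c \<tau> < card T" using bij_betwE[OF c] \<tau> by auto
    have ps: "pick ?S (r i) = (b + i) mod N"
    proof -
      have "(b + i) mod N \<in> ?S" unfolding I(2) using i by (rule imageI)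
      thus ?thesis unfolding r_def comp_apply by (rule bij_betw_inv_into_right[OF pS])
    qed
    have pt: "pick ?T (c \<tau>) = (a + \<tau>) mod N"
    proof -
      have "(a + \<tau>) mod N \<in> ?T" unfolding a using \<tau> by blast
      thus ?thesis unfolding c_def comp_apply by (rule bij_betw_inv_into_right[OF pT])
    qed
    have "?A $$ (r i, c \<tau>) = fourier_mat N $$ (pick ?S (r i), pick ?T (c \<tau>))"
      unfolding submat_def by (rule submatrix_index) (simp_all only: rows cS cT ri ct)
    also have "\<dots> = exp (2 * of_real pi * \<i> * of_nat ((b + i) mod N) * of_nat ((a + \<tau>) mod N) / of_nat N)"
      unfolding ps pt using N by (simp add: fourier_mat_def)
    also have "\<dots> = cis (2 * pi * real (((b + i) mod N) * ((a + \<tau>) mod N)) / real N)"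
      unfolding cis_conv_exp by (rule arg_cong[where f = exp]) (simp add: mult_ac)
    also have "\<dots> = cis (2 * pi * real ((b + i) * (a + \<tau>)) / real N)"
      using N by (intro cis_mod_eq) (simp_all add: mod_mult_eq)
    also have "\<dots> = \<phi> i * node N b i ^ \<tau>"
      unfolding \<phi>_def node_def Complex.DeMoivre cis_mult
      by (rule arg_cong[where f = cis]) (use N in \<open>simp add: field_simps\<close>)
    finally show "?A $$ (r i, c \<tau>) = \<phi> i * node N b i ^ \<tau>" .
  qed (use I q A r c in auto)
  thus ?thesis using that cS cS' by metis
qed

lemma catalan_bounds: "8 / 9 \<le> catalan_const" "catalan_const \<le> 1"
proof -
  define a where "a n = 1 / (2 * real n + 1) ^ 2" for n
  have cat: "catalan_const = (\<Sum>i. (- 1) ^ i * a i)" by (simp add: catalan_const_def a_def)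
  have dec: "a (Suc n) \<le> a n" "0 \<le> a n" for n
    unfolding a_def by (auto intro!: divide_left_mono power_mono)
  have lim: "a \<longlonglongrightarrow> 0"
  proof (rule tendsto_sandwich[OF _ _ tendsto_const lim_inverse_n'])
    show "\<forall>\<^sub>F n in sequentially. a n \<le> 1 / real n"
    proof (rule eventually_sequentiallyI[of 1])
      fix n :: nat assume n: "1 \<le> n"
      have "real n * 1 \<le> (2 * real n + 1) * (2 * real n + 1)" by (intro mult_mono) auto
      thus "a n \<le> 1 / real n" unfolding a_def power2_eq_square using n by (intro divide_left_mono) auto
    qed
  qed (simp add: dec)
  note L = summable_Leibniz'[OF lim dec(2,1)]
  have "(\<Sum>i<2 * 1. (- 1) ^ i * a i) = 8 / 9" by (simp add: a_def numeral_2_eq_2)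
  thus "8 / 9 \<le> catalan_const" using L(2)[of 1] unfolding cat by simp
  have "(\<Sum>i<2 * 0 + 1. (- 1) ^ i * a i) = 1" by (simp add: a_def)
  thus "catalan_const \<le> 1" using L(4)[of 0] unfolding cat by simp
qed

text \<open>The first summand covers the upper bounds for the energy. The second covers the loss \<open>exp (- 400)\<close> of the test vector
and, for \<open>N < 400\<close>, the whole main term.\<close>

definition log_cond_const :: real where "log_cond_const = ln (2 + (148 * exp 6)^2) / 2 + 402"

lemma energy_const_pos: "0 < 2 + (148 * exp 6 :: real)^2"
  by (intro add_pos_nonneg) auto

lemma log_energy_bound:
  fixes E m x :: real
  assumes "0 \<le> E" "0 < m" and "E \<le> (148 * exp (x + 6))^2 / m" and m: "m \<le> 2 * (exp x)^2"
  shows "ln (1 + E) / 2 \<le> x - ln m / 2 + log_cond_const"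
proof -
  have "E \<le> (exp x)^2 * (148 * exp 6)^2 / m" using assms(3) by (simp add: exp_add power_mult_distrib mult_ac)
  moreover have "1 \<le> (exp x)^2 * 2 / m" using m assms(2) by (simp add: mult.commute)
  ultimately have "1 + E \<le> (exp x)^2 * (2 + (148 * exp 6)^2) / m"
    by (simp add: distrib_left add_divide_distrib)
  hence "ln (1 + E) \<le> ln ((exp x)^2 * (2 + (148 * exp 6)^2) / m)"
    using assms(1,2) energy_const_pos by (subst ln_le_cancel_iff) (auto intro!: mult_pos_pos divide_pos_pos)
  also have "\<dots> = ln ((exp x)^2 * (2 + (148 * exp 6)^2)) - ln m"
    by (rule ln_divide_pos[OF mult_pos_pos[OF _ energy_const_pos] assms(2)]) simp
  also have "ln ((exp x)^2 * (2 + (148 * exp 6)^2)) = 2 * x + ln (2 + (148 * exp 6)^2)"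
    using energy_const_pos by (simp only: ln_mult_pos exp_gt_zero zero_less_power ln_realpow ln_exp of_nat_numeral)
  finally show ?thesis unfolding log_cond_const_def by simp
qed

lemma log_energy_le:
  assumes "I \<subseteq> {..<N}"
  shows "ln (1 + lagr_energy N b I) / 2 \<le> main_term N + log_cond_const"
proof -
  let ?x = "main_term N"
  have "0 \<le> ?x" using catalan_bounds by simp
  hence "1 \<le> exp ?x" by simp
  hence "1 \<le> (exp ?x)^2" by (rule one_le_power)
  hence one: "1 \<le> 2 * (exp ?x)^2" by linarith
  have "(2 * exp (?x + 2))^2 \<le> (148 * exp (?x + 6))^2" by (intro power_mono mult_mono) auto
  hence E: "lagr_energy N b I \<le> (148 * exp (?x + 6))^2 / 1" using lagr_energy_le[OF assms, of b] by simp
  have "ln (1 + lagr_energy N b I) / 2 \<le> ?x - ln 1 / 2 + log_cond_const"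
    by (rule log_energy_bound[OF lagr_energy_nonneg _ E one]) simp
  thus ?thesis by simp
qed

lemma log_energy_interval_le:
  assumes n: "n \<le> N" and N: "N > 0"
  shows "ln (1 + lagr_energy N b {..<n}) / 2 \<le> main_term N - ln (real N) / 2 + log_cond_const"
proof (rule log_energy_bound[OF lagr_energy_nonneg _ lagr_energy_interval_le[OF n N]])
  let ?x = "main_term N"
  have "2 * (8 / 9) * real N / 4 \<le> ?x"
    using catalan_bounds pi_less_4 by (intro frac_le mult_right_mono mult_left_mono mult_nonneg_nonneg) auto
  moreover have "1 + 2 * ?x \<le> (exp ?x)^2" unfolding exp_double[symmetric] by (rule exp_ge_add_one_self)
  moreover have "m \<le> 2 * e" if "2 * (8 / 9) * m / 4 \<le> y" "1 + 2 * y \<le> e" "0 \<le> m" for m y e :: real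
    using that by linarith
  ultimately show "real N \<le> 2 * (exp ?x)^2" by simp
qed (use N in simp)

lemma log_cond_const_ge: "402 \<le> log_cond_const"
  unfolding log_cond_const_def by (auto intro!: ln_ge_zero)

text \<open>For large \<open>N\<close> the constant polynomial bounds the largest singular value from below and \<open>central_test_vector\<close> bounds
the smallest one from above. For \<open>N < 400\<close> the main term is at most \<open>400\<close>, and the logarithm of a condition
number is nonnegative.\<close>

lemma log_cond_half_lower:
  assumes V: "phased_vandermonde N b n {..<n} A r c \<phi>" and n: "real N / 2 \<le> real n" "real n \<le> real N / 2 + 1"
  shows "\<exists>L. log_ereal (cond_number A) = ereal L \<and> main_term N - ln (real N) / 2 - log_cond_const \<le> L"
proof -
  interpret phased_vandermonde N b n "{..<n}" A r c \<phi> by (rule V)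
  let ?x = "main_term N"
  have N: "N > 0" using q by simp
  have mn: "min (card {..<n}) n = n" by simp
  have pos: "0 < sigma A n" using log_cond_le(1)[of "{..<n}"] by simp
  have eq: "log_ereal (cond_number A) = ereal (ln (sigma A 1) - ln (sigma A n))"
    using log_cond_eq(1) pos by simp
  have le: "sigma A n \<le> sigma A 1" using log_cond_eq(2) pos by simp
  have "?x - ln (real N) / 2 - log_cond_const \<le> ln (sigma A 1) - ln (sigma A n)"
  proof (cases "N \<ge> 400")
    case False
    have "?x \<le> 2 * 1 * real N / 2"
      using catalan_bounds pi_ge_two by (intro frac_le mult_right_mono mult_left_mono mult_nonneg_nonneg) auto
    hence "?x \<le> 400" using False by simp
    moreover have "0 \<le> ln (real N)" using N by simp
    moreover have "ln (sigma A n) \<le> ln (sigma A 1)" using pos le by (subst ln_le_cancel_iff) auto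
    ultimately show ?thesis using log_cond_const_ge by linarith
  next
    case True
    obtain v :: "nat \<Rightarrow> complex" where v: "0 < (\<Sum>t<n. (cmod (v t))^2)"
      "(\<Sum>i<n. (cmod (\<Sum>t<n. v t * node N b i ^ t))^2)
         \<le> (2 * real N / exp (?x - 400))^2 * (\<Sum>t<n. (cmod (v t))^2)"
      using central_test_vector[OF True, of n b] n by (auto simp: abs_le_iff)
    have "sigma A n \<le> 2 * real N / exp (?x - 400)" by (rule sigma_min_le[OF v]) simp
    hence "ln (sigma A n) \<le> ln (2 * real N / exp (?x - 400))" using pos N by (subst ln_le_cancel_iff) auto
    also have "\<dots> = ln 2 + ln (real N) - (?x - 400)" using N by (simp add: ln_div ln_mult)
    finally have small: "ln (sigma A n) \<le> ln 2 + ln (real N) - (?x - 400)" .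
    have s1: "0 < sigma A 1" using pos le by linarith
    have "ln (real N / 2) \<le> ln ((sigma A 1)^2)"
      using sigma_max_ge n N s1 by (subst ln_le_cancel_iff) auto
    hence "ln (real N) - ln 2 \<le> 2 * ln (sigma A 1)" using N s1 by (simp add: ln_div ln_realpow)
    hence "(ln (real N) - ln 2) / 2 \<le> ln (sigma A 1)" by simp
    moreover have "ln 2 \<le> (1 :: real)" using ln_le_minus_one[of "2 :: real"] by simp
    ultimately show ?thesis using small log_cond_const_ge by (simp add: diff_divide_distrib)
  qed
  thus ?thesis using eq by blast
qed

theorem corollary1p3:
  shows "\<exists>K::real. K > 0 \<and>
    (\<forall>(N::nat) S T. N \<ge> 1 \<longrightarrow>
      S \<subseteq> {1..N} \<longrightarrow> S \<noteq> {} \<longrightarrow>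
      T \<subseteq> {1..N} \<longrightarrow> T \<noteq> {} \<longrightarrow> cyclically_contiguous N T \<longrightarrow>
      log_ereal (cond_number (submat (fourier_mat N) S T))
        \<le> ereal (2 * catalan_const * real N / pi + K) \<and>
      (cyclically_contiguous N S \<longrightarrow>
        log_ereal (cond_number (submat (fourier_mat N) S T))
          \<le> ereal (2 * catalan_const * real N / pi - 1 / 2 * ln (real N) + K) \<and>
        (int (card S) = \<lceil>real N / 2\<rceil> \<and> int (card T) = \<lceil>real N / 2\<rceil> \<longrightarrow>
          \<bar>log_ereal (cond_number (submat (fourier_mat N) S T))
             - ereal (2 * catalan_const * real N / pi - 1 / 2 * ln (real N))\<bar> \<le> ereal K)))"
proof (intro exI[of _ log_cond_const] conjI allI impI)
  show "log_cond_const > 0" using log_cond_const_ge by linarith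
next
  fix N :: nat and S T :: "nat set"
  assume N: "N \<ge> 1" and S: "S \<subseteq> {1..N}" "S \<noteq> {}" and T: "T \<subseteq> {1..N}" "T \<noteq> {}" and ccT: "cyclically_contiguous N T"
  let ?A = "submat (fourier_mat N) S T"
  obtain a where a: "(\<lambda>s. s - 1) ` T = (\<lambda>\<tau>. (a + \<tau>) mod N) ` {..<card T}"
    by (rule cyclically_contiguous_shift[OF T ccT N])
  let ?I = "(\<lambda>s. s - 1) ` S"
  have I: "?I \<subseteq> {..<N}" by (rule diff1_image_subset[OF S(1)])
  have "(\<lambda>i. (0 + i) mod N) ` ?I = (\<lambda>i. i) ` ?I"
  proof (rule image_cong[OF refl])
    fix x assume "x \<in> ?I"
    hence "x < N" using I by blast
    thus "(0 + x) mod N = x" by simp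
  qed
  hence "?I = (\<lambda>i. (0 + i) mod N) ` ?I" by simp
  from fourier_submatrix_phased_vandermonde[OF N S T I this a]
  obtain r c \<phi> where "phased_vandermonde N 0 (card T) ?I ?A r c \<phi>" by blast
  then interpret phased_vandermonde N 0 "card T" ?I ?A r c \<phi> .
  obtain I' where I': "I' \<subseteq> ?I" "card I' = min (card ?I) (card T)"
    using obtain_subset_with_card_n[of "min (card ?I) (card T)" ?I] by auto
  have "I' \<subseteq> {..<N}" using I' I by blast
  note log_energy_le[OF this, of 0]
  with log_cond_le(2)[OF I'] show "log_ereal (cond_number ?A) \<le> ereal (main_term N + log_cond_const)"
    by (meson ereal_less_eq(3) order_trans)
next
  fix N :: nat and S T :: "nat set"
  assume N: "N \<ge> 1" and S: "S \<subseteq> {1..N}" "S \<noteq> {}" and T: "T \<subseteq> {1..N}" "T \<noteq> {}"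
    and ccT: "cyclically_contiguous N T" and ccS: "cyclically_contiguous N S"
  let ?A = "submat (fourier_mat N) S T" and ?y = "main_term N - 1 / 2 * ln (real N)"
  obtain a where a: "(\<lambda>s. s - 1) ` T = (\<lambda>\<tau>. (a + \<tau>) mod N) ` {..<card T}"
    by (rule cyclically_contiguous_shift[OF T ccT N])
  obtain b where b: "(\<lambda>s. s - 1) ` S = (\<lambda>i. (b + i) mod N) ` {..<card S}"
    by (rule cyclically_contiguous_shift[OF S ccS N])
  have SN: "{..<card S} \<subseteq> {..<N}" using card_mono[OF _ S(1)] by auto
  obtain r c \<phi> where V: "phased_vandermonde N b (card T) {..<card S} ?A r c \<phi>"
    using fourier_submatrix_phased_vandermonde[OF N S T SN b a] by blast
  then interpret phased_vandermonde N b "card T" "{..<card S}" ?A r c \<phi> .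
  have "log_ereal (cond_number ?A) \<le> ereal (ln (1 + lagr_energy N b {..<min (card S) (card T)}) / 2)"
    by (rule log_cond_le(2)) auto
  also have "\<dots> \<le> ereal (?y + log_cond_const)"
    using log_energy_interval_le[of "min (card S) (card T)" N b] q N by simp
  finally show upper: "log_ereal (cond_number ?A) \<le> ereal (?y + log_cond_const)" .
  assume half: "int (card S) = \<lceil>real N / 2\<rceil> \<and> int (card T) = \<lceil>real N / 2\<rceil>"
  hence ST: "card S = card T" by simp
  have "real N / 2 \<le> real_of_int (int (card T))" "real_of_int (int (card T)) \<le> real N / 2 + 1"
    using half by linarith+
  hence n: "real N / 2 \<le> real (card T)" "real (card T) \<le> real N / 2 + 1" by simp_all
  obtain L where L: "log_ereal (cond_number ?A) = ereal L" "main_term N - ln (real N) / 2 - log_cond_const \<le> L"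
    using log_cond_half_lower[OF V[unfolded ST] n] by blast
  have "?y - log_cond_const \<le> L" using L(2) by simp
  moreover have "L \<le> ?y + log_cond_const" using upper unfolding L(1) by simp
  ultimately have "\<bar>L - ?y\<bar> \<le> log_cond_const" by (simp add: abs_le_iff)
  thus "\<bar>log_ereal (cond_number ?A) - ereal ?y\<bar> \<le> ereal log_cond_const" unfolding L(1) by simp
qed

end
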